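(* Let $\rho=\rho_{AB}$ be a finite-dimensional bipartite quantum state. Then $$E_{d,\mathrm{DNE}}(\rho)=D^{\mathbb{SEP},\infty}(\rho\|\mathcal S)\le\widetilde E_\kappa^\infty(\rho)\le\widetilde E_\kappa(\rho).$$
   Context: $\mathcal S=\mathcal S(A\!:\!B)$ is the set of separable states on $AB$ (finite convex combinations of product states); $\mathrm{cone}(\mathcal S)=\{\lambda\sigma:\lambda\ge0,\sigma\in\mathcal S\}$; $\mathcal S_n=\mathcal S(A^n\!:\!B^n)$. $\Gamma$ is partial transposition on $B$: $(X_A\otimes Y_B)^\Gamma=X_A\otimes Y_B^{\intercal}$, extended linearly. Modified $\kappa$-entanglement: $$\widetilde E_\kappa(\rho)=\log_2\min\{\mathrm{Tr}\,S:\ -S\le\rho^\Gamma\le S,\ S\in\mathrm{cone}(\mathcal S)\},\qquad \widetilde E^\infty_\kappa(\rho)=\lim_{n\to\infty}\tfrac1n\widetilde E_\kappa(\rho^{\otimes n})$$ (the limit exists by sub-additivity of $\widetilde E_\kappa$). $\mathbb{SEP}$ is the set of POVMs $(E_x)_x$ with all $E_x\in\mathrm{cone}(\mathcal S)$. $D^{\mathbb{SEP}}(\rho\|\sigma)=\sup_{(E_x)_x\in\mathbb{SEP}}\sum_x\mathrm{Tr}[\rho E_x]\log_2\frac{\mathrm{Tr}[\rho E_x]}{\mathrm{Tr}[\sigma E_x]}$, $D^{\mathbb{SEP}}(\rho\|\mathcal S)=\inf_{\sigma\in\mathcal S}D^{\mathbb{SEP}}(\rho\|\sigma)$, $D^{\mathbb{SEP},\infty}(\rho\|\mathcal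 S)=\lim_{n\to\infty}\frac1nD^{\mathbb{SEP}}(\rho^{\otimes n}\|\mathcal S_n)$ (the limit exists). $\mathrm{DNE}(AB\to A'B')$ is the set of completely positive trace-preserving maps $\Xi$ with $\Xi(\mathcal S(A\!:\!B))\subseteq\mathcal S(A'\!:\!B')$ and $\Xi^\dagger(\mathcal S(A'\!:\!B'))\subseteq\mathrm{cone}(\mathcal S(A\!:\!B))$, where $\mathrm{Tr}[X\,\Xi(Y)]=\mathrm{Tr}[\Xi^\dagger(X)Y]$. With $\Phi_2=|\Phi_2\rangle\langle\Phi_2|$, $|\Phi_2\rangle=\frac1{\sqrt2}(|00\rangle+|11\rangle)$ on a two-qubit system $A_0B_0$, and $\varepsilon\in[0,1)$, $E^{(1),\varepsilon}_{d,\mathrm{DNE}}(\rho)=\max\{m\in\mathbb N:\inf_{\Theta\in\mathrm{DNE}(AB\to A_0^mB_0^m)}\frac12\|\Theta(\rho)-\Phi_2^{\otimes m}\|_1\le\varepsilon\}$, and $E_{d,\mathrm{DNE}}(\rho)=\lim_{\varepsilon\to0^+}\liminf_{n\to\infty}\frac1nE^{(1),\varepsilon}_{d,\mathrm{DNE}}(\rho^{\otimes n})$. *)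

theory Defs
  imports
    "HOL-Library.Extended_Real"
    "HOL-Library.Liminf_Limsup"
    "Jordan_Normal_Form.Schur_Decomposition"
begin

text \<open>
  Operators on a \<open>d\<close>-dimensional Hilbert space are elements of \<open>carrier_mat d d\<close>. An operator
  on a bipartite system with local dimensions \<open>dA\<close> and \<open>dB\<close> is an element of
  \<open>carrier_mat (dA * dB) (dA * dB)\<close>, where the row (or column) \<open>i * dB + j\<close> stands for the
  basis vector \<open>|i>|j>\<close>, with \<open>i < dA\<close> and \<open>j < dB\<close>. The local dimensions are always passed
  explicitly, since the product \<open>dA * dB\<close> does not determine the bipartition.
\<close>

definition tr :: "complex mat \<Rightarrow> complex" where
  "tr X = (\<Sum>i<dim_row X. X $$ (i, i))"

text \<open>
  The order on \<open>complex\<close> is the one of \<open>HOL-Library.Complex_Order\<close>, so \<open>0 \<le> z\<close> includes that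
  \<open>z\<close> is real; in particular positive semidefinite matrices are Hermitian.
\<close>

definition psd :: "nat \<Rightarrow> complex mat \<Rightarrow> bool" where
  "psd d X \<longleftrightarrow> X \<in> carrier_mat d d \<and> (\<forall>v \<in> carrier_vec d. 0 \<le> (X *\<^sub>v v) \<bullet>c v)"

definition lowner_le :: "nat \<Rightarrow> complex mat \<Rightarrow> complex mat \<Rightarrow> bool" where
  "lowner_le d X Y \<longleftrightarrow> X \<in> carrier_mat d d \<and> Y \<in> carrier_mat d d \<and> psd d (Y - X)"

definition states :: "nat \<Rightarrow> complex mat set" where
  "states d = {\<rho>. psd d \<rho> \<and> tr \<rho> = 1}"

definition psd_sqrt :: "nat \<Rightarrow> complex mat \<Rightarrow> complex mat" where
  "psd_sqrt d P = (THE R. psd d R \<and> R * R = P)"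

definition trace_norm :: "nat \<Rightarrow> complex mat \<Rightarrow> real" where
  "trace_norm d X = Re (tr (psd_sqrt d (mat_adjoint X * X)))"

definition mat_sum :: "nat \<Rightarrow> (nat \<Rightarrow> complex mat) \<Rightarrow> nat \<Rightarrow> complex mat" where
  "mat_sum d X k = mat d d (\<lambda>(i, j). \<Sum>x<k. X x $$ (i, j))"

definition kron :: "complex mat \<Rightarrow> complex mat \<Rightarrow> complex mat" where
  "kron X Y = mat (dim_row X * dim_row Y) (dim_col X * dim_col Y)
     (\<lambda>(r, c). X $$ (r div dim_row Y, c div dim_col Y) * Y $$ (r mod dim_row Y, c mod dim_col Y))"

definition partial_transpose :: "nat \<Rightarrow> nat \<Rightarrow> complex mat \<Rightarrow> complex mat" where
  "partial_transpose dA dB X = mat (dA * dB) (dA * dB)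
     (\<lambda>(r, c). X $$ ((r div dB) * dB + c mod dB, (c div dB) * dB + r mod dB))"

text \<open>
  The tensor product of an operator on \<open>A:B\<close> and one on \<open>A':B'\<close>, regarded as an operator on
  \<open>AA':BB'\<close>. The row \<open>(a * dA' + a') * (dB * dB') + (b * dB' + b')\<close> stands for the basis
  vector \<open>|a a'>|b b'>\<close>.
\<close>

definition bip_tensor ::
  "nat \<Rightarrow> nat \<Rightarrow> nat \<Rightarrow> nat \<Rightarrow> complex mat \<Rightarrow> complex mat \<Rightarrow> complex mat" where
  "bip_tensor dA dB dA' dB' X Y = mat ((dA * dA') * (dB * dB')) ((dA * dA') * (dB * dB'))
     (\<lambda>(r, c).
        let rA = r div (dB * dB'); rB = r mod (dB * dB');
            cA = c div (dB * dB'); cB = c mod (dB * dB')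
        in X $$ ((rA div dA') * dB + rB div dB', (cA div dA') * dB + cB div dB') *
           Y $$ ((rA mod dA') * dB' + rB mod dB', (cA mod dA') * dB' + cB mod dB'))"

text \<open>The \<open>n\<close>-th tensor power, as an operator on \<open>A\<^sup>n:B\<^sup>n\<close> with dimensions \<open>dA ^ n\<close>, \<open>dB ^ n\<close>.\<close>

fun bip_power :: "nat \<Rightarrow> nat \<Rightarrow> complex mat \<Rightarrow> nat \<Rightarrow> complex mat" where
  "bip_power dA dB X 0 = 1\<^sub>m 1"
| "bip_power dA dB X (Suc n) = bip_tensor (dA ^ n) (dB ^ n) dA dB (bip_power dA dB X n) X"

definition sep_states :: "nat \<Rightarrow> nat \<Rightarrow> complex mat set" where
  "sep_states dA dB =
     {mat_sum (dA * dB) (\<lambda>x. complex_of_real (p x) \<cdot>\<^sub>m kron (\<alpha> x) (\<beta> x)) k | k p \<alpha> \<beta>.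
        (\<forall>x<k. 0 \<le> p x \<and> \<alpha> x \<in> states dA \<and> \<beta> x \<in> states dB) \<and> (\<Sum>x<k. p x) = (1 :: real)}"

definition sep_cone :: "nat \<Rightarrow> nat \<Rightarrow> complex mat set" where
  "sep_cone dA dB = {complex_of_real l \<cdot>\<^sub>m \<sigma> | l \<sigma>. 0 \<le> l \<and> \<sigma> \<in> sep_states dA dB}"

text \<open>
  The infimum is a minimum: \<open>sep_cone\<close> is closed, large multiples of the identity are feasible,
  and feasible points satisfy \<open>1 = tr \<rho> \<le> tr S\<close>.
\<close>

definition E_kappa :: "nat \<Rightarrow> nat \<Rightarrow> complex mat \<Rightarrow> real" where
  "E_kappa dA dB \<rho> = log 2 (Inf {Re (tr S) | S. S \<in> sep_cone dA dB \<and>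
     lowner_le (dA * dB) (- S) (partial_transpose dA dB \<rho>) \<and>
     lowner_le (dA * dB) (partial_transpose dA dB \<rho>) S})"

definition E_kappa_reg :: "nat \<Rightarrow> nat \<Rightarrow> complex mat \<Rightarrow> real" where
  "E_kappa_reg dA dB \<rho> = lim (\<lambda>n. E_kappa (dA ^ n) (dB ^ n) (bip_power dA dB \<rho> n) / real n)"

text \<open>A measurement with outcomes \<open>x < k\<close> is represented by \<open>k\<close> and \<open>E\<close>.\<close>

definition sep_povm :: "nat \<Rightarrow> nat \<Rightarrow> nat \<Rightarrow> (nat \<Rightarrow> complex mat) \<Rightarrow> bool" where
  "sep_povm dA dB k E \<longleftrightarrow>
     (\<forall>x<k. E x \<in> sep_cone dA dB) \<and> mat_sum (dA * dB) E k = 1\<^sub>m (dA * dB)"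

text \<open>
  The summand \<open>p * log\<^sub>2 (p / q)\<close> for \<open>p, q \<ge> 0\<close>, with the usual conventions
  \<open>0 * log\<^sub>2 (0 / q) = 0\<close> and \<open>p * log\<^sub>2 (p / 0) = \<infinity>\<close> for \<open>p > 0\<close>.
\<close>

definition rel_ent_term :: "real \<Rightarrow> real \<Rightarrow> ereal" where
  "rel_ent_term p q = (if p = 0 then 0 else if q = 0 then \<infinity> else ereal (p * log 2 (p / q)))"

definition D_SEP :: "nat \<Rightarrow> nat \<Rightarrow> complex mat \<Rightarrow> complex mat \<Rightarrow> ereal" where
  "D_SEP dA dB \<rho> \<sigma> =
     Sup {\<Sum>x<k. rel_ent_term (Re (tr (\<rho> * E x))) (Re (tr (\<sigma> * E x))) | k E. sep_povm dA dB k E}"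

definition D_SEP_sep :: "nat \<Rightarrow> nat \<Rightarrow> complex mat \<Rightarrow> ereal" where
  "D_SEP_sep dA dB \<rho> = (INF \<sigma> \<in> sep_states dA dB. D_SEP dA dB \<rho> \<sigma>)"

definition D_SEP_reg :: "nat \<Rightarrow> nat \<Rightarrow> complex mat \<Rightarrow> ereal" where
  "D_SEP_reg dA dB \<rho> =
     lim (\<lambda>n. D_SEP_sep (dA ^ n) (dB ^ n) (bip_power dA dB \<rho> n) / ereal (real n))"

definition linear_map :: "nat \<Rightarrow> nat \<Rightarrow> (complex mat \<Rightarrow> complex mat) \<Rightarrow> bool" where
  "linear_map d d' \<Xi> \<longleftrightarrow>
     (\<forall>X \<in> carrier_mat d d. \<Xi> X \<in> carrier_mat d' d') \<and>
     (\<forall>X \<in> carrier_mat d d. \<forall>Y \<in> carrier_mat d d. \<Xi> (X + Y) = \<Xi> X + \<Xi> Y) \<and>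
     (\<forall>a. \<forall>X \<in> carrier_mat d d. \<Xi> (a \<cdot>\<^sub>m X) = a \<cdot>\<^sub>m \<Xi> X)"

text \<open>The map \<open>id\<^sub>k \<otimes> \<Xi>\<close>, which applies \<open>\<Xi>\<close> to each of the \<open>k * k\<close> blocks of size \<open>d\<close>.\<close>

definition ampliation ::
  "nat \<Rightarrow> nat \<Rightarrow> nat \<Rightarrow> (complex mat \<Rightarrow> complex mat) \<Rightarrow> complex mat \<Rightarrow> complex mat" where
  "ampliation k d d' \<Xi> X = mat (k * d') (k * d')
     (\<lambda>(r, c). \<Xi> (mat d d (\<lambda>(i, j). X $$ ((r div d') * d + i, (c div d') * d + j)))
                 $$ (r mod d', c mod d'))"

definition completely_positive :: "nat \<Rightarrow> nat \<Rightarrow> (complex mat \<Rightarrow> complex mat) \<Rightarrow> bool" where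
  "completely_positive d d' \<Xi> \<longleftrightarrow>
     linear_map d d' \<Xi> \<and> (\<forall>k X. psd (k * d) X \<longrightarrow> psd (k * d') (ampliation k d d' \<Xi> X))"

definition cptp :: "nat \<Rightarrow> nat \<Rightarrow> (complex mat \<Rightarrow> complex mat) \<Rightarrow> bool" where
  "cptp d d' \<Xi> \<longleftrightarrow>
     completely_positive d d' \<Xi> \<and> (\<forall>X \<in> carrier_mat d d. tr (\<Xi> X) = tr X)"

text \<open>
  The adjoint for the bilinear pairing \<open>tr (X * Y)\<close>, without complex conjugation. It is
  uniquely determined if \<open>\<Xi>\<close> is a linear map and \<open>X\<close> has dimension \<open>d'\<close>.
\<close>

definition adjoint_map ::
  "nat \<Rightarrow> nat \<Rightarrow> (complex mat \<Rightarrow> complex mat) \<Rightarrow> complex mat \<Rightarrow> complex mat" where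
  "adjoint_map d d' \<Xi> X =
     (THE Z. Z \<in> carrier_mat d d \<and> (\<forall>Y \<in> carrier_mat d d. tr (X * \<Xi> Y) = tr (Z * Y)))"

definition DNE :: "nat \<Rightarrow> nat \<Rightarrow> nat \<Rightarrow> nat \<Rightarrow> (complex mat \<Rightarrow> complex mat) set" where
  "DNE dA dB dA' dB' = {\<Xi>. cptp (dA * dB) (dA' * dB') \<Xi> \<and>
     \<Xi> ` sep_states dA dB \<subseteq> sep_states dA' dB' \<and>
     adjoint_map (dA * dB) (dA' * dB') \<Xi> ` sep_states dA' dB' \<subseteq> sep_cone dA dB}"

definition phi_vec :: "complex vec" where
  "phi_vec = complex_of_real (1 / sqrt 2) \<cdot>\<^sub>v (unit_vec 4 (0 * 2 + 0) + unit_vec 4 (1 * 2 + 1))"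

definition Phi2 :: "complex mat" where
  "Phi2 = mat 4 4 (\<lambda>(i, j). phi_vec $ i * cnj (phi_vec $ j))"

text \<open>
  For a state \<open>\<rho>\<close> and \<open>0 \<le> \<epsilon> < 1\<close> the set of admissible \<open>m\<close> is finite and contains \<open>0\<close>, so the
  maximum exists. Finiteness: \<open>\<rho> \<le> dA * dB * \<tau>\<close> for the maximally mixed, hence separable, state
  \<open>\<tau>\<close>, and the fidelity of a separable state with \<open>\<Phi>\<^sub>2\<close> to the tensor power \<open>m\<close> is at most \<open>2 ^ -m\<close>.
\<close>

definition E_d_one :: "nat \<Rightarrow> nat \<Rightarrow> real \<Rightarrow> complex mat \<Rightarrow> nat" where
  "E_d_one dA dB \<epsilon> \<rho> = Max {m :: nat.
     (INF \<Theta> \<in> DNE dA dB (2 ^ m) (2 ^ m).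
        1 / 2 * trace_norm (2 ^ m * 2 ^ m) (\<Theta> \<rho> - bip_power 2 2 Phi2 m)) \<le> \<epsilon>}"

definition E_d_DNE :: "nat \<Rightarrow> nat \<Rightarrow> complex mat \<Rightarrow> ereal" where
  "E_d_DNE dA dB \<rho> = Lim (at_right 0)
     (\<lambda>\<epsilon>. liminf (\<lambda>n.
        ereal (real (E_d_one (dA ^ n) (dB ^ n) \<epsilon> (bip_power dA dB \<rho> n)) / real n)))"

lemma mult_add_less:
  fixes i j m n :: nat
  assumes "i < m" "j < n"
  shows "i * n + j < m * n"
proof -
  have "i * n + j < Suc i * n" using assms by simp
  also have "\<dots> \<le> m * n" using assms by (intro mult_le_mono1) simp
  finally show ?thesis .
qed

lemma kron_index:
  assumes "X \<in> carrier_mat dA dA" "Y \<in> carrier_mat dB dB"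
    and "i < dA" "i' < dA" "j < dB" "j' < dB"
  shows "kron X Y $$ (i * dB + j, i' * dB + j') = X $$ (i, i') * Y $$ (j, j')"
  using assms by (simp add: kron_def mult_add_less)

lemma partial_transpose_kron:
  assumes "X \<in> carrier_mat dA dA" "Y \<in> carrier_mat dB dB"
  shows "partial_transpose dA dB (kron X Y) = kron X (transpose_mat Y)"
proof (rule eq_matI)
  fix r c
  assume "r < dim_row (kron X (transpose_mat Y))" "c < dim_col (kron X (transpose_mat Y))"
  then have r: "r < dA * dB" and c: "c < dA * dB" using assms by (auto simp: kron_def)
  then have "0 < dB" by (cases dB) auto
  with r c have "r div dB < dA" "c div dB < dA" "r mod dB < dB" "c mod dB < dB"
    by (auto simp: less_mult_imp_div_less)
  with assms r c show "partial_transpose dA dB (kron X Y) $$ (r, c) = kron X (transpose_mat Y) $$ (r, c)"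
    by (simp add: partial_transpose_def kron_index) (simp add: kron_def)
qed (use assms in \<open>auto simp: partial_transpose_def kron_def\<close>)

lemma bip_tensor_kron:
  assumes "X \<in> carrier_mat dA dA" "Y \<in> carrier_mat dB dB"
    and "X' \<in> carrier_mat dA' dA'" "Y' \<in> carrier_mat dB' dB'"
  shows "bip_tensor dA dB dA' dB' (kron X Y) (kron X' Y') = kron (kron X X') (kron Y Y')"
proof (rule eq_matI)
  fix r c
  assume "r < dim_row (kron (kron X X') (kron Y Y'))" "c < dim_col (kron (kron X X') (kron Y Y'))"
  then have r: "r < (dA * dA') * (dB * dB')" and c: "c < (dA * dA') * (dB * dB')"
    using assms by (auto simp: kron_def)
  then have pos: "0 < dB * dB'" "0 < dA'" "0 < dB'"
    by (cases "dB * dB'"; cases dA'; cases dB'; simp)+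
  define rA rB cA cB where ab: "rA = r div (dB * dB')" "rB = r mod (dB * dB')"
    "cA = c div (dB * dB')" "cB = c mod (dB * dB')"
  have b: "rA < dA * dA'" "rB < dB * dB'" "cA < dA * dA'" "cB < dB * dB'"
    unfolding ab using r c pos by (auto simp: less_mult_imp_div_less)
  have d: "rA div dA' < dA" "rA mod dA' < dA'" "cA div dA' < dA" "cA mod dA' < dA'"
    "rB div dB' < dB" "rB mod dB' < dB'" "cB div dB' < dB" "cB mod dB' < dB'"
    using b pos by (auto simp: less_mult_imp_div_less)
  have "bip_tensor dA dB dA' dB' (kron X Y) (kron X' Y') $$ (r, c) =
      (X $$ (rA div dA', cA div dA') * Y $$ (rB div dB', cB div dB')) *
      (X' $$ (rA mod dA', cA mod dA') * Y' $$ (rB mod dB', cB mod dB'))"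
    using r c d assms by (simp add: bip_tensor_def Let_def ab[symmetric] kron_index)
  also have "\<dots> = kron X X' $$ (rA, cA) * kron Y Y' $$ (rB, cB)"
    using b assms by (simp add: kron_def)
  also have "\<dots> = kron (kron X X') (kron Y Y') $$ (r, c)"
    unfolding ab using r c assms by (simp add: kron_def)
  finally show "bip_tensor dA dB dA' dB' (kron X Y) (kron X' Y') $$ (r, c) =
      kron (kron X X') (kron Y Y') $$ (r, c)" .
qed (use assms in \<open>auto simp: bip_tensor_def kron_def\<close>)

lemma bip_power_1:
  assumes "X \<in> carrier_mat (dA * dB) (dA * dB)"
  shows "bip_power dA dB X 1 = X"
proof (rule eq_matI)
  fix r c assume "r < dim_row X" "c < dim_col X"
  with assms have rc: "r < dA * dB" "c < dA * dB" by auto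
  then have "0 < dB" by (cases dB) auto
  with rc have "r div dB < dA" "c div dB < dA" "r mod dB < dB" "c mod dB < dB"
    by (auto simp: less_mult_imp_div_less)
  with rc show "bip_power dA dB X 1 $$ (r, c) = X $$ (r, c)"
    by (simp add: bip_tensor_def Let_def)
qed (use assms in \<open>auto simp: bip_tensor_def\<close>)

end

theory Submission
  imports Defs
begin

text \<open>
  Call a finite list of pairs \<open>(E, f)\<close> of separable effects \<open>E\<close> summing to the identity and weights
  \<open>f > 0\<close> feasible if \<open>\<Sum> f * tr (E \<sigma>) \<le> 1\<close> for all separable \<open>\<sigma>\<close>. Up to an additive
  constant, \<open>D_SEP_sep \<rho>\<close> is the supremum of \<open>\<Sum> tr (E \<rho>) * log 2 f\<close> over feasible lists; one direction is
  \<open>ln x \<le> x - 1\<close>, the other a minimax argument. Feasible lists are closed under tensor products,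
  because contracting a separable state with a separable effect leaves a separable operator. Hence
  the relative entropy is superadditive up to a constant and its regularization exists, and
  thresholding the product of the weights of many copies of one list gives a separable test
  with a Chernoff bound on \<open>\<rho>\<close> and a Markov bound on separable states. Such a test becomes a DNE
  distillation map by preparing \<open>\<Phi>\<close> or the orthogonal isotropic state. Conversely a DNE map pulls the
  separable test \<open>(1 + d \<Phi>) / (d + 1)\<close> back to a separable test.
\<close>

section \<open>Hermitian matrices, trace norm and cones of rank-one operators\<close>

text \<open>Everything is finally divided by the number of copies, so additive constants cost
  nothing, and the factor \<open>1 - 2 * \<epsilon>\<close> of a weak converse disappears as the
  error tends to 0. This leaves room for a minimax argument with slack. The obstacle is that
  \<open>D_SEP_sep\<close> is an infimum over states of a supremum over measurements, so a good
  measurement may depend on the state. A feasible list is a single measurement that works against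
  all separable states at once, and such an object can be tensored. Its constraint is tested on
  product vectors only (\<open>pord\<close>): this order is weaker than the Loewner order, but it is
  all that separable states can see, and it survives tensoring with separable effects. In the
  converse \<open>\<Phi>\<close> cannot itself be pulled back, because the adjoint condition of DNE
  controls separable operators only. The effect \<open>(1 + d \<Phi>) / (d + 1)\<close> accepts
  \<open>\<Phi>\<close> surely, and both it and its complement are separable. Their separability
  comes from finite averages over roots of unity, in place of an integral over a unitary
  group.\<close>

definition mv :: "nat \<Rightarrow> complex mat \<Rightarrow> (nat \<Rightarrow> complex) \<Rightarrow> nat \<Rightarrow> complex" where
  "mv d X u i = (\<Sum>j<d. X $$ (i, j) * u j)"

text \<open>Vectors are functions on all naturals, of which only the entries below \<open>d\<close>
  are read; tensor products and contractions of vectors are then plain lambda terms.\<close>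

definition ip :: "nat \<Rightarrow> (nat \<Rightarrow> complex) \<Rightarrow> (nat \<Rightarrow> complex) \<Rightarrow> complex" where
  "ip d u v = (\<Sum>i<d. cnj (u i) * v i)"

definition quad :: "nat \<Rightarrow> complex mat \<Rightarrow> (nat \<Rightarrow> complex) \<Rightarrow> complex" where
  "quad d X u = (\<Sum>i<d. \<Sum>j<d. cnj (u i) * X $$ (i, j) * u j)"

definition prj :: "nat \<Rightarrow> (nat \<Rightarrow> complex) \<Rightarrow> complex mat" where
  "prj d u = mat d d (\<lambda>(i, j). u i * cnj (u j))"

definition herm :: "nat \<Rightarrow> complex mat \<Rightarrow> bool" where
  "herm d X \<longleftrightarrow> X \<in> carrier_mat d d \<and> (\<forall>i<d. \<forall>j<d. X $$ (j, i) = cnj (X $$ (i, j)))"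

lemma hermD:
  assumes "herm d X"
  shows "X \<in> carrier_mat d d" "i < d \<Longrightarrow> j < d \<Longrightarrow> cnj (X $$ (i, j)) = X $$ (j, i)"
  using assms unfolding herm_def by metis+

lemma hermI:
  assumes "X \<in> carrier_mat d d" "\<And>i j. i < d \<Longrightarrow> j < d \<Longrightarrow> cnj (X $$ (i, j)) = X $$ (j, i)"
  shows "herm d X"
  using assms unfolding herm_def by metis

lemma prj_carrier [simp]: "prj d u \<in> carrier_mat d d"
  and prj_dim [simp]: "dim_row (prj d u) = d" "dim_col (prj d u) = d"
  and prj_index [simp]: "i < d \<Longrightarrow> j < d \<Longrightarrow> prj d u $$ (i, j) = u i * cnj (u j)"
  by (auto simp: prj_def)

section \<open>Traces, inner products and quadratic forms in coordinates\<close>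

lemma mult_index:
  assumes "X \<in> carrier_mat d d" "Y \<in> carrier_mat d d" "i < d" "j < d"
  shows "(X * Y) $$ (i, j) = (\<Sum>k<d. X $$ (i, k) * Y $$ (k, j))"
  using assms by (simp add: scalar_prod_def atLeast0LessThan)

lemma tr_mult:
  assumes "X \<in> carrier_mat d d" "Y \<in> carrier_mat d d"
  shows "tr (X * Y) = (\<Sum>i<d. \<Sum>j<d. X $$ (i, j) * Y $$ (j, i))"
proof -
  have "dim_row (X * Y) = d" using assms by simp
  then show ?thesis unfolding tr_def using assms by (auto intro!: sum.cong simp: mult_index simp del: index_mult_mat)
qed

lemma tr_carrier: "X \<in> carrier_mat d d \<Longrightarrow> tr X = (\<Sum>i<d. X $$ (i, i))"
  by (auto simp: tr_def)

lemma tr_comm: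
  assumes "X \<in> carrier_mat d d" "Y \<in> carrier_mat d d"
  shows "tr (X * Y) = tr (Y * X)"
  unfolding tr_mult[OF assms] tr_mult[OF assms(2,1)]
  by (subst sum.swap) (simp add: mult.commute)

lemma tr_add:
  assumes "X \<in> carrier_mat d d" "Y \<in> carrier_mat d d"
  shows "tr (X + Y) = tr X + tr Y"
  using assms by (simp add: tr_def sum.distrib)

lemma tr_smult: "X \<in> carrier_mat d d \<Longrightarrow> tr (c \<cdot>\<^sub>m X) = c * tr X"
  by (simp add: tr_def sum_distrib_left)

lemma tr_minus:
  assumes "X \<in> carrier_mat d d" "Y \<in> carrier_mat d d"
  shows "tr (X - Y) = tr X - tr Y"
  using assms by (simp add: tr_def sum_subtractf)

lemma tr_mult_add:
  assumes "X \<in> carrier_mat d d" "Y \<in> carrier_mat d d" "Z \<in> carrier_mat d d"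
  shows "tr (X * (Y + Z)) = tr (X * Y) + tr (X * Z)"
  using assms by (simp add: mult_add_distrib_mat tr_add[of _ d])

lemma tr_mult_smult:
  assumes "X \<in> carrier_mat d d" "Y \<in> carrier_mat d d"
  shows "tr (X * (c \<cdot>\<^sub>m Y)) = c * tr (X * Y)"
  using assms by (simp add: mult_smult_distrib tr_smult[of _ d])

lemma tr_mult_minus:
  assumes "X \<in> carrier_mat d d" "Y \<in> carrier_mat d d" "Z \<in> carrier_mat d d"
  shows "tr (X * (Y - Z)) = tr (X * Y) - tr (X * Z)"
  using assms by (simp add: mult_minus_distrib_mat tr_minus[of _ d])

lemma tr_mult_prj: "X \<in> carrier_mat d d \<Longrightarrow> tr (X * prj d u) = quad d X u"
  by (simp add: tr_mult quad_def mult_ac)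

lemma tr_prj: "tr (prj d u) = ip d u u"
  by (simp add: tr_def ip_def mult_ac)

lemma ip_self: "ip d u u = of_real (\<Sum>i<d. (cmod (u i))\<^sup>2)"
  unfolding ip_def of_real_sum by (intro sum.cong refl) (metis complex_norm_square mult.commute)

lemma ip_self_ge0: "0 \<le> ip d u u"
  unfolding ip_self less_eq_complex_def by (simp add: sum_nonneg)

lemma ip_cnj: "ip d v u = cnj (ip d u v)"
  by (simp add: ip_def mult.commute)

lemma ip_add_right: "ip d u (\<lambda>i. v i + w i) = ip d u v + ip d u w"
  by (simp add: ip_def sum.distrib distrib_left)

lemma ip_smult_right: "ip d u (\<lambda>i. c * v i) = c * ip d u v"
  by (simp add: ip_def sum_distrib_left mult_ac)

lemma ip_add_left: "ip d (\<lambda>i. v i + w i) u = ip d v u + ip d w u"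
  by (simp add: ip_def sum.distrib distrib_right)

lemma ip_smult_left: "ip d (\<lambda>i. c * v i) u = cnj c * ip d v u"
  by (simp add: ip_def sum_distrib_left mult_ac)

lemma ip_cong: "(\<And>i. i < d \<Longrightarrow> u i = u' i) \<Longrightarrow> (\<And>i. i < d \<Longrightarrow> v i = v' i) \<Longrightarrow> ip d u v = ip d u' v'"
  by (simp add: ip_def)

lemma quad_ip: "quad d X u = ip d u (mv d X u)"
  by (simp add: quad_def ip_def mv_def sum_distrib_left mult_ac)

lemma quad_prj: "quad d (prj d u) v = of_real ((cmod (ip d u v))\<^sup>2)"
proof -
  have "quad d (prj d u) v = (\<Sum>i<d. \<Sum>j<d. (cnj (v i) * u i) * (cnj (u j) * v j))"
    by (simp add: quad_def mult_ac)
  also have "\<dots> = ip d v u * ip d u v"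
    by (simp add: ip_def sum_product)
  also have "\<dots> = of_real ((cmod (ip d u v))\<^sup>2)"
    by (subst ip_cnj) (metis complex_norm_square mult.commute)
  finally show ?thesis .
qed

lemma quad_prj_ge0: "0 \<le> quad d (prj d u) v"
  unfolding quad_prj less_eq_complex_def by simp

lemma quad_add:
  assumes "X \<in> carrier_mat d d" "Y \<in> carrier_mat d d"
  shows "quad d (X + Y) u = quad d X u + quad d Y u"
  using assms by (simp add: quad_def sum.distrib algebra_simps)

lemma quad_minus:
  assumes "X \<in> carrier_mat d d" "Y \<in> carrier_mat d d"
  shows "quad d (X - Y) u = quad d X u - quad d Y u"
  using assms by (simp add: quad_def sum_subtractf algebra_simps)

lemma quad_smult: "X \<in> carrier_mat d d \<Longrightarrow> quad d (c \<cdot>\<^sub>m X) u = c * quad d X u"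
  by (simp add: quad_def sum_distrib_left mult_ac)

lemma quad_zero [simp]: "quad d (0\<^sub>m d d) u = 0"
  by (simp add: quad_def)

lemma quad_one [simp]: "quad d (1\<^sub>m d) u = ip d u u"
proof -
  have "quad d (1\<^sub>m d) u = (\<Sum>i<d. \<Sum>j<d. if i = j then cnj (u i) * u i else 0)"
    unfolding quad_def by (intro sum.cong refl) auto
  then show ?thesis by (simp add: ip_def)
qed

lemma psd_iff: "psd d X \<longleftrightarrow> X \<in> carrier_mat d d \<and> (\<forall>u. 0 \<le> quad d X u)"
proof -
  have 1: "(X *\<^sub>v v) \<bullet>c v = quad d X (\<lambda>i. v $ i)"
    if "X \<in> carrier_mat d d" "v \<in> carrier_vec d" for v
    using that
    by (auto simp: quad_def scalar_prod_def atLeast0LessThan sum_distrib_right sum_distrib_left mult_ac intro!: sum.cong)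
  have 2: "quad d X u = quad d X (\<lambda>i. vec d u $ i)" for u
    by (simp add: quad_def)
  show ?thesis unfolding psd_def
    using 1 2 by (metis vec_carrier)
qed

lemma psdD: "psd d X \<Longrightarrow> X \<in> carrier_mat d d" "psd d X \<Longrightarrow> 0 \<le> quad d X u"
  by (auto simp: psd_iff)

lemma sum_two_points:
  fixes d :: nat
  assumes "i < d" "j < d" "i \<noteq> j" "\<And>k. k \<noteq> i \<Longrightarrow> k \<noteq> j \<Longrightarrow> f k = (0::complex)"
  shows "(\<Sum>k<d. f k) = f i + f j"
proof -
  have "(\<Sum>k<d. f k) = (\<Sum>k\<in>{i,j}. f k)"
    by (rule sum.mono_neutral_right) (use assms in auto)
  then show ?thesis using assms by simp
qed

lemma sum_one_point:
  fixes d :: nat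
  assumes "i < d" "\<And>k. k \<noteq> i \<Longrightarrow> f k = (0::complex)"
  shows "(\<Sum>k<d. f k) = f i"
proof -
  have "(\<Sum>k<d. f k) = (\<Sum>k\<in>{i}. f k)"
    by (rule sum.mono_neutral_right) (use assms in auto)
  then show ?thesis using assms by simp
qed

lemma quad_unit:
  assumes "i < d"
  shows "quad d X (\<lambda>k. if k = i then 1 else 0) = X $$ (i, i)"
  unfolding quad_def by (subst sum_one_point[OF assms]; simp?)+

lemma quad_two_points:
  assumes "i < d" "j < d" "i \<noteq> j"
  shows "quad d X (\<lambda>k. if k = i then a else if k = j then b else 0) =
    cnj a * a * X $$ (i, i) + cnj b * b * X $$ (j, j) + cnj a * b * X $$ (i, j) + cnj b * a * X $$ (j, i)"
proof -
  let ?u = "\<lambda>k. if k = i then a else if k = j then b else 0"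
  have inner: "(\<Sum>l<d. cnj (?u k) * X $$ (k, l) * ?u l) = cnj (?u k) * (X $$ (k, i) * a + X $$ (k, j) * b)" for k
  proof -
    have "(\<Sum>l<d. cnj (?u k) * X $$ (k, l) * ?u l) =
        cnj (?u k) * X $$ (k, i) * ?u i + cnj (?u k) * X $$ (k, j) * ?u j"
      by (rule sum_two_points[OF assms]) simp
    then show ?thesis using assms(3) by (simp add: distrib_left mult.assoc)
  qed
  have "quad d X ?u = (\<Sum>k<d. cnj (?u k) * (X $$ (k, i) * a + X $$ (k, j) * b))"
    unfolding quad_def inner ..
  also have "\<dots> = cnj (?u i) * (X $$ (i, i) * a + X $$ (i, j) * b) + cnj (?u j) * (X $$ (j, i) * a + X $$ (j, j) * b)"
    by (rule sum_two_points[OF assms]) simp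
  finally have "quad d X ?u = \<dots>" .
  then show ?thesis using assms(3) by (simp add: distrib_left mult_ac)
qed

text \<open>Only the reality of the form is used: \<open>e_i + e_j\<close> shows that the imaginary
  parts of opposite entries cancel, and \<open>e_i + \<i> e_j\<close> that their real parts
  agree.\<close>

lemma psd_herm:
  assumes "psd d X" shows "herm d X"
proof -
  have r: "Im (quad d X u) = 0" for u
    using psdD(2)[OF assms, of u] by (simp add: less_eq_complex_def)
  have dg: "Im (X $$ (i, i)) = 0" if "i < d" for i
    using r[of "\<lambda>k. if k = i then 1 else 0"] quad_unit[OF that, of X] by simp
  have "X $$ (j, i) = cnj (X $$ (i, j))" if "i < d" "j < d" for i j
  proof (cases "i = j")
    case True
    with dg that show ?thesis by (simp add: complex_eq_iff)
  next
    case False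
    have q: "Im (cnj a * a * X $$ (i, i) + cnj b * b * X $$ (j, j) + cnj a * b * X $$ (i, j)
        + cnj b * a * X $$ (j, i)) = 0" for a b
      using r[of "\<lambda>k. if k = i then a else if k = j then b else 0"]
      unfolding quad_two_points[OF that False] .
    have "Im (X $$ (i, j)) + Im (X $$ (j, i)) = 0"
      using q[of 1 1] dg[OF that(1)] dg[OF that(2)] by simp
    moreover have "Re (X $$ (i, j)) = Re (X $$ (j, i))"
      using q[of 1 \<i>] dg[OF that(1)] dg[OF that(2)] by simp
    ultimately show ?thesis by (simp add: complex_eq_iff)
  qed
  with psdD(1)[OF assms] show ?thesis by (intro hermI) metis+
qed

section \<open>Eigenvectors and the spectral decomposition\<close>

lemma herm_ip:
  assumes "herm d X" shows "ip d (mv d X u) v = ip d u (mv d X v)"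
proof -
  have "ip d (mv d X u) v = (\<Sum>i<d. \<Sum>j<d. cnj (X $$ (i, j)) * cnj (u j) * v i)"
    by (simp add: ip_def mv_def sum_distrib_right)
  also have "\<dots> = (\<Sum>i<d. \<Sum>j<d. X $$ (j, i) * cnj (u j) * v i)"
    by (intro sum.cong refl) (simp add: hermD(2)[OF assms])
  also have "\<dots> = (\<Sum>j<d. \<Sum>i<d. X $$ (j, i) * cnj (u j) * v i)" by (rule sum.swap)
  also have "\<dots> = ip d u (mv d X v)"
    by (simp add: ip_def mv_def sum_distrib_left mult_ac)
  finally show ?thesis .
qed

lemma herm_mult_index:
  assumes "herm d X"
  shows "tr (X * X) = of_real (\<Sum>i<d. \<Sum>j<d. (cmod (X $$ (i, j)))\<^sup>2)"
proof -
  have X: "X \<in> carrier_mat d d" using assms by (rule hermD)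
  have "tr (X * X) = (\<Sum>i<d. \<Sum>j<d. X $$ (i, j) * cnj (X $$ (i, j)))"
    unfolding tr_mult[OF X X] by (intro sum.cong refl) (simp add: hermD(2)[OF assms])
  also have "\<dots> = of_real (\<Sum>i<d. \<Sum>j<d. (cmod (X $$ (i, j)))\<^sup>2)"
    by (simp only: of_real_sum complex_norm_square)
  finally show ?thesis .
qed

lemma tr_square_upper_triangular:
  assumes B: "B \<in> carrier_mat d d" and u: "upper_triangular B"
  shows "tr (B * B) = (\<Sum>i<d. (B $$ (i, i))\<^sup>2)"
  unfolding tr_mult[OF B B]
proof (intro sum.cong refl)
  fix i assume i: "i \<in> {..<d}"
  have "B $$ (i, j) * B $$ (j, i) = 0" if "j < d" "j \<noteq> i" for j
    using that i B upper_triangularD[OF u, of j i] upper_triangularD[OF u, of i j] by (cases "j < i") auto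
  then have "(\<Sum>j<d. B $$ (i, j) * B $$ (j, i)) = (\<Sum>j\<in>{i}. B $$ (i, j) * B $$ (j, i))"
    using i by (intro sum.mono_neutral_right) auto
  then show "(\<Sum>j<d. B $$ (i, j) * B $$ (j, i)) = (B $$ (i, i))\<^sup>2"
    by (simp add: power2_eq_square)
qed

text \<open>For Hermitian \<open>X\<close>, \<open>tr (X * X)\<close> is the sum of the squared
  moduli of all entries, hence nonzero. In Schur form it is also the sum of the squared eigenvalues,
  so one eigenvalue does not vanish.\<close>

lemma herm_nonzero_eigenvector:
  assumes h: "herm d X" and nz: "X \<noteq> 0\<^sub>m d d"
  obtains c :: real and u where "c \<noteq> 0" "ip d u u = 1" "\<And>i. i < d \<Longrightarrow> mv d X u i = of_real c * u i"
proof -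
  have X: "X \<in> carrier_mat d d" using h by (rule hermD)
  have "tr (X * X) \<noteq> 0"
  proof
    assume "tr (X * X) = 0"
    then have "(\<Sum>i<d. \<Sum>j<d. (cmod (X $$ (i, j)))\<^sup>2) = 0"
      using herm_mult_index[OF h] by (metis of_real_eq_0_iff)
    then have "\<forall>i\<in>{..<d}. (\<Sum>j<d. (cmod (X $$ (i, j)))\<^sup>2) = 0"
      by (subst (asm) sum_nonneg_eq_0_iff) (auto intro: sum_nonneg)
    then have "\<forall>i<d. \<forall>j<d. X $$ (i, j) = 0"
      by (subst (asm) sum_nonneg_eq_0_iff) (auto)
    then have "X = 0\<^sub>m d d" using X by (intro eq_matI) auto
    with nz show False by simp
  qed
  obtain es where es: "char_poly X = (\<Prod>e\<leftarrow>es. [:- e, 1:])" using char_poly_factorized[OF X] by blast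
  obtain B P Q where "schur_decomposition X es = (B, P, Q)" by (cases "schur_decomposition X es")
  from schur_decomposition[OF X es this]
  have sim: "similar_mat_wit X B P Q" and ut: "upper_triangular B" and dm: "diag_mat B = es" by auto
  from similar_mat_witD2[OF X sim]
  have BPQ: "B \<in> carrier_mat d d" "P \<in> carrier_mat d d" "Q \<in> carrier_mat d d"
    and QP: "Q * P = 1\<^sub>m d" and XB: "X = P * B * Q" by auto
  have "X * X = P * B * (Q * P) * (B * Q)" unfolding XB using BPQ
    by (simp add: assoc_mult_mat[of _ d d _ d _ d])
  also have "\<dots> = P * (B * B * Q)" unfolding QP using BPQ
    by (simp add: assoc_mult_mat[of _ d d _ d _ d])
  finally have "tr (X * X) = tr ((B * B * Q) * P)"
    using BPQ by (simp add: tr_comm[of _ d])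
  also have "(B * B * Q) * P = (B * B) * (Q * P)" using BPQ
    by (simp add: assoc_mult_mat[of _ d d _ d _ d])
  also have "\<dots> = B * B" using BPQ by (simp add: QP)
  finally have "(\<Sum>i<d. (B $$ (i, i))\<^sup>2) \<noteq> 0"
    using \<open>tr (X * X) \<noteq> 0\<close> tr_square_upper_triangular[OF BPQ(1) ut] by simp
  then obtain i where i: "i < d" "B $$ (i, i) \<noteq> 0"
    by (metis (no_types, lifting) lessThan_iff power_zero_numeral sum.neutral)
  define e where "e = B $$ (i, i)"
  have "e \<in> set es" using i BPQ(1) by (auto simp: dm[symmetric] diag_mat_def e_def)
  then have "poly (char_poly X) e = 0"
    unfolding es by (auto simp: poly_prod_list prod_list_zero_iff image_iff intro!: bexI[of _ e])
  then have "eigenvalue X e" using eigenvalue_root_char_poly[OF X] by simp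
  then obtain v where v: "v \<in> carrier_vec d" "v \<noteq> 0\<^sub>v d" "X *\<^sub>v v = e \<cdot>\<^sub>v v"
    using X by (auto simp: eigenvalue_def eigenvector_def)
  define w where "w = (\<lambda>i. v $ i)"
  have Xw: "mv d X w i = e * w i" if "i < d" for i
    using arg_cong[OF v(3), of "\<lambda>x. x $ i"] that X v(1)
    by (auto simp: mv_def w_def scalar_prod_def atLeast0LessThan)
  define n where "n = sqrt (\<Sum>i<d. (cmod (w i))\<^sup>2)"
  have n2: "n\<^sup>2 = (\<Sum>i<d. (cmod (w i))\<^sup>2)" unfolding n_def by (simp add: sum_nonneg)
  have n0: "n \<noteq> 0"
  proof
    assume "n = 0"
    with n2 have "\<forall>i<d. w i = 0" by (auto simp: sum_nonneg_eq_0_iff)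
    then have "v = 0\<^sub>v d" using v(1) by (intro eq_vecI) (auto simp: w_def)
    with v show False by simp
  qed
  have ww: "ip d w w = of_real (n\<^sup>2)" unfolding ip_self n2 ..
  have "quad d X w = e * ip d w w"
    unfolding quad_ip using ip_cong[of d w w "mv d X w" "\<lambda>i. e * w i"] Xw
    by (simp add: ip_smult_right)
  moreover have "quad d X w = cnj (quad d X w)"
    unfolding quad_ip using herm_ip[OF h, of w w] ip_cnj by metis
  ultimately have "e = cnj e" using n0 unfolding ww by simp
  then have er: "e = of_real (Re e)" by (metis Reals_cnj_iff of_real_Re)
  define u where "u = (\<lambda>i. of_real (1 / n) * w i)"
  have "ip d u u = 1" unfolding u_def ip_smult_left ip_smult_right ww using n0
    by (simp add: power2_eq_square)
  moreover have "mv d X u i = of_real (Re e) * u i" if "i < d" for i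
  proof -
    have "mv d X u i = of_real (1 / n) * mv d X w i"
      by (simp add: mv_def u_def sum_distrib_left mult_ac)
    then show ?thesis using Xw[OF that] er by (simp add: u_def mult_ac)
  qed
  moreover have "Re e \<noteq> 0" using i er e_def by auto
  ultimately show ?thesis using that by blast
qed

definition orthonormal :: "nat \<Rightarrow> nat \<Rightarrow> (nat \<Rightarrow> nat \<Rightarrow> complex) \<Rightarrow> bool" where
  "orthonormal d k u \<longleftrightarrow> (\<forall>l<k. \<forall>m<k. ip d (u l) (u m) = (if l = m then 1 else 0))"

definition spec_mat :: "nat \<Rightarrow> nat \<Rightarrow> (nat \<Rightarrow> real) \<Rightarrow> (nat \<Rightarrow> nat \<Rightarrow> complex) \<Rightarrow> complex mat" where
  "spec_mat d k c u = mat d d (\<lambda>(i, j). \<Sum>l<k. of_real (c l) * u l i * cnj (u l j))"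

lemma mv_minus:
  assumes "X \<in> carrier_mat d d" "Y \<in> carrier_mat d d" "i < d"
  shows "mv d (X - Y) v i = mv d X v i - mv d Y v i"
  using assms by (simp add: mv_def left_diff_distrib sum_subtractf)

lemma spec_mat_carrier [simp]: "spec_mat d k c u \<in> carrier_mat d d"
  and spec_mat_dim [simp]: "dim_row (spec_mat d k c u) = d" "dim_col (spec_mat d k c u) = d"
  and spec_mat_index [simp]: "i < d \<Longrightarrow> j < d \<Longrightarrow>
    spec_mat d k c u $$ (i, j) = (\<Sum>l<k. of_real (c l) * u l i * cnj (u l j))"
  by (auto simp: spec_mat_def)

lemma mv_spec_mat:
  "i < d \<Longrightarrow> mv d (spec_mat d k c u) v i = (\<Sum>l<k. of_real (c l) * ip d (u l) v * u l i)"
  unfolding mv_def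
  by (simp add: sum_distrib_right sum_distrib_left ip_def mult_ac) (rule sum.swap)

lemma ip_sum_right:
  fixes k :: nat
  shows "ip d v (\<lambda>i. \<Sum>l<k. a l * u l i) = (\<Sum>l<k. a l * ip d v (u l))"
  by (induction k) (simp_all add: ip_add_right ip_smult_right, simp add: ip_def)

lemma ip_sum_left:
  fixes k :: nat
  shows "ip d (\<lambda>i. \<Sum>l<k. a l * u l i) v = (\<Sum>l<k. cnj (a l) * ip d (u l) v)"
  by (induction k) (simp_all add: ip_add_left ip_smult_left, simp add: ip_def)

lemma quad_spec_mat:
  "quad d (spec_mat d k c u) v = (\<Sum>l<k. of_real (c l * (cmod (ip d (u l) v))\<^sup>2))"
proof -
  have "quad d (spec_mat d k c u) v = ip d v (\<lambda>i. \<Sum>l<k. (of_real (c l) * ip d (u l) v) * u l i)"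
    unfolding quad_ip by (rule ip_cong) (simp_all add: mv_spec_mat)
  also have "\<dots> = (\<Sum>l<k. of_real (c l) * (ip d v (u l) * ip d (u l) v))"
    unfolding ip_sum_right by (simp add: mult_ac)
  also have "\<dots> = (\<Sum>l<k. of_real (c l * (cmod (ip d (u l) v))\<^sup>2))"
  proof (intro sum.cong refl)
    fix l
    have "ip d v (u l) * ip d (u l) v = of_real ((cmod (ip d (u l) v))\<^sup>2)"
      by (subst ip_cnj) (metis complex_norm_square mult.commute)
    then show "of_real (c l) * (ip d v (u l) * ip d (u l) v) = of_real (c l * (cmod (ip d (u l) v))\<^sup>2)"
      by simp
  qed
  finally show ?thesis .
qed

lemma bessel:
  assumes "orthonormal d k u"
  shows "(\<Sum>l<k. (cmod (ip d (u l) v))\<^sup>2) \<le> (\<Sum>i<d. (cmod (v i))\<^sup>2)"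
proof -
  define a where "a l = ip d (u l) v" for l
  define s where "s = (\<lambda>i. \<Sum>l<k. a l * u l i)"
  have av: "ip d s v = of_real (\<Sum>l<k. (cmod (a l))\<^sup>2)"
    unfolding s_def ip_sum_left a_def[symmetric] of_real_sum
    by (intro sum.cong refl) (metis complex_norm_square mult.commute)
  have us: "ip d (u l) s = a l" if "l < k" for l
  proof -
    have "ip d (u l) s = (\<Sum>m<k. if l = m then a m else 0)"
      unfolding s_def ip_sum_right using assms that
      by (intro sum.cong refl) (auto simp: orthonormal_def)
    then show ?thesis using that by simp
  qed
  have ss: "ip d s s = of_real (\<Sum>l<k. (cmod (a l))\<^sup>2)"
  proof -
    have "ip d s s = (\<Sum>l<k. cnj (a l) * ip d (u l) s)"
      by (subst s_def) (rule ip_sum_left)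
    also have "\<dots> = (\<Sum>l<k. of_real ((cmod (a l))\<^sup>2))"
      by (intro sum.cong refl) (metis us lessThan_iff complex_norm_square mult.commute)
    finally show ?thesis by simp
  qed
  have "0 \<le> ip d (\<lambda>i. v i + (-1) * s i) (\<lambda>i. v i + (-1) * s i)" by (rule ip_self_ge0)
  also have "\<dots> = ip d v v - ip d v s - ip d s v + ip d s s"
    unfolding ip_add_left ip_add_right ip_smult_left ip_smult_right by simp
  also have "\<dots> = of_real ((\<Sum>i<d. (cmod (v i))\<^sup>2) - (\<Sum>l<k. (cmod (a l))\<^sup>2))"
    by (subst ip_cnj) (simp add: av ss ip_self[of d v])
  finally show ?thesis unfolding a_def by (simp add: less_eq_complex_def)
qed

text \<open>Double counting of \<open>\<Sum> |u_l(i)|^2\<close>: each vector contributes 1, and each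
  coordinate contributes at most 1 by Bessel's inequality for the basis vector.\<close>

lemma orthonormal_le_dim:
  assumes "orthonormal d k u" shows "k \<le> d"
proof -
  have "(\<Sum>l<k. (cmod (u l i))\<^sup>2) \<le> 1" if "i < d" for i
  proof -
    let ?e = "\<lambda>j. if j = i then 1 else (0::complex)"
    have 1: "ip d (u l) ?e = cnj (u l i)" for l
      unfolding ip_def by (subst sum_one_point[OF that]) auto
    have 2: "(\<Sum>j<d. (cmod (?e j))\<^sup>2) = 1"
    proof -
      have "(\<Sum>j<d. (cmod (?e j))\<^sup>2) = (\<Sum>j<d. if j = i then 1 else 0)"
        by (intro sum.cong refl) auto
      then show ?thesis using that by simp
    qed
    show ?thesis using bessel[OF assms, of ?e] unfolding 1 2 by simp
  qed
  then have "(\<Sum>i<d. \<Sum>l<k. (cmod (u l i))\<^sup>2) \<le> (\<Sum>i<d. 1)"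
    by (intro sum_mono) simp
  moreover have "(\<Sum>i<d. \<Sum>l<k. (cmod (u l i))\<^sup>2) = (\<Sum>l<k. \<Sum>i<d. (cmod (u l i))\<^sup>2)"
    by (rule sum.swap)
  moreover have "(\<Sum>i<d. (cmod (u l i))\<^sup>2) = 1" if "l < k" for l
  proof -
    have "ip d (u l) (u l) = 1" using that assms by (simp add: orthonormal_def)
    then show ?thesis unfolding ip_self by (metis of_real_eq_1_iff)
  qed
  ultimately have "real k \<le> real d" by simp
  then show ?thesis by simp
qed

text \<open>A maximal orthonormal system of eigenvectors with nonzero eigenvalues exhausts a Hermitian
  matrix: an eigenvector of what remains would be orthogonal to the system and extend it.\<close>

lemma herm_spectral:
  assumes h: "herm d X"
  obtains k c u where "orthonormal d k u" "X = spec_mat d k c u"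
    "\<And>l i. l < k \<Longrightarrow> i < d \<Longrightarrow> mv d X (u l) i = of_real (c l) * u l i"
proof -
  have X: "X \<in> carrier_mat d d" using h by (rule hermD)
  define P where "P k \<longleftrightarrow> (\<exists>c u. orthonormal d k u \<and>
    (\<forall>l<k. c l \<noteq> 0 \<and> (\<forall>i<d. mv d X (u l) i = of_real (c l :: real) * u l i)))" for k
  have "P 0" by (auto simp: P_def orthonormal_def)
  moreover have "\<And>k. P k \<Longrightarrow> k \<le> d" using orthonormal_le_dim by (auto simp: P_def)
  ultimately obtain k where k: "P k" "\<And>m. P m \<Longrightarrow> m \<le> k"
    by (metis GreatestI_nat Greatest_le_nat)
  then obtain c u where on: "orthonormal d k u"
    and ev: "\<And>l. l < k \<Longrightarrow> c l \<noteq> 0" "\<And>l i. l < k \<Longrightarrow> i < d \<Longrightarrow> mv d X (u l) i = of_real (c l) * u l i"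
    unfolding P_def by blast
  define Y where "Y = X - spec_mat d k c u"
  have mvY: "mv d Y v i = mv d X v i - mv d (spec_mat d k c u) v i" if "i < d" for v i
    unfolding Y_def by (rule mv_minus[OF X spec_mat_carrier that])
  have hY: "herm d Y"
    by (rule hermI) (use hermD[OF h] in \<open>auto simp: Y_def mult_ac\<close>)
  have Yu: "mv d Y (u l) i = 0" if l: "l < k" and i: "i < d" for l i
  proof -
    have "mv d (spec_mat d k c u) (u l) i = (\<Sum>m<k. if m = l then of_real (c l) * u l i else 0)"
      unfolding mv_spec_mat[OF i] using on l by (intro sum.cong refl) (auto simp: orthonormal_def)
    then show ?thesis using l i ev by (simp add: mvY)
  qed
  have "Y = 0\<^sub>m d d"
  proof (rule ccontr)
    assume "Y \<noteq> 0\<^sub>m d d"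
    from herm_nonzero_eigenvector[OF hY this] obtain a v
      where a: "a \<noteq> 0" and vv: "ip d v v = 1" and Yv: "\<And>i. i < d \<Longrightarrow> mv d Y v i = of_real a * v i"
      by blast
    have uv: "ip d (u l) v = 0" if l: "l < k" for l
    proof -
      have "of_real a * ip d (u l) v = ip d (u l) (mv d Y v)"
        unfolding ip_smult_right[symmetric] by (rule ip_cong) (simp_all add: Yv)
      also have "\<dots> = ip d (mv d Y (u l)) v" by (rule herm_ip[OF hY, symmetric])
      also have "\<dots> = 0" using Yu[OF l] by (simp add: ip_def)
      finally show ?thesis using a by simp
    qed
    have vu: "ip d v (u l) = 0" if l: "l < k" for l
      using uv[OF l] by (subst ip_cnj) simp
    have Xv: "mv d X v i = of_real a * v i" if i: "i < d" for i
      using Yv[OF i] mvY[OF i, of v] uv by (simp add: mv_spec_mat[OF i])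
    have "orthonormal d (Suc k) (u(k := v))"
      unfolding orthonormal_def
    proof (intro allI impI)
      fix l m assume "l < Suc k" "m < Suc k"
      then show "ip d ((u(k := v)) l) ((u(k := v)) m) = (if l = m then 1 else 0)"
        using on uv vu vv by (cases "l = k"; cases "m = k") (auto simp: orthonormal_def)
    qed
    moreover have "\<forall>l<Suc k. (c(k := a)) l \<noteq> 0 \<and>
        (\<forall>i<d. mv d X ((u(k := v)) l) i = of_real ((c(k := a)) l) * (u(k := v)) l i)"
      using ev Xv a by (auto simp: less_Suc_eq)
    ultimately have "P (Suc k)" unfolding P_def by blast
    with k(2) show False by fastforce
  qed
  have "X = spec_mat d k c u"
  proof (rule eq_matI)
    fix i j assume ij: "i < dim_row (spec_mat d k c u)" "j < dim_col (spec_mat d k c u)"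
    then have ij': "i < d" "j < d" by (auto simp: spec_mat_def)
    have "Y $$ (i, j) = 0" using ij' by (simp add: \<open>Y = 0\<^sub>m d d\<close>)
    then show "X $$ (i, j) = spec_mat d k c u $$ (i, j)"
      using ij' X by (simp add: Y_def)
  qed (use X in \<open>auto simp: spec_mat_def\<close>)
  with on ev show ?thesis using that by blast
qed

text \<open>Nonnegative factors are absorbed into the generators, so one inductive cone serves for
  positive operators (\<open>V = UNIV\<close>) and for separable ones (product vectors), and a
  bilinear claim reduces by induction to rank-one terms.\<close>

inductive_set gcone :: "nat \<Rightarrow> (nat \<Rightarrow> complex) set \<Rightarrow> complex mat set"
  for d :: nat and V :: "(nat \<Rightarrow> complex) set" where
  zero: "0\<^sub>m d d \<in> gcone d V"
| step: "X \<in> gcone d V \<Longrightarrow> u \<in> V \<Longrightarrow> X + prj d u \<in> gcone d V"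

lemma gcone_carrier: "X \<in> gcone d V \<Longrightarrow> X \<in> carrier_mat d d"
  by (induction rule: gcone.induct) auto

lemma gcone_prj: "u \<in> V \<Longrightarrow> prj d u \<in> gcone d V"
  using gcone.step[OF gcone.zero, of u V d] by simp

lemma gcone_add:
  assumes "X \<in> gcone d V" "Y \<in> gcone d V" shows "X + Y \<in> gcone d V"
  using assms(2,1)
proof (induction rule: gcone.induct)
  case zero
  then show ?case using gcone_carrier[of X] by simp
next
  case (step Y u)
  then have "(X + Y) + prj d u \<in> gcone d V" by (auto intro: gcone.step)
  with step show ?case using gcone_carrier[of X d V] gcone_carrier[of Y d V] by (simp add: assoc_add_mat[of _ d d])
qed

lemma gcone_smult:
  assumes "X \<in> gcone d V" "\<And>u a. u \<in> V \<Longrightarrow> (\<lambda>i. complex_of_real a * u i) \<in> V" "0 \<le> a"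
  shows "complex_of_real a \<cdot>\<^sub>m X \<in> gcone d V"
  using assms(1)
proof (induction rule: gcone.induct)
  case zero
  then show ?case using gcone.zero by simp
next
  case (step X u)
  have "complex_of_real (sqrt a) * complex_of_real (sqrt a) = complex_of_real a"
    using assms(3) by (metis of_real_mult real_sqrt_mult_self abs_of_nonneg)
  then have "complex_of_real a \<cdot>\<^sub>m prj d u = prj d (\<lambda>i. complex_of_real (sqrt a) * u i)"
    by (intro eq_matI) (auto simp: mult_ac) 
  moreover have "complex_of_real a \<cdot>\<^sub>m (X + prj d u) = complex_of_real a \<cdot>\<^sub>m X + complex_of_real a \<cdot>\<^sub>m prj d u"
    using gcone_carrier[OF step(1)] by (simp add: add_smult_distrib_left_mat[of _ d d])
  ultimately show ?case using step assms(2)[OF step(2)] by (simp add: gcone.step)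
qed

lemma tr_gcone_ge0:
  assumes "Y \<in> gcone d V" "X \<in> carrier_mat d d" "\<And>u. u \<in> V \<Longrightarrow> 0 \<le> quad d X u"
  shows "0 \<le> tr (X * Y)"
  using assms(1)
proof (induction rule: gcone.induct)
  case zero
  then show ?case using assms(2) by (simp add: tr_def)
next
  case (step Y u)
  then show ?case using gcone_carrier[OF step(1)] assms
    by (simp add: tr_mult_add[of _ d] tr_mult_prj)
qed

lemma gcone_quad_ge0: "X \<in> gcone d V \<Longrightarrow> 0 \<le> quad d X u"
proof (induction rule: gcone.induct)
  case (step X v)
  then show ?case using gcone_carrier[OF step(1)] by (simp add: quad_add quad_prj_ge0)
qed auto

lemma gcone_psd: "X \<in> gcone d V \<Longrightarrow> psd d X"
  by (simp add: psd_iff gcone_quad_ge0 gcone_carrier)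

text \<open>The eigenvectors, scaled by the square roots of their eigenvalues, are the generators.
  This opens every positive operator to induction over rank-one terms.\<close>

lemma psd_gcone:
  assumes "psd d X" shows "X \<in> gcone d UNIV"
proof -
  obtain k c u where on: "orthonormal d k u" and X: "X = spec_mat d k c u"
    and ev: "\<And>l i. l < k \<Longrightarrow> i < d \<Longrightarrow> mv d X (u l) i = of_real (c l) * u l i"
    using herm_spectral[OF psd_herm[OF assms]] by metis
  have c: "0 \<le> c l" if l: "l < k" for l
  proof -
    have "quad d X (u l) = of_real (c l)"
      unfolding quad_ip using ip_cong[of d "u l" "u l" "mv d X (u l)" "\<lambda>i. of_real (c l) * u l i"]
        ev[OF l] on l by (simp add: ip_smult_right orthonormal_def)
    with psdD(2)[OF assms, of "u l"] show ?thesis by (simp add: less_eq_complex_def)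
  qed
  have "spec_mat d m c u \<in> gcone d UNIV" if "m \<le> k" for m
    using that
  proof (induction m)
    case 0
    have "spec_mat d 0 c u = 0\<^sub>m d d" by (intro eq_matI) (auto simp: spec_mat_def)
    then show ?case using gcone.zero by simp
  next
    case (Suc m)
    have "spec_mat d (Suc m) c u = spec_mat d m c u + prj d (\<lambda>i. of_real (sqrt (c m)) * u m i)"
    proof (rule eq_matI)
      fix i j assume "i < dim_row (spec_mat d m c u + prj d (\<lambda>i. of_real (sqrt (c m)) * u m i))"
        "j < dim_col (spec_mat d m c u + prj d (\<lambda>i. of_real (sqrt (c m)) * u m i))"
      then have ij: "i < d" "j < d" by auto
      have "complex_of_real (c m) = of_real (sqrt (c m)) * of_real (sqrt (c m))"
        using c[of m] Suc by (simp flip: of_real_mult)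
      with ij show "spec_mat d (Suc m) c u $$ (i, j) =
          (spec_mat d m c u + prj d (\<lambda>i. of_real (sqrt (c m)) * u m i)) $$ (i, j)"
        by simp
    qed (auto simp: spec_mat_def)
    with Suc show ?case by (simp add: gcone.step)
  qed
  then show ?thesis using X by simp
qed

lemma psd_eq_gcone: "psd d X \<longleftrightarrow> X \<in> gcone d UNIV"
  using psd_gcone gcone_psd by blast

lemma psd_tr_mult_ge0:
  assumes "psd d X" "psd d Y" shows "0 \<le> tr (X * Y)"
  using tr_gcone_ge0[OF psd_gcone[OF assms(2)] psdD(1)[OF assms(1)]] psdD(2)[OF assms(1)] by blast

text \<open>Let \<open>v\<close> be a unit eigenvector of \<open>R - S\<close> with eigenvalue
  \<open>a \<noteq> 0\<close>. Since \<open>R v\<close> and \<open>S v\<close> have equal norms,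
  \<open>quad d S v = - a / 2\<close> and \<open>quad d R v = a / 2\<close>, and one of the two is
  negative. This uniqueness is what allows the \<open>THE\<close> in \<open>psd_sqrt\<close> to be
  evaluated.\<close>

lemma psd_square_unique:
  assumes R: "psd d R" and S: "psd d S" and eq: "R * R = S * S"
  shows "R = S"
proof (rule ccontr)
  assume ne: "R \<noteq> S"
  have car: "R \<in> carrier_mat d d" "S \<in> carrier_mat d d" using R S psdD by auto
  have hR: "herm d R" and hS: "herm d S" using R S psd_herm by auto
  define D where "D = R - S"
  have hD: "herm d D" unfolding D_def by (rule hermI) (use hermD[OF hR] hermD[OF hS] in auto)
  have "D \<noteq> 0\<^sub>m d d"
  proof
    assume D0: "D = 0\<^sub>m d d"
    have "R = S"
    proof (rule eq_matI)
      fix i j assume "i < dim_row S" "j < dim_col S"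
      then have ij: "i < d" "j < d" using car by auto
      then have "D $$ (i, j) = 0" by (simp add: D0)
      then show "R $$ (i, j) = S $$ (i, j)" using ij car by (simp add: D_def)
    qed (use car in auto)
    with ne show False by simp
  qed
  from herm_nonzero_eigenvector[OF hD this] obtain a v
    where a: "a \<noteq> 0" and vv: "ip d v v = 1" and Dv: "\<And>i. i < d \<Longrightarrow> mv d D v i = of_real a * v i"
    by blast
  have rel: "mv d R v i = mv d S v i + of_real a * v i" if i: "i < d" for i
    using Dv[OF i] car i by (simp add: D_def mv_def left_diff_distrib sum_subtractf algebra_simps)
  have sq: "ip d (mv d T v) (mv d T v) = quad d (T * T) v" if T: "herm d T" for T
  proof -
    have Tc: "T \<in> carrier_mat d d" using T by (rule hermD)
    have "mv d (T * T) v i = mv d T (mv d T v) i" if i: "i < d" for i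
    proof -
      have "mv d (T * T) v i = (\<Sum>j<d. \<Sum>k<d. T $$ (i, k) * T $$ (k, j) * v j)"
        unfolding mv_def using Tc i by (intro sum.cong refl) (simp add: mult_index sum_distrib_right del: index_mult_mat)
      also have "\<dots> = mv d T (mv d T v) i"
        unfolding mv_def by (subst sum.swap) (simp add: sum_distrib_left mult_ac)
      finally show ?thesis .
    qed
    then have "quad d (T * T) v = ip d v (mv d T (mv d T v))"
      unfolding quad_ip by (intro ip_cong) auto
    then show ?thesis using herm_ip[OF T] by metis
  qed
  have "ip d (mv d R v) (mv d R v) = ip d (\<lambda>i. mv d S v i + of_real a * v i) (\<lambda>i. mv d S v i + of_real a * v i)"
    by (rule ip_cong) (simp_all add: rel)
  also have "\<dots> = ip d (mv d S v) (mv d S v) + of_real a * (ip d (mv d S v) v + ip d v (mv d S v)) + (of_real a)\<^sup>2"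
    unfolding ip_add_left ip_add_right ip_smult_left ip_smult_right
    by (simp add: vv power2_eq_square algebra_simps)
  finally have "of_real a * (ip d (mv d S v) v + ip d v (mv d S v)) + (of_real a)\<^sup>2 = 0"
    using sq[OF hR] sq[OF hS] eq by simp
  then have "of_real a * (2 * quad d S v + of_real a) = 0"
    unfolding herm_ip[OF hS] quad_ip by (simp add: power2_eq_square algebra_simps)
  then have 1: "2 * quad d S v = - of_real a" using a by (simp add: add_eq_0_iff)
  have "quad d R v = ip d v (\<lambda>i. mv d S v i + of_real a * v i)"
    unfolding quad_ip by (rule ip_cong) (simp_all add: rel)
  then have 2: "quad d R v = quad d S v + of_real a"
    unfolding ip_add_right ip_smult_right vv by (simp add: quad_ip)
  have "0 \<le> Re (quad d S v)" "0 \<le> Re (quad d R v)"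
    using psdD(2)[OF S, of v] psdD(2)[OF R, of v] by (auto simp: less_eq_complex_def)
  moreover have "2 * Re (quad d S v) = - a" using arg_cong[OF 1, of Re] by simp
  moreover have "Re (quad d R v) = Re (quad d S v) + a" using 2 by simp
  ultimately show False using a by linarith
qed

lemma mat_adjoint_herm:
  assumes "herm d X" shows "mat_adjoint X = X"
  using hermD[OF assms] unfolding mat_adjoint_def
  by (intro eq_matI) (auto simp: mat_of_rows_def)

text \<open>Replacing the eigenvalues by their moduli gives a positive matrix with the same square,
  so it is the root that defines the trace norm.\<close>

lemma trace_norm_spec_mat:
  assumes on: "orthonormal d k u" and h: "herm d (spec_mat d k c u)"
  shows "trace_norm d (spec_mat d k c u) = (\<Sum>l<k. \<bar>c l\<bar>)"
proof -
  let ?S = "\<lambda>c. spec_mat d k c u"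
  have sq: "?S a * ?S a = ?S (\<lambda>l. (a l)\<^sup>2)" for a
  proof (rule eq_matI)
    fix i j assume "i < dim_row (?S (\<lambda>l. (a l)\<^sup>2))" "j < dim_col (?S (\<lambda>l. (a l)\<^sup>2))"
    then have ij: "i < d" "j < d" by (auto simp: spec_mat_def)
    have "(?S a * ?S a) $$ (i, j) = mv d (?S a) (\<lambda>x. ?S a $$ (x, j)) i"
      using ij by (simp add: mult_index[of _ d] mv_def del: index_mult_mat spec_mat_index)
    also have "\<dots> = (\<Sum>l<k. of_real (a l) * ip d (u l) (\<lambda>x. \<Sum>m<k. (of_real (a m) * cnj (u m j)) * u m x) * u l i)"
      unfolding mv_spec_mat[OF ij(1)] using ij
      by (intro sum.cong refl arg_cong2[of _ _ _ _ "(*)"] ip_cong) (auto simp: mult_ac)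
    also have "\<dots> = (\<Sum>l<k. of_real ((a l)\<^sup>2) * u l i * cnj (u l j))"
    proof (intro sum.cong refl)
      fix l assume "l \<in> {..<k}"
      then have "(\<Sum>m<k. (of_real (a m) * cnj (u m j)) * ip d (u l) (u m)) = (\<Sum>m<k. if l = m then of_real (a m) * cnj (u m j) else 0)"
        using on by (intro sum.cong refl) (auto simp: orthonormal_def)
      with \<open>l \<in> {..<k}\<close> show "of_real (a l) * ip d (u l) (\<lambda>x. \<Sum>m<k. (of_real (a m) * cnj (u m j)) * u m x) * u l i
         = of_real ((a l)\<^sup>2) * u l i * cnj (u l j)"
        unfolding ip_sum_right by (simp add: power2_eq_square)
    qed
    finally show "(?S a * ?S a) $$ (i, j) = ?S (\<lambda>l. (a l)\<^sup>2) $$ (i, j)" using ij by simp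
  qed (auto simp: spec_mat_def)
  have p: "psd d (?S (\<lambda>l. \<bar>c l\<bar>))"
    unfolding psd_iff quad_spec_mat of_real_sum[symmetric] less_eq_complex_def by (auto intro!: sum_nonneg)
  have "psd_sqrt d (?S c * ?S c) = ?S (\<lambda>l. \<bar>c l\<bar>)"
    unfolding psd_sqrt_def
  proof (rule the_equality)
    show *: "psd d (?S (\<lambda>l. \<bar>c l\<bar>)) \<and> ?S (\<lambda>l. \<bar>c l\<bar>) * ?S (\<lambda>l. \<bar>c l\<bar>) = ?S c * ?S c"
      using p by (simp add: sq)
    show "R = ?S (\<lambda>l. \<bar>c l\<bar>)" if "psd d R \<and> R * R = ?S c * ?S c" for R
      using psd_square_unique[of d R] that * by auto
  qed
  moreover have "tr (?S (\<lambda>l. \<bar>c l\<bar>)) = (\<Sum>l<k. of_real \<bar>c l\<bar>)"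
  proof -
    have "tr (?S (\<lambda>l. \<bar>c l\<bar>)) = (\<Sum>i<d. \<Sum>l<k. of_real \<bar>c l\<bar> * (cnj (u l i) * u l i))"
      by (simp add: tr_carrier[of _ d] mult_ac)
    also have "\<dots> = (\<Sum>l<k. of_real \<bar>c l\<bar> * ip d (u l) (u l))"
      by (subst sum.swap) (simp add: ip_def sum_distrib_left)
    also have "\<dots> = (\<Sum>l<k. of_real \<bar>c l\<bar>)"
      using on by (intro sum.cong refl) (simp add: orthonormal_def)
    finally show ?thesis .
  qed
  ultimately show ?thesis
    unfolding trace_norm_def mat_adjoint_herm[OF h] by simp
qed

lemma eigenvector_quad:
  assumes "orthonormal d k u" "l < k" "\<And>i. i < d \<Longrightarrow> mv d X (u l) i = of_real c * u l i"
  shows "quad d X (u l) = of_real c"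
  unfolding quad_ip using ip_cong[of d "u l" "u l" "mv d X (u l)" "\<lambda>i. of_real c * u l i"]
    assms by (simp add: ip_smult_right orthonormal_def)

lemma trace_norm_ge0:
  assumes "herm d X" shows "0 \<le> trace_norm d X"
  using herm_spectral[OF assms] trace_norm_spec_mat assms by (metis abs_ge_zero sum_nonneg)

lemma sum_quad_orthonormal_le_tr:
  assumes "psd d X" "orthonormal d k u"
  shows "(\<Sum>l<k. Re (quad d X (u l))) \<le> Re (tr X)"
  using psd_gcone[OF assms(1)]
proof (induction rule: gcone.induct)
  case zero
  then show ?case by (simp add: tr_def)
next
  case (step X v)
  have "(\<Sum>l<k. (cmod (ip d v (u l)))\<^sup>2) = (\<Sum>l<k. (cmod (ip d (u l) v))\<^sup>2)"
    by (subst ip_cnj) simp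
  also have "\<dots> \<le> (\<Sum>i<d. (cmod (v i))\<^sup>2)" by (rule bessel[OF assms(2)])
  finally show ?case using step gcone_carrier[OF step(1)]
    by (simp add: quad_add quad_prj tr_add[of _ d] tr_prj ip_self sum.distrib)
qed

lemma herm_minus_psd: "psd d X \<Longrightarrow> psd d Y \<Longrightarrow> herm d (X - Y)"
  by (rule hermI) (use hermD[OF psd_herm[of d X]] hermD[OF psd_herm[of d Y]] in auto)

text \<open>In an eigenvector \<open>u l\<close> of the difference, the modulus of the eigenvalue is
  at most the sum of the two nonnegative expectations, and these sum to at most the traces.\<close>

lemma trace_norm_psd_minus_le:
  assumes X: "psd d X" and Y: "psd d Y"
  shows "trace_norm d (X - Y) \<le> Re (tr X) + Re (tr Y)"
proof -
  have h: "herm d (X - Y)" using X Y by (rule herm_minus_psd)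
  obtain k c u where on: "orthonormal d k u" and XY: "X - Y = spec_mat d k c u"
    and ev: "\<And>l i. l < k \<Longrightarrow> i < d \<Longrightarrow> mv d (X - Y) (u l) i = of_real (c l) * u l i"
    using herm_spectral[OF h] by metis
  have "\<bar>c l\<bar> \<le> Re (quad d X (u l)) + Re (quad d Y (u l))" if "l < k" for l
  proof -
    have "quad d X (u l) - quad d Y (u l) = of_real (c l)"
      using eigenvector_quad[OF on that ev[OF that]] quad_minus[OF psdD(1)[OF X] psdD(1)[OF Y]] by simp
    then have "Re (quad d X (u l)) - Re (quad d Y (u l)) = c l" by (metis Re_complex_of_real minus_complex.simps(1))
    moreover have "0 \<le> Re (quad d X (u l))" "0 \<le> Re (quad d Y (u l))"
      using psdD(2)[OF X, of "u l"] psdD(2)[OF Y, of "u l"] by (auto simp: less_eq_complex_def)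
    ultimately show ?thesis by linarith
  qed
  then have "(\<Sum>l<k. \<bar>c l\<bar>) \<le> (\<Sum>l<k. Re (quad d X (u l)) + Re (quad d Y (u l)))"
    by (intro sum_mono) auto
  also have "\<dots> \<le> Re (tr X) + Re (tr Y)"
    using sum_quad_orthonormal_le_tr[OF X on] sum_quad_orthonormal_le_tr[OF Y on] by (simp add: sum.distrib)
  finally show ?thesis using trace_norm_spec_mat[OF on] h XY by simp
qed

text \<open>Diagonalizing \<open>X\<close> bounds its pairing with an effect by the sum of the
  moduli of the eigenvalues. The full trace norm, not half of it, appears here; this is the origin
  of the factor 2 in \<open>distillation_converse\<close>.\<close>

lemma tr_mult_le_trace_norm:
  assumes h: "herm d X" and E: "E \<in> carrier_mat d d"
    and E01: "\<And>u. 0 \<le> quad d E u" "\<And>u. quad d E u \<le> ip d u u"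
  shows "\<bar>Re (tr (E * X))\<bar> \<le> trace_norm d X"
proof -
  obtain k c u where on: "orthonormal d k u" and X: "X = spec_mat d k c u"
    using herm_spectral[OF h] by metis
  have "tr (E * X) = (\<Sum>i<d. \<Sum>j<d. \<Sum>l<k. of_real (c l) * (cnj (u l i) * E $$ (i, j) * u l j))"
    unfolding X by (simp add: tr_mult[OF E] sum_distrib_left mult_ac)
  also have "\<dots> = (\<Sum>l<k. of_real (c l) * quad d E (u l))"
  proof -
    have "(\<Sum>i<d. \<Sum>j<d. \<Sum>l<k. of_real (c l) * (cnj (u l i) * E $$ (i, j) * u l j)) =
        (\<Sum>i<d. \<Sum>l<k. \<Sum>j<d. of_real (c l) * (cnj (u l i) * E $$ (i, j) * u l j))"
      by (intro sum.cong refl sum.swap)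
    also have "\<dots> = (\<Sum>l<k. \<Sum>i<d. \<Sum>j<d. of_real (c l) * (cnj (u l i) * E $$ (i, j) * u l j))"
      by (rule sum.swap)
    finally show ?thesis by (simp only: quad_def sum_distrib_left)
  qed
  finally have t: "tr (E * X) = (\<Sum>l<k. of_real (c l) * quad d E (u l))" .
  have "\<bar>Re (tr (E * X))\<bar> \<le> (\<Sum>l<k. \<bar>c l * Re (quad d E (u l))\<bar>)"
    unfolding t by (simp add: sum_abs)
  also have "\<dots> \<le> (\<Sum>l<k. \<bar>c l\<bar>)"
  proof (rule sum_mono)
    fix l assume "l \<in> {..<k}"
    then have "ip d (u l) (u l) = 1" using on by (simp add: orthonormal_def)
    then have "0 \<le> Re (quad d E (u l))" "Re (quad d E (u l)) \<le> 1"
      using E01[of "u l"] by (auto simp: less_eq_complex_def)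
    then show "\<bar>c l * Re (quad d E (u l))\<bar> \<le> \<bar>c l\<bar>"
      by (simp add: abs_mult mult_left_le)
  qed
  finally show ?thesis using trace_norm_spec_mat[OF on] h X by simp
qed

section \<open>Bipartite tensor products and product vectors\<close>

text \<open>\<open>bi1\<close> and \<open>bi2\<close> extract from an index of \<open>AA':BB'\<close> the indices of its \<open>A:B\<close> and
  \<open>A':B'\<close> parts.\<close>

definition bi1 :: "nat \<Rightarrow> nat \<Rightarrow> nat \<Rightarrow> nat \<Rightarrow> nat" where
  "bi1 dB dA' dB' r = (r div (dB * dB') div dA') * dB + r mod (dB * dB') div dB'"

definition bi2 :: "nat \<Rightarrow> nat \<Rightarrow> nat \<Rightarrow> nat \<Rightarrow> nat" where
  "bi2 dB dA' dB' r = (r div (dB * dB') mod dA') * dB' + r mod (dB * dB') mod dB'"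

definition tv :: "nat \<Rightarrow> nat \<Rightarrow> nat \<Rightarrow> (nat \<Rightarrow> complex) \<Rightarrow> (nat \<Rightarrow> complex) \<Rightarrow> nat \<Rightarrow> complex" where
  "tv dB dA' dB' u v r = u (bi1 dB dA' dB' r) * v (bi2 dB dA' dB' r)"

lemma div_mod_mult_add:
  fixes a b n :: nat
  assumes "b < n"
  shows "(a * n + b) div n = a" "(a * n + b) mod n = b"
  using assms by auto

lemma bi_enc:
  assumes "a' < dA'" "b < dB" "b' < dB'"
  shows "bi1 dB dA' dB' ((a * dA' + a') * (dB * dB') + (b * dB' + b')) = a * dB + b"
    and "bi2 dB dA' dB' ((a * dA' + a') * (dB * dB') + (b * dB' + b')) = a' * dB' + b'"
  using assms mult_add_less[of b dB b' dB'] unfolding bi1_def bi2_def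
  by (simp_all only: div_mod_mult_add)

lemma bi_cases:
  fixes r :: nat
  assumes "0 < dB" "0 < dA'" "0 < dB'"
  obtains a a' b b' where "r = (a * dA' + a') * (dB * dB') + (b * dB' + b')" "a' < dA'" "b < dB" "b' < dB'"
proof
  show "r = (r div (dB * dB') div dA' * dA' + r div (dB * dB') mod dA') * (dB * dB')
      + (r mod (dB * dB') div dB' * dB' + r mod (dB * dB') mod dB')" by (simp only: div_mult_mod_eq)
  have "r mod (dB * dB') < dB * dB'" using assms by simp
  then show "r mod (dB * dB') div dB' < dB" by (simp add: less_mult_imp_div_less)
qed (use assms in auto)

lemma bi_less:
  assumes "r < (dA * dA') * (dB * dB')"
  shows "bi1 dB dA' dB' r < dA * dB" "bi2 dB dA' dB' r < dA' * dB'"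
proof -
  have pos: "0 < dB * dB'" "0 < dA'" "0 < dB'"
    using assms by (cases "dB * dB'"; cases dA'; cases dB'; simp)+
  have 1: "r div (dB * dB') < dA * dA'" "r mod (dB * dB') < dB * dB'"
    using assms pos by (auto simp: less_mult_imp_div_less)
  then have "r div (dB * dB') div dA' < dA" "r mod (dB * dB') div dB' < dB"
    by (auto simp: less_mult_imp_div_less)
  then show "bi1 dB dA' dB' r < dA * dB" "bi2 dB dA' dB' r < dA' * dB'"
    using pos unfolding bi1_def bi2_def by (auto intro: mult_add_less)
qed

section \<open>Algebra of the bipartite tensor product\<close>

lemma bip_tensor_carrier [simp]:
  "bip_tensor dA dB dA' dB' X Y \<in> carrier_mat ((dA * dA') * (dB * dB')) ((dA * dA') * (dB * dB'))"
  and bip_tensor_dim [simp]: "dim_row (bip_tensor dA dB dA' dB' X Y) = (dA * dA') * (dB * dB')"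
    "dim_col (bip_tensor dA dB dA' dB' X Y) = (dA * dA') * (dB * dB')"
  by (auto simp: bip_tensor_def)

lemma bip_index:
  assumes "r < (dA * dA') * (dB * dB')" "c < (dA * dA') * (dB * dB')"
  shows "bip_tensor dA dB dA' dB' X Y $$ (r, c) =
    X $$ (bi1 dB dA' dB' r, bi1 dB dA' dB' c) * Y $$ (bi2 dB dA' dB' r, bi2 dB dA' dB' c)"
  using assms by (simp add: bip_tensor_def Let_def bi1_def bi2_def)

lemma sum_mult_index:
  fixes f :: "nat \<Rightarrow> 'a :: comm_monoid_add"
  shows "(\<Sum>r<m * n. f r) = (\<Sum>a<m. \<Sum>b<n. f (a * n + b))"
proof -
  have "(\<Sum>r<m * n. f r) = (\<Sum>(a, b)\<in>{..<m} \<times> {..<n}. f (a * n + b))"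
  proof (rule sum.reindex_bij_witness[of _ "\<lambda>(a, b). a * n + b" "\<lambda>r. (r div n, r mod n)"])
    fix r assume r: "r \<in> {..<m * n}"
    then have "0 < n" by (cases n) auto
    with r show "(r div n, r mod n) \<in> {..<m} \<times> {..<n}" by (auto simp: less_mult_imp_div_less)
  qed (auto simp: mult_add_less)
  then show ?thesis by (simp add: sum.cartesian_product)
qed

text \<open>\<open>bi1\<close> and \<open>bi2\<close> together biject the indices of
  \<open>AA':BB'\<close> with pairs of indices; only the sums over \<open>a'\<close> and
  \<open>b\<close> have to change places.\<close>

lemma sum_bip:
  fixes h :: "nat \<Rightarrow> nat \<Rightarrow> 'a :: comm_monoid_add"
  shows "(\<Sum>r<(dA * dA') * (dB * dB'). h (bi1 dB dA' dB' r) (bi2 dB dA' dB' r)) =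
    (\<Sum>i<dA * dB. \<Sum>j<dA' * dB'. h i j)"
proof -
  have "(\<Sum>r<(dA * dA') * (dB * dB'). h (bi1 dB dA' dB' r) (bi2 dB dA' dB' r)) =
      (\<Sum>a<dA. \<Sum>a'<dA'. \<Sum>b<dB. \<Sum>b'<dB'. h (a * dB + b) (a' * dB' + b'))"
    by (simp add: sum_mult_index bi_enc)
  also have "\<dots> = (\<Sum>a<dA. \<Sum>b<dB. \<Sum>a'<dA'. \<Sum>b'<dB'. h (a * dB + b) (a' * dB' + b'))"
    by (intro sum.cong refl sum.swap)
  also have "\<dots> = (\<Sum>i<dA * dB. \<Sum>j<dA' * dB'. h i j)"
    by (simp add: sum_mult_index)
  finally show ?thesis .
qed

lemma sum_bip2:
  fixes h :: "nat \<Rightarrow> nat \<Rightarrow> nat \<Rightarrow> nat \<Rightarrow> complex"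
  shows "(\<Sum>r<(dA * dA') * (dB * dB'). \<Sum>c<(dA * dA') * (dB * dB').
      h (bi1 dB dA' dB' r) (bi2 dB dA' dB' r) (bi1 dB dA' dB' c) (bi2 dB dA' dB' c)) =
    (\<Sum>i<dA * dB. \<Sum>j<dA' * dB'. \<Sum>k<dA * dB. \<Sum>l<dA' * dB'. h i j k l)"
proof -
  have "(\<Sum>c<(dA * dA') * (dB * dB'). h i j (bi1 dB dA' dB' c) (bi2 dB dA' dB' c)) =
      (\<Sum>k<dA * dB. \<Sum>l<dA' * dB'. h i j k l)" for i j
    by (rule sum_bip[where h = "h i j"])
  then show ?thesis
    using sum_bip[where h = "\<lambda>i j. \<Sum>k<dA * dB. \<Sum>l<dA' * dB'. h i j k l"] by simp
qed

lemma tr_bip_mult: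
  assumes "X \<in> carrier_mat (dA * dB) (dA * dB)" "X' \<in> carrier_mat (dA * dB) (dA * dB)"
    and "Y \<in> carrier_mat (dA' * dB') (dA' * dB')" "Y' \<in> carrier_mat (dA' * dB') (dA' * dB')"
  shows "tr (bip_tensor dA dB dA' dB' X Y * bip_tensor dA dB dA' dB' X' Y') = tr (X * X') * tr (Y * Y')"
proof -
  have "tr (bip_tensor dA dB dA' dB' X Y * bip_tensor dA dB dA' dB' X' Y') =
    (\<Sum>i<dA * dB. \<Sum>j<dA' * dB'. \<Sum>k<dA * dB. \<Sum>l<dA' * dB'.
       (X $$ (i, k) * Y $$ (j, l)) * (X' $$ (k, i) * Y' $$ (l, j)))"
    unfolding tr_mult[OF bip_tensor_carrier bip_tensor_carrier]
    unfolding sum_bip2[symmetric] by (intro sum.cong refl) (simp add: bip_index)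
  also have "\<dots> = (\<Sum>i<dA * dB. \<Sum>j<dA' * dB'. (\<Sum>k<dA * dB. X $$ (i, k) * X' $$ (k, i)) *
       (\<Sum>l<dA' * dB'. Y $$ (j, l) * Y' $$ (l, j)))"
    by (simp add: sum_product mult_ac)
  also have "\<dots> = tr (X * X') * tr (Y * Y')"
    by (simp add: tr_mult[OF assms(1,2)] tr_mult[OF assms(3,4)] sum_product)
  finally show ?thesis .
qed

lemma tr_bip:
  assumes "X \<in> carrier_mat (dA * dB) (dA * dB)" "Y \<in> carrier_mat (dA' * dB') (dA' * dB')"
  shows "tr (bip_tensor dA dB dA' dB' X Y) = tr X * tr Y"
proof -
  have "tr (bip_tensor dA dB dA' dB' X Y) = (\<Sum>i<dA * dB. \<Sum>j<dA' * dB'. X $$ (i, i) * Y $$ (j, j))"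
    unfolding tr_carrier[OF bip_tensor_carrier] sum_bip[symmetric]
    by (intro sum.cong refl) (simp add: bip_index)
  then show ?thesis by (simp add: tr_carrier[OF assms(1)] tr_carrier[OF assms(2)] sum_product)
qed

lemma bip_add_left:
  assumes "X \<in> carrier_mat (dA * dB) (dA * dB)" "X' \<in> carrier_mat (dA * dB) (dA * dB)"
  shows "bip_tensor dA dB dA' dB' (X + X') Y = bip_tensor dA dB dA' dB' X Y + bip_tensor dA dB dA' dB' X' Y"
  using assms by (intro eq_matI) (auto simp: bip_index bi_less distrib_right)

lemma bip_add_right:
  assumes "Y \<in> carrier_mat (dA' * dB') (dA' * dB')" "Y' \<in> carrier_mat (dA' * dB') (dA' * dB')"
  shows "bip_tensor dA dB dA' dB' X (Y + Y') = bip_tensor dA dB dA' dB' X Y + bip_tensor dA dB dA' dB' X Y'"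
  using assms by (intro eq_matI) (auto simp: bip_index bi_less distrib_left)

lemma bip_smult_left:
  assumes "X \<in> carrier_mat (dA * dB) (dA * dB)"
  shows "bip_tensor dA dB dA' dB' (a \<cdot>\<^sub>m X) Y = a \<cdot>\<^sub>m bip_tensor dA dB dA' dB' X Y"
  using assms by (intro eq_matI) (auto simp: bip_index bi_less)

lemma bip_zero_left: "bip_tensor dA dB dA' dB' (0\<^sub>m (dA * dB) (dA * dB)) Y = 0\<^sub>m ((dA * dA') * (dB * dB')) ((dA * dA') * (dB * dB'))"
  by (intro eq_matI) (auto simp: bip_index bi_less)

lemma bip_zero_right: "bip_tensor dA dB dA' dB' X (0\<^sub>m (dA' * dB') (dA' * dB')) = 0\<^sub>m ((dA * dA') * (dB * dB')) ((dA * dA') * (dB * dB'))"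
  by (intro eq_matI) (auto simp: bip_index bi_less)

lemma bip_prj: "bip_tensor dA dB dA' dB' (prj (dA * dB) u) (prj (dA' * dB') v) =
    prj ((dA * dA') * (dB * dB')) (tv dB dA' dB' u v)"
  by (intro eq_matI) (auto simp: bip_index bi_less tv_def)

lemma bi_inj:
  assumes "0 < dB" "0 < dA'" "0 < dB'"
    "bi1 dB dA' dB' r = bi1 dB dA' dB' c" "bi2 dB dA' dB' r = bi2 dB dA' dB' c"
  shows "r = c"
proof -
  obtain a a' b b' where r: "r = (a * dA' + a') * (dB * dB') + (b * dB' + b')" "a' < dA'" "b < dB" "b' < dB'"
    using bi_cases[OF assms(1-3), of r] by blast
  obtain e e' f f' where c: "c = (e * dA' + e') * (dB * dB') + (f * dB' + f')" "e' < dA'" "f < dB" "f' < dB'"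
    using bi_cases[OF assms(1-3), of c] by blast
  have 1: "a * dB + b = e * dB + f" "a' * dB' + b' = e' * dB' + f'"
    using assms(4,5) unfolding r(1) c(1) bi_enc[OF r(2-4)] bi_enc[OF c(2-4)] by auto
  have "a = e" "b = f" using 1(1) r(3) c(3) by (metis div_mod_mult_add)+
  moreover have "a' = e'" "b' = f'" using 1(2) r(4) c(4) by (metis div_mod_mult_add)+
  ultimately show ?thesis using r(1) c(1) by simp
qed

lemma bip_one:
  assumes "0 < dB" "0 < dA'" "0 < dB'"
  shows "bip_tensor dA dB dA' dB' (1\<^sub>m (dA * dB)) (1\<^sub>m (dA' * dB')) = 1\<^sub>m ((dA * dA') * (dB * dB'))"
  using bi_inj[OF assms] by (intro eq_matI) (auto simp: bip_index bi_less)

lemma gcone_bip: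
  assumes "X \<in> gcone (dA * dB) V" "Y \<in> gcone (dA' * dB') V'"
    and "\<And>u v. u \<in> V \<Longrightarrow> v \<in> V' \<Longrightarrow> tv dB dA' dB' u v \<in> W"
  shows "bip_tensor dA dB dA' dB' X Y \<in> gcone ((dA * dA') * (dB * dB')) W"
  using assms(1)
proof (induction rule: gcone.induct)
  case zero
  show ?case unfolding bip_zero_left by (rule gcone.zero)
next
  case (step X u)
  have "bip_tensor dA dB dA' dB' (prj (dA * dB) u) Y \<in> gcone ((dA * dA') * (dB * dB')) W"
    using assms(2)
  proof (induction rule: gcone.induct)
    case zero
    show ?case unfolding bip_zero_right by (rule gcone.zero)
  next
    case (step Y v)
    then show ?case using gcone_carrier[OF step(1)] assms(3)[OF \<open>u \<in> V\<close> step(2)]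
      by (simp add: bip_add_right bip_prj gcone.step)
  qed
  then show ?case using gcone_carrier[OF step(1)] step
    by (simp add: bip_add_left gcone_add)
qed

lemma psd_bip:
  assumes "psd (dA * dB) X" "psd (dA' * dB') Y"
  shows "psd ((dA * dA') * (dB * dB')) (bip_tensor dA dB dA' dB' X Y)"
  using assms gcone_bip[of X dA dB UNIV Y dA' dB' UNIV UNIV] unfolding psd_eq_gcone by auto

text \<open>The equation is literal, not merely up to a permutation of the basis: both bracketings
  encode \<open>|a a' a''>|b b' b''>\<close> by the same number, which is decoded once in each
  nesting.\<close>

lemma bip_assoc:
  assumes "0 < dB" "0 < dA'" "0 < dB'" "0 < dA''" "0 < dB''"
  shows "bip_tensor (dA * dA') (dB * dB') dA'' dB'' (bip_tensor dA dB dA' dB' X Y) Z =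
    bip_tensor dA dB (dA' * dA'') (dB' * dB'') X (bip_tensor dA' dB' dA'' dB'' Y Z)"
proof (rule eq_matI)
  have e: "bi1 dB dA' dB' (bi1 (dB * dB') dA'' dB'' r) = bi1 dB (dA' * dA'') (dB' * dB'') r"
    "bi2 dB dA' dB' (bi1 (dB * dB') dA'' dB'' r) = bi1 dB' dA'' dB'' (bi2 dB (dA' * dA'') (dB' * dB'') r)"
    "bi2 (dB * dB') dA'' dB'' r = bi2 dB' dA'' dB'' (bi2 dB (dA' * dA'') (dB' * dB'') r)" for r
  proof -
    have pos: "0 < dB * dB'" "0 < dA' * dA''" "0 < dB' * dB''" using assms by auto
    obtain x a'' y b'' where r: "r = (x * dA'' + a'') * ((dB * dB') * dB'') + (y * dB'' + b'')"
      "a'' < dA''" "y < dB * dB'" "b'' < dB''"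
      using bi_cases[OF pos(1) assms(4,5), of r] by blast
    define a a' b b' where ab: "a = x div dA'" "a' = x mod dA'" "b = y div dB'" "b' = y mod dB'"
    have x: "x = a * dA' + a'" "a' < dA'" and y: "y = b * dB' + b'" "b' < dB'" using assms by (auto simp: ab)
    have b: "b < dB" using r(3) by (simp add: ab less_mult_imp_div_less)
    have r2: "r = (a * (dA' * dA'') + (a' * dA'' + a'')) * (dB * (dB' * dB'')) + (b * (dB' * dB'') + (b' * dB'' + b''))"
      unfolding r(1) x(1) y(1) by (simp add: algebra_simps)
    have l: "a' * dA'' + a'' < dA' * dA''" "b' * dB'' + b'' < dB' * dB''"
      using x y r by (auto intro: mult_add_less)
    have 1: "bi1 (dB * dB') dA'' dB'' r = x * (dB * dB') + y" "bi2 (dB * dB') dA'' dB'' r = a'' * dB'' + b''"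
      unfolding r(1) using bi_enc[OF r(2-4)] by auto
    have 2: "bi1 dB (dA' * dA'') (dB' * dB'') r = a * dB + b"
      "bi2 dB (dA' * dA'') (dB' * dB'') r = (a' * dA'' + a'') * (dB' * dB'') + (b' * dB'' + b'')"
      unfolding r2 using bi_enc[OF l(1) b l(2)] by auto
    have 3: "bi1 dB dA' dB' (x * (dB * dB') + y) = a * dB + b" "bi2 dB dA' dB' (x * (dB * dB') + y) = a' * dB' + b'"
      unfolding x(1) y(1) using bi_enc[OF x(2) b y(2)] by auto
    show "bi1 dB dA' dB' (bi1 (dB * dB') dA'' dB'' r) = bi1 dB (dA' * dA'') (dB' * dB'') r"
      "bi2 dB dA' dB' (bi1 (dB * dB') dA'' dB'' r) = bi1 dB' dA'' dB'' (bi2 dB (dA' * dA'') (dB' * dB'') r)"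
      "bi2 (dB * dB') dA'' dB'' r = bi2 dB' dA'' dB'' (bi2 dB (dA' * dA'') (dB' * dB'') r)"
      unfolding 1 2 3 using bi_enc[OF r(2) y(2) r(4)] by auto
  qed
  fix r c
  assume "r < dim_row (bip_tensor dA dB (dA' * dA'') (dB' * dB'') X (bip_tensor dA' dB' dA'' dB'' Y Z))"
    "c < dim_col (bip_tensor dA dB (dA' * dA'') (dB' * dB'') X (bip_tensor dA' dB' dA'' dB'' Y Z))"
  then have rc: "r < (dA * (dA' * dA'')) * (dB * (dB' * dB''))" "c < (dA * (dA' * dA'')) * (dB * (dB' * dB''))"
    by auto
  then have rc': "r < ((dA * dA') * dA'') * ((dB * dB') * dB'')" "c < ((dA * dA') * dA'') * ((dB * dB') * dB'')"
    by (auto simp: mult.assoc)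
  show "bip_tensor (dA * dA') (dB * dB') dA'' dB'' (bip_tensor dA dB dA' dB' X Y) Z $$ (r, c) =
      bip_tensor dA dB (dA' * dA'') (dB' * dB'') X (bip_tensor dA' dB' dA'' dB'' Y Z) $$ (r, c)"
    unfolding bip_index[OF rc] bip_index[OF rc'] bip_index[OF bi_less(1)[OF rc'(1)] bi_less(1)[OF rc'(2)]]
      bip_index[OF bi_less(2)[OF rc(1)] bi_less(2)[OF rc(2)]] e
    by (simp add: mult.assoc)
qed (auto simp: mult.assoc)

lemma bip_one_right:
  assumes "X \<in> carrier_mat (dA * dB) (dA * dB)"
  shows "bip_tensor dA dB 1 1 X (1\<^sub>m 1) = X"
proof (rule eq_matI)
  fix r c assume "r < dim_row X" "c < dim_col X"
  then have rc: "r < (dA * 1) * (dB * 1)" "c < (dA * 1) * (dB * 1)" using assms by auto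
  have "bi1 dB 1 1 x = x" "bi2 dB 1 1 x = 0" for x
    by (auto simp: bi1_def bi2_def)
  then show "bip_tensor dA dB 1 1 X (1\<^sub>m 1) $$ (r, c) = X $$ (r, c)"
    unfolding bip_index[OF rc] by simp
qed (use assms in auto)

lemma bip_power_carrier:
  "X \<in> carrier_mat (dA * dB) (dA * dB) \<Longrightarrow> bip_power dA dB X n \<in> carrier_mat (dA ^ n * dB ^ n) (dA ^ n * dB ^ n)"
  by (cases n) (auto simp: bip_tensor_def mult_ac)

lemma bip_power_add:
  assumes "0 < dA" "0 < dB" "X \<in> carrier_mat (dA * dB) (dA * dB)"
  shows "bip_power dA dB X (m + n) =
    bip_tensor (dA ^ m) (dB ^ m) (dA ^ n) (dB ^ n) (bip_power dA dB X m) (bip_power dA dB X n)"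
proof (induction n)
  case 0
  then show ?case using bip_one_right[OF bip_power_carrier[OF assms(3)]] by simp
next
  case (Suc n)
  have "bip_power dA dB X (m + Suc n) = bip_tensor (dA ^ m * dA ^ n) (dB ^ m * dB ^ n) dA dB
      (bip_tensor (dA ^ m) (dB ^ m) (dA ^ n) (dB ^ n) (bip_power dA dB X m) (bip_power dA dB X n)) X"
    using Suc by (simp add: power_add)
  also have "\<dots> = bip_tensor (dA ^ m) (dB ^ m) (dA ^ n * dA) (dB ^ n * dB) (bip_power dA dB X m)
      (bip_power dA dB X (Suc n))"
    using assms by (subst bip_assoc) auto
  finally show ?case by (simp add: mult.commute)
qed

lemma bip_power_mult:
  assumes "0 < dA" "0 < dB" "X \<in> carrier_mat (dA * dB) (dA * dB)"
  shows "bip_power dA dB X (k * j) = bip_power (dA ^ k) (dB ^ k) (bip_power dA dB X k) j"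
proof (induction j)
  case (Suc j)
  have "bip_power dA dB X (k * Suc j) = bip_power dA dB X (k * j + k)" by (simp add: add.commute)
  then show ?case unfolding bip_power_add[OF assms] by (simp add: Suc power_mult)
qed simp

lemma tr_bip_power:
  assumes "X \<in> carrier_mat (dA * dB) (dA * dB)"
  shows "tr (bip_power dA dB X n) = tr X ^ n"
proof (induction n)
  case 0
  then show ?case by (simp add: tr_def)
next
  case (Suc n)
  then show ?case using tr_bip[OF bip_power_carrier[OF assms, of n] assms] by simp
qed

lemma psd_bip_power:
  assumes "psd (dA * dB) X"
  shows "psd (dA ^ n * dB ^ n) (bip_power dA dB X n)"
proof (induction n)
  case 0
  then show ?case by (simp add: psd_iff ip_self_ge0)
next
  case (Suc n)
  then show ?case using psd_bip[OF Suc assms] by (simp add: mult_ac)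
qed

lemma states_bip_power:
  assumes "\<rho> \<in> states (dA * dB)"
  shows "bip_power dA dB \<rho> n \<in> states (dA ^ n * dB ^ n)"
  using assms psd_bip_power tr_bip_power[OF psdD(1)] by (auto simp: states_def)

section \<open>Product vectors and the separable cone\<close>

definition pv :: "nat \<Rightarrow> (nat \<Rightarrow> complex) \<Rightarrow> (nat \<Rightarrow> complex) \<Rightarrow> nat \<Rightarrow> complex" where
  "pv dB a b r = a (r div dB) * b (r mod dB)"

text \<open>No \<open>dA\<close> occurs: quotient and remainder by \<open>dB\<close> already
  determine the two factors, and entries beyond the dimension are never read.\<close>

definition pvs :: "nat \<Rightarrow> (nat \<Rightarrow> complex) set" where
  "pvs dB = {pv dB a b | a b. True}"

abbreviation pcone :: "nat \<Rightarrow> nat \<Rightarrow> complex mat set" where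
  "pcone dA dB \<equiv> gcone (dA * dB) (pvs dB)"

lemma pv_in_pvs [simp]: "pv dB a b \<in> pvs dB"
  by (auto simp: pvs_def)

lemma pvs_scale: "u \<in> pvs dB \<Longrightarrow> (\<lambda>i. c * u i) \<in> pvs dB"
proof -
  assume "u \<in> pvs dB"
  then obtain a b where u: "u = pv dB a b" by (auto simp: pvs_def)
  have "(\<lambda>i. c * u i) = pv dB (\<lambda>x. c * a x) b" by (rule ext) (simp add: u pv_def)
  then show ?thesis by simp
qed

lemma pcone_smult: "X \<in> pcone dA dB \<Longrightarrow> 0 \<le> a \<Longrightarrow> complex_of_real a \<cdot>\<^sub>m X \<in> pcone dA dB"
  by (rule gcone_smult) (auto intro: pvs_scale)

text \<open>After regrouping, the local factors are the tensor products of the \<open>A\<close>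
  parts and of the \<open>B\<close> parts.\<close>

lemma tv_pvs:
  assumes "0 < dB" "0 < dA'" "0 < dB'" "u \<in> pvs dB" "v \<in> pvs dB'"
  shows "tv dB dA' dB' u v \<in> pvs (dB * dB')"
proof -
  obtain a b a' b' where uv: "u = pv dB a b" "v = pv dB' a' b'" using assms by (auto simp: pvs_def)
  have "tv dB dA' dB' u v = pv (dB * dB') (\<lambda>i. a (i div dA') * a' (i mod dA')) (\<lambda>j. b (j div dB') * b' (j mod dB'))"
  proof
    fix r
    obtain i i' j j' where r: "r = (i * dA' + i') * (dB * dB') + (j * dB' + j')" "i' < dA'" "j < dB" "j' < dB'"
      using bi_cases[OF assms(1-3), of r] by blast
    show "tv dB dA' dB' u v r = pv (dB * dB') (\<lambda>i. a (i div dA') * a' (i mod dA')) (\<lambda>j. b (j div dB') * b' (j mod dB')) r"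
      unfolding r(1) tv_def bi_enc[OF r(2-4)] uv pv_def
      unfolding div_mod_mult_add[OF r(2)] div_mod_mult_add[OF r(3)] div_mod_mult_add[OF r(4)]
        div_mod_mult_add[OF mult_add_less[OF r(3,4)]]
      by (simp add: mult_ac)
  qed
  then show ?thesis by simp
qed

lemma pcone_bip:
  assumes "0 < dB" "0 < dA'" "0 < dB'" "X \<in> pcone dA dB" "Y \<in> pcone dA' dB'"
  shows "bip_tensor dA dB dA' dB' X Y \<in> pcone (dA * dA') (dB * dB')"
  using gcone_bip[OF assms(4,5)] tv_pvs[OF assms(1-3)] by blast

lemma gcone_sum_prj:
  fixes n :: nat
  assumes "\<And>k. k < n \<Longrightarrow> u k \<in> V"
  shows "mat d d (\<lambda>(i, j). \<Sum>k<n. u k i * cnj (u k j)) \<in> gcone d V"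
  using assms
proof (induction n)
  case 0
  have "mat d d (\<lambda>(i, j). \<Sum>k<0. u k i * cnj (u k j)) = 0\<^sub>m d d" by (intro eq_matI) auto
  then show ?case using gcone.zero by metis
next
  case (Suc n)
  have "mat d d (\<lambda>(i, j). \<Sum>k<Suc n. u k i * cnj (u k j)) =
     mat d d (\<lambda>(i, j). \<Sum>k<n. u k i * cnj (u k j)) + prj d (u n)" by (intro eq_matI) auto
  with Suc show ?case by (simp add: gcone.step)
qed

lemma pcone_one: "1\<^sub>m (dA * dB) \<in> pcone dA dB"
proof (cases "dB = 0")
  case True
  then have "1\<^sub>m (dA * dB) = (0\<^sub>m (dA * dB) (dA * dB) :: complex mat)" by (intro eq_matI) auto
  then show ?thesis using gcone.zero[of "dA * dB"] by simp
next
  case False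
  define u where "u k = pv dB (\<lambda>x. if x = k div dB then 1 else 0) (\<lambda>x. if x = k mod dB then 1 else 0)" for k :: nat
  have u: "u k i = (if i = k then 1 else 0)" for k i
    unfolding u_def pv_def by (metis (mono_tags, lifting) mult_cancel_right1 mult_zero_left mult_zero_right div_mult_mod_eq)
  have "1\<^sub>m (dA * dB) = mat (dA * dB) (dA * dB) (\<lambda>(i, j). \<Sum>k<dA * dB. u k i * cnj (u k j))"
  proof (rule eq_matI)
    fix i j assume "i < dim_row (mat (dA * dB) (dA * dB) (\<lambda>(i, j). \<Sum>k<dA * dB. u k i * cnj (u k j)))"
      "j < dim_col (mat (dA * dB) (dA * dB) (\<lambda>(i, j). \<Sum>k<dA * dB. u k i * cnj (u k j)))"
    then have ij: "i < dA * dB" "j < dA * dB" by auto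
    have "(\<Sum>k<dA * dB. u k i * cnj (u k j)) = u i i * cnj (u i j)"
      by (rule sum_one_point[OF ij(1)]) (simp add: u)
    with ij show "1\<^sub>m (dA * dB) $$ (i, j) = mat (dA * dB) (dA * dB) (\<lambda>(i, j). \<Sum>k<dA * dB. u k i * cnj (u k j)) $$ (i, j)"
      by (simp add: u)
  qed auto
  also have "\<dots> \<in> pcone dA dB" by (rule gcone_sum_prj) (simp add: u_def)
  finally show ?thesis .
qed

section \<open>Partial transposition\<close>

lemma partial_transpose_carrier [simp]: "partial_transpose dA dB X \<in> carrier_mat (dA * dB) (dA * dB)"
  and partial_transpose_dim [simp]: "dim_row (partial_transpose dA dB X) = dA * dB"
    "dim_col (partial_transpose dA dB X) = dA * dB"
  and partial_transpose_index: "r < dA * dB \<Longrightarrow> c < dA * dB \<Longrightarrow>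
    partial_transpose dA dB X $$ (r, c) = X $$ ((r div dB) * dB + c mod dB, (c div dB) * dB + r mod dB)"
  by (auto simp: partial_transpose_def)

lemma pt_less:
  fixes r c :: nat
  assumes "r < dA * dB" "c < dA * dB"
  shows "(r div dB) * dB + c mod dB < dA * dB"
proof -
  have "0 < dB" using assms by (cases dB) auto
  then show ?thesis using assms by (intro mult_add_less) (auto simp: less_mult_imp_div_less)
qed

lemma pt_swap:
  fixes r c :: nat
  assumes "r < dA * dB" "c < dA * dB"
  shows "((r div dB) * dB + c mod dB) div dB = r div dB" "((r div dB) * dB + c mod dB) mod dB = c mod dB"
proof -
  have "0 < dB" using assms by (cases dB) auto
  then show "((r div dB) * dB + c mod dB) div dB = r div dB" "((r div dB) * dB + c mod dB) mod dB = c mod dB"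
    by auto
qed

lemma partial_transpose_twice:
  assumes "X \<in> carrier_mat (dA * dB) (dA * dB)"
  shows "partial_transpose dA dB (partial_transpose dA dB X) = X"
  using assms by (intro eq_matI) (auto simp: partial_transpose_index pt_less pt_swap)

lemma partial_transpose_add:
  assumes "X \<in> carrier_mat (dA * dB) (dA * dB)" "Y \<in> carrier_mat (dA * dB) (dA * dB)"
  shows "partial_transpose dA dB (X + Y) = partial_transpose dA dB X + partial_transpose dA dB Y"
  using assms by (intro eq_matI) (auto simp: partial_transpose_index pt_less)

text \<open>Transposing on \<open>B\<close> only exchanges the summation variables \<open>b\<close>
  and \<open>b'\<close>, so it moves across the trace pairing.\<close>

lemma tr_partial_transpose_mult:
  assumes "X \<in> carrier_mat (dA * dB) (dA * dB)" "Y \<in> carrier_mat (dA * dB) (dA * dB)"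
  shows "tr (partial_transpose dA dB X * Y) = tr (X * partial_transpose dA dB Y)"
proof -
  have "tr (partial_transpose dA dB X * Y) =
    (\<Sum>a<dA. \<Sum>b<dB. \<Sum>a'<dA. \<Sum>b'<dB. X $$ (a * dB + b', a' * dB + b) * Y $$ (a' * dB + b', a * dB + b))"
    unfolding tr_mult[OF partial_transpose_carrier assms(2)]
    by (simp add: sum_mult_index partial_transpose_index mult_add_less)
  also have "\<dots> = (\<Sum>a<dA. \<Sum>a'<dA. \<Sum>b<dB. \<Sum>b'<dB. X $$ (a * dB + b', a' * dB + b) * Y $$ (a' * dB + b', a * dB + b))"
    by (intro sum.cong refl sum.swap)
  also have "\<dots> = (\<Sum>a<dA. \<Sum>a'<dA. \<Sum>b<dB. \<Sum>b'<dB. X $$ (a * dB + b, a' * dB + b') * Y $$ (a' * dB + b, a * dB + b'))"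
    by (rule sum.cong[OF refl], rule sum.cong[OF refl], rule sum.swap)
  also have "\<dots> = (\<Sum>a<dA. \<Sum>b<dB. \<Sum>a'<dA. \<Sum>b'<dB. X $$ (a * dB + b, a' * dB + b') * Y $$ (a' * dB + b, a * dB + b'))"
    by (intro sum.cong refl sum.swap)
  also have "\<dots> = tr (X * partial_transpose dA dB Y)"
    unfolding tr_mult[OF assms(1) partial_transpose_carrier]
    by (simp add: sum_mult_index partial_transpose_index mult_add_less)
  finally show ?thesis .
qed

lemma tr_partial_transpose:
  assumes "X \<in> carrier_mat (dA * dB) (dA * dB)"
  shows "tr (partial_transpose dA dB X) = tr X"
  unfolding tr_carrier[OF assms] tr_carrier[OF partial_transpose_carrier]
  by (intro sum.cong refl) (simp add: partial_transpose_index)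

lemma herm_partial_transpose:
  assumes "herm (dA * dB) X"
  shows "herm (dA * dB) (partial_transpose dA dB X)"
  by (rule hermI) (auto simp: partial_transpose_index hermD(2)[OF assms] pt_less)

text \<open>The transpose of the projection along \<open>b\<close> is the projection along its
  complex conjugate, so generators go to generators.\<close>

lemma pcone_partial_transpose:
  assumes "X \<in> pcone dA dB" shows "partial_transpose dA dB X \<in> pcone dA dB"
  using assms
proof (induction rule: gcone.induct)
  case zero
  have "partial_transpose dA dB (0\<^sub>m (dA * dB) (dA * dB)) = 0\<^sub>m (dA * dB) (dA * dB)"
    by (intro eq_matI) (auto simp: partial_transpose_index pt_less)
  then show ?case using gcone.zero by simp
next
  case (step X u)
  then obtain a b where u: "u = pv dB a b" by (auto simp: pvs_def)
  have "partial_transpose dA dB (prj (dA * dB) u) = prj (dA * dB) (pv dB a (\<lambda>x. cnj (b x)))"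
    by (intro eq_matI) (simp_all add: partial_transpose_index pt_less u pv_def pt_swap, (simp_all add: mult_ac)?)
  with step gcone_carrier[OF step(1)] show ?case by (simp add: partial_transpose_add gcone.step)
qed

lemma partial_transpose_bip:
  assumes "0 < dB" "0 < dA'" "0 < dB'"
  shows "partial_transpose (dA * dA') (dB * dB') (bip_tensor dA dB dA' dB' X Y) =
    bip_tensor dA dB dA' dB' (partial_transpose dA dB X) (partial_transpose dA' dB' Y)"
proof (rule eq_matI)
  fix r c
  assume "r < dim_row (bip_tensor dA dB dA' dB' (partial_transpose dA dB X) (partial_transpose dA' dB' Y))"
    "c < dim_col (bip_tensor dA dB dA' dB' (partial_transpose dA dB X) (partial_transpose dA' dB' Y))"
  then have rc: "r < (dA * dA') * (dB * dB')" "c < (dA * dA') * (dB * dB')" by auto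
  obtain a a' b b' where r: "r = (a * dA' + a') * (dB * dB') + (b * dB' + b')" "a' < dA'" "b < dB" "b' < dB'"
    using bi_cases[OF assms(1-3), of r] by blast
  obtain e e' f f' where c: "c = (e * dA' + e') * (dB * dB') + (f * dB' + f')" "e' < dA'" "f < dB" "f' < dB'"
    using bi_cases[OF assms(1-3), of c] by blast
  let ?x = "(a * dA' + a') * (dB * dB') + (f * dB' + f')"
  let ?y = "(e * dA' + e') * (dB * dB') + (b * dB' + b')"
  have s: "r div (dB * dB') * (dB * dB') + c mod (dB * dB') = ?x"
    "c div (dB * dB') * (dB * dB') + r mod (dB * dB') = ?y"
    unfolding r(1) c(1)
    unfolding div_mod_mult_add[OF mult_add_less[OF r(3,4)]] div_mod_mult_add[OF mult_add_less[OF c(3,4)]] by auto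
  have xy: "?x < (dA * dA') * (dB * dB')" "?y < (dA * dA') * (dB * dB')"
    using pt_less[OF rc] pt_less[OF rc(2,1)] unfolding s by auto
  have l: "a * dB + b < dA * dB" "a' * dB' + b' < dA' * dB'" "e * dB + f < dA * dB" "e' * dB' + f' < dA' * dB'"
    using bi_less[OF rc(1)] bi_less[OF rc(2)] unfolding r(1) c(1) bi_enc[OF r(2-4)] bi_enc[OF c(2-4)] by auto
  show "partial_transpose (dA * dA') (dB * dB') (bip_tensor dA dB dA' dB' X Y) $$ (r, c) =
    bip_tensor dA dB dA' dB' (partial_transpose dA dB X) (partial_transpose dA' dB' Y) $$ (r, c)"
    unfolding partial_transpose_index[OF rc] s bip_index[OF xy] bip_index[OF rc]
    unfolding bi_enc[OF r(2) c(3,4)] bi_enc[OF c(2) r(3,4)]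
    unfolding r(1) c(1) bi_enc[OF r(2-4)] bi_enc[OF c(2-4)]
    unfolding partial_transpose_index[OF l(1,3)] partial_transpose_index[OF l(2,4)]
    unfolding div_mod_mult_add[OF r(3)] div_mod_mult_add[OF r(4)] div_mod_mult_add[OF c(3)] div_mod_mult_add[OF c(4)]
    ..
qed auto

text \<open>This says that \<open>Y - X\<close> is block positive, that is, that it lies in the dual
  of the separable cone (\<open>pord_tr_mult\<close>, \<open>pord_from_sep_states\<close>).\<close>

definition pord :: "nat \<Rightarrow> nat \<Rightarrow> complex mat \<Rightarrow> complex mat \<Rightarrow> bool" where
  "pord dA dB X Y \<longleftrightarrow> (\<forall>u\<in>pvs dB. quad (dA * dB) X u \<le> quad (dA * dB) Y u)"

text \<open>\<open>U\<close> is the vector \<open>u\<close> read as a matrix over pairs of indices,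
  and the inner sum is its partial contraction with \<open>v\<close>.\<close>

lemma quad_bip_prj_right:
  assumes "\<And>r. r < (dA * dA') * (dB * dB') \<Longrightarrow> u r = U (bi1 dB dA' dB' r) (bi2 dB dA' dB' r)"
  shows "quad ((dA * dA') * (dB * dB')) (bip_tensor dA dB dA' dB' X (prj (dA' * dB') v)) u =
    quad (dA * dB) X (\<lambda>x. \<Sum>y<dA' * dB'. cnj (v y) * U x y)"
proof -
  have "quad ((dA * dA') * (dB * dB')) (bip_tensor dA dB dA' dB' X (prj (dA' * dB') v)) u =
    (\<Sum>i<dA * dB. \<Sum>j<dA' * dB'. \<Sum>k<dA * dB. \<Sum>l<dA' * dB'.
       cnj (U i j) * (X $$ (i, k) * (v j * cnj (v l))) * U k l)"
    unfolding quad_def sum_bip2[symmetric]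
    by (intro sum.cong refl) (simp add: bip_index bi_less assms)
  also have "\<dots> = (\<Sum>i<dA * dB. \<Sum>k<dA * dB. \<Sum>j<dA' * dB'. \<Sum>l<dA' * dB'.
       cnj (U i j) * (X $$ (i, k) * (v j * cnj (v l))) * U k l)"
    by (intro sum.cong refl sum.swap)
  also have "\<dots> = (\<Sum>i<dA * dB. \<Sum>k<dA * dB. X $$ (i, k) *
      ((\<Sum>j<dA' * dB'. v j * cnj (U i j)) * (\<Sum>l<dA' * dB'. cnj (v l) * U k l)))"
    unfolding sum_product unfolding sum_distrib_left by (simp add: mult_ac)
  also have "\<dots> = quad (dA * dB) X (\<lambda>x. \<Sum>y<dA' * dB'. cnj (v y) * U x y)"
    by (simp add: quad_def mult_ac)
  finally show ?thesis .
qed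

lemma quad_bip_prj_left:
  assumes "\<And>r. r < (dA * dA') * (dB * dB') \<Longrightarrow> u r = U (bi1 dB dA' dB' r) (bi2 dB dA' dB' r)"
  shows "quad ((dA * dA') * (dB * dB')) (bip_tensor dA dB dA' dB' (prj (dA * dB) v) Y) u =
    quad (dA' * dB') Y (\<lambda>y. \<Sum>x<dA * dB. cnj (v x) * U x y)"
proof -
  have "quad ((dA * dA') * (dB * dB')) (bip_tensor dA dB dA' dB' (prj (dA * dB) v) Y) u =
    (\<Sum>i<dA * dB. \<Sum>j<dA' * dB'. \<Sum>k<dA * dB. \<Sum>l<dA' * dB'.
       cnj (U i j) * ((v i * cnj (v k)) * Y $$ (j, l)) * U k l)"
    unfolding quad_def sum_bip2[symmetric]
    by (intro sum.cong refl) (simp add: bip_index bi_less assms)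
  also have "\<dots> = (\<Sum>j<dA' * dB'. \<Sum>i<dA * dB. \<Sum>k<dA * dB. \<Sum>l<dA' * dB'.
       cnj (U i j) * ((v i * cnj (v k)) * Y $$ (j, l)) * U k l)"
    by (rule sum.swap)
  also have "\<dots> = (\<Sum>j<dA' * dB'. \<Sum>i<dA * dB. \<Sum>l<dA' * dB'. \<Sum>k<dA * dB.
       cnj (U i j) * ((v i * cnj (v k)) * Y $$ (j, l)) * U k l)"
    by (intro sum.cong refl sum.swap)
  also have "\<dots> = (\<Sum>j<dA' * dB'. \<Sum>l<dA' * dB'. \<Sum>i<dA * dB. \<Sum>k<dA * dB.
       cnj (U i j) * ((v i * cnj (v k)) * Y $$ (j, l)) * U k l)"
    by (intro sum.cong refl sum.swap)
  also have "\<dots> = (\<Sum>j<dA' * dB'. \<Sum>l<dA' * dB'. Y $$ (j, l) *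
      ((\<Sum>i<dA * dB. v i * cnj (U i j)) * (\<Sum>k<dA * dB. cnj (v k) * U k l)))"
    unfolding sum_product unfolding sum_distrib_left by (simp add: mult_ac)
  also have "\<dots> = quad (dA' * dB') Y (\<lambda>y. \<Sum>x<dA * dB. cnj (v x) * U x y)"
    by (simp add: quad_def mult_ac)
  finally show ?thesis .
qed

lemma pv_bip_index:
  assumes "0 < dB" "0 < dA'" "0 < dB'"
  shows "pv (dB * dB') \<alpha> \<beta> r = (\<lambda>x y. \<alpha> (x div dB * dA' + y div dB') * \<beta> (x mod dB * dB' + y mod dB'))
    (bi1 dB dA' dB' r) (bi2 dB dA' dB' r)"
proof -
  obtain i i' j j' where r: "r = (i * dA' + i') * (dB * dB') + (j * dB' + j')" "i' < dA'" "j < dB" "j' < dB'"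
    using bi_cases[OF assms(1-3), of r] by blast
  show ?thesis
    unfolding r(1) bi_enc[OF r(2-4)] pv_def
    unfolding div_mod_mult_add[OF r(3)] div_mod_mult_add[OF r(4)] div_mod_mult_add[OF mult_add_less[OF r(3,4)]] ..
qed

text \<open>Each generator of \<open>Y\<close> is a product vector; contracting a product vector
  with it leaves a product vector, to which the hypothesis applies. For \<open>Y\<close> merely
  positive the conclusion can fail, because the contraction may then be entangled.\<close>

lemma pord_bip_left:
  assumes pos: "0 < dB" "0 < dA'" "0 < dB'" and le: "pord dA dB X X'" and Y: "Y \<in> pcone dA' dB'"
  shows "pord (dA * dA') (dB * dB') (bip_tensor dA dB dA' dB' X Y) (bip_tensor dA dB dA' dB' X' Y)"
  using Y
proof (induction rule: gcone.induct)
  case zero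
  show ?case by (simp add: bip_zero_right pord_def)
next
  case (step Y v)
  obtain c e where v: "v = pv dB' c e" using step by (auto simp: pvs_def)
  have "quad ((dA * dA') * (dB * dB')) (bip_tensor dA dB dA' dB' X (prj (dA' * dB') v)) u \<le>
     quad ((dA * dA') * (dB * dB')) (bip_tensor dA dB dA' dB' X' (prj (dA' * dB') v)) u" if u: "u \<in> pvs (dB * dB')" for u
  proof -
    obtain \<alpha> \<beta> where u: "u = pv (dB * dB') \<alpha> \<beta>" using u by (auto simp: pvs_def)
    note q = quad_bip_prj_right[where u = u, unfolded u, OF pv_bip_index[OF pos]]
    have "(\<lambda>x. \<Sum>y<dA' * dB'. cnj (v y) * (\<alpha> (x div dB * dA' + y div dB') * \<beta> (x mod dB * dB' + y mod dB'))) =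
      pv dB (\<lambda>x. \<Sum>i<dA'. cnj (c i) * \<alpha> (x * dA' + i)) (\<lambda>x. \<Sum>j<dB'. cnj (e j) * \<beta> (x * dB' + j))"
      by (rule ext) (simp add: sum_mult_index v pv_def sum_product mult_ac)
    then show ?thesis unfolding u q using le by (auto simp: pord_def)
  qed
  then show ?case using step gcone_carrier[OF step(1)]
    by (auto simp: pord_def bip_add_right quad_add intro!: add_mono)
qed

lemma pord_bip_right:
  assumes pos: "0 < dB" "0 < dA'" "0 < dB'" and le: "pord dA' dB' Y Y'" and X: "X \<in> pcone dA dB"
  shows "pord (dA * dA') (dB * dB') (bip_tensor dA dB dA' dB' X Y) (bip_tensor dA dB dA' dB' X Y')"
  using X
proof (induction rule: gcone.induct)
  case zero
  show ?case by (simp add: bip_zero_left pord_def)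
next
  case (step X v)
  obtain c e where v: "v = pv dB c e" using step by (auto simp: pvs_def)
  have "quad ((dA * dA') * (dB * dB')) (bip_tensor dA dB dA' dB' (prj (dA * dB) v) Y) u \<le>
     quad ((dA * dA') * (dB * dB')) (bip_tensor dA dB dA' dB' (prj (dA * dB) v) Y') u" if u: "u \<in> pvs (dB * dB')" for u
  proof -
    obtain \<alpha> \<beta> where u: "u = pv (dB * dB') \<alpha> \<beta>" using u by (auto simp: pvs_def)
    note q = quad_bip_prj_left[where u = u, unfolded u, OF pv_bip_index[OF pos]]
    have "(\<lambda>y. \<Sum>x<dA * dB. cnj (v x) * (\<alpha> (x div dB * dA' + y div dB') * \<beta> (x mod dB * dB' + y mod dB'))) =
      pv dB' (\<lambda>y. \<Sum>i<dA. cnj (c i) * \<alpha> (i * dA' + y)) (\<lambda>y. \<Sum>j<dB. cnj (e j) * \<beta> (j * dB' + y))"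
      by (rule ext) (simp add: sum_mult_index v pv_def sum_product mult_ac)
    then show ?thesis unfolding u q using le by (auto simp: pord_def)
  qed
  then show ?case using step gcone_carrier[OF step(1)]
    by (auto simp: pord_def bip_add_left quad_add intro!: add_mono)
qed

lemma pord_tr_mult:
  assumes "pord dA dB X Y" "X \<in> carrier_mat (dA * dB) (dA * dB)" "Y \<in> carrier_mat (dA * dB) (dA * dB)"
    and Z: "Z \<in> pcone dA dB"
  shows "tr (X * Z) \<le> tr (Y * Z)"
  using Z
proof (induction rule: gcone.induct)
  case zero
  then show ?case using assms by (simp add: tr_def)
next
  case (step Z u)
  then show ?case using assms gcone_carrier[OF step(1)]
    by (auto simp: tr_mult_add[of _ "dA * dB"] tr_mult_prj pord_def intro!: add_mono)
qed

section \<open>Separable states and weighted separable measurements\<close>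

text \<open>Bessel's inequality for the one-vector system formed by the normalized
  \<open>u\<close>.\<close>

lemma cauchy_schwarz_ip: "(cmod (ip d u v))\<^sup>2 \<le> (\<Sum>i<d. (cmod (u i))\<^sup>2) * (\<Sum>i<d. (cmod (v i))\<^sup>2)"
proof (cases "(\<Sum>i<d. (cmod (u i))\<^sup>2) = 0")
  case True
  then have "\<forall>i<d. u i = 0" by (simp add: sum_nonneg_eq_0_iff)
  then show ?thesis using True by (simp add: ip_def)
next
  case False
  define n where "n = (\<Sum>i<d. (cmod (u i))\<^sup>2)"
  have n: "0 < n" using False by (simp add: n_def sum_nonneg less_le)
  define w where "w = (\<lambda>i. of_real (1 / sqrt n) * u i)"
  have "ip d w w = of_real (1 / sqrt n * (1 / sqrt n) * n)"
    unfolding w_def ip_smult_left ip_smult_right ip_self n_def[symmetric] complex_cnj_complex_of_real of_real_mult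
    by (simp only: mult.assoc)
  also have "1 / sqrt n * (1 / sqrt n) * n = 1" using n by simp
  finally have "orthonormal d 1 (\<lambda>_. w)" by (simp add: orthonormal_def)
  from bessel[OF this, of v] have "(cmod (ip d w v))\<^sup>2 \<le> (\<Sum>i<d. (cmod (v i))\<^sup>2)" by simp
  moreover have "(cmod (ip d w v))\<^sup>2 = (cmod (ip d u v))\<^sup>2 / n"
    unfolding w_def ip_smult_left using n by (simp add: norm_mult norm_divide power_divide power_mult_distrib)
  ultimately show ?thesis using n by (simp add: n_def[symmetric] field_simps)
qed

lemma psd_quad_le_tr:
  assumes "psd d X" shows "quad d X u \<le> tr X * ip d u u"
  using psd_gcone[OF assms]
proof (induction rule: gcone.induct)
  case zero
  then show ?case by (simp add: tr_def)
next
  case (step X v)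
  have "quad d (prj d v) u \<le> ip d v v * ip d u u"
    unfolding quad_prj ip_self of_real_mult[symmetric] less_eq_complex_def
    using cauchy_schwarz_ip[of d v u] by simp
  then show ?case using step gcone_carrier[OF step(1)]
    by (simp add: quad_add tr_add[of _ d] tr_prj distrib_right add_mono)
qed

text \<open>For a generator, twice the product of two moduli is at most the sum of their squares.
  The resulting bound on entries replaces compactness: it yields the finite net of states in
  \<open>exists_feas\<close> and the feasible point in \<open>kset_nonempty\<close>.\<close>

lemma psd_entry_le_tr:
  assumes "psd d X" "i < d" "j < d" shows "cmod (X $$ (i, j)) \<le> Re (tr X)"
  using psd_gcone[OF assms(1)]
proof (induction rule: gcone.induct)
  case zero
  then show ?case using assms by (simp add: tr_def)
next
  case (step X v)
  have le: "(cmod (v k))\<^sup>2 \<le> (\<Sum>l<d. (cmod (v l))\<^sup>2)" if "k < d" for k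
    using that by (intro member_le_sum) auto
  have "2 * (cmod (v i) * cmod (v j)) \<le> (cmod (v i))\<^sup>2 + (cmod (v j))\<^sup>2"
    using sum_squares_bound[of "cmod (v i)" "cmod (v j)"] by simp
  then have "cmod (prj d v $$ (i, j)) \<le> (\<Sum>l<d. (cmod (v l))\<^sup>2)"
    using le[OF assms(2)] le[OF assms(3)] assms by (simp add: norm_mult)
  then have "cmod (X $$ (i, j) + prj d v $$ (i, j)) \<le> Re (tr X) + (\<Sum>l<d. (cmod (v l))\<^sup>2)"
    using norm_triangle_ineq[of "X $$ (i, j)" "prj d v $$ (i, j)"] step.IH by linarith
  then show ?case using gcone_carrier[OF step(1)] assms
    by (simp add: tr_add[of _ d] tr_prj ip_self del: prj_index)
qed

lemma mat_sum_carrier [simp]: "mat_sum d X k \<in> carrier_mat d d"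
  by (simp add: mat_sum_def)

lemma mat_sum_0: "mat_sum d X 0 = 0\<^sub>m d d"
  by (intro eq_matI) (auto simp: mat_sum_def)

lemma mat_sum_Suc: "X k \<in> carrier_mat d d \<Longrightarrow> mat_sum d X (Suc k) = mat_sum d X k + X k"
  by (intro eq_matI) (auto simp: mat_sum_def)

lemma gcone_mat_sum:
  assumes "\<And>x. x < k \<Longrightarrow> X x \<in> gcone d V" shows "mat_sum d X k \<in> gcone d V"
  using assms
proof (induction k)
  case 0
  show ?case unfolding mat_sum_0 by (rule gcone.zero)
next
  case (Suc k)
  then show ?case using gcone_carrier[of "X k" d V] by (simp add: mat_sum_Suc gcone_add)
qed

lemma tr_mult_mat_sum:
  assumes "\<And>x. x < k \<Longrightarrow> X x \<in> carrier_mat d d" "Y \<in> carrier_mat d d"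
  shows "tr (Y * mat_sum d X k) = (\<Sum>x<k. tr (Y * X x))"
  using assms
proof (induction k)
  case 0
  then show ?case by (simp add: mat_sum_0 tr_def)
next
  case (Suc k)
  then show ?case by (simp add: mat_sum_Suc tr_mult_add[of _ d])
qed

lemma tr_mat_sum:
  assumes "\<And>x. x < k \<Longrightarrow> X x \<in> carrier_mat d d"
  shows "tr (mat_sum d X k) = (\<Sum>x<k. tr (X x))"
  using tr_mult_mat_sum[OF assms one_carrier_mat] assms by (simp add: left_mult_one_mat[of _ d d])

section \<open>Separable states as normalized elements of the product cone\<close>

lemma kron_carrier:
  "X \<in> carrier_mat dA dA \<Longrightarrow> Y \<in> carrier_mat dB dB \<Longrightarrow> kron X Y \<in> carrier_mat (dA * dB) (dA * dB)"
  by (auto simp: kron_def)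

lemma kron_prj: "kron (prj dA a) (prj dB b) = prj (dA * dB) (pv dB a b)"
proof (rule eq_matI)
  fix r c assume "r < dim_row (prj (dA * dB) (pv dB a b))" "c < dim_col (prj (dA * dB) (pv dB a b))"
  then have rc: "r < dA * dB" "c < dA * dB" by auto
  then have "0 < dB" by (cases dB) auto
  with rc have "r div dB < dA" "c div dB < dA" "r mod dB < dB" "c mod dB < dB"
    by (auto simp: less_mult_imp_div_less)
  with rc show "kron (prj dA a) (prj dB b) $$ (r, c) = prj (dA * dB) (pv dB a b) $$ (r, c)"
    by (simp add: kron_def pv_def)
qed (auto simp: kron_def)

lemma div_mod_less:
  fixes r :: nat
  assumes "r < dA * dB" shows "r div dB < dA" "r mod dB < dB"
proof -
  have "0 < dB" using assms by (cases dB) auto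
  then show "r div dB < dA" "r mod dB < dB" using assms by (auto simp: less_mult_imp_div_less)
qed

lemma kron_add_left:
  assumes "X \<in> carrier_mat dA dA" "X' \<in> carrier_mat dA dA" "Y \<in> carrier_mat dB dB"
  shows "kron (X + X') Y = kron X Y + kron X' Y"
  using assms by (intro eq_matI) (auto simp: kron_def div_mod_less distrib_right)

lemma kron_add_right:
  assumes "X \<in> carrier_mat dA dA" "Y' \<in> carrier_mat dB dB" "Y \<in> carrier_mat dB dB"
  shows "kron X (Y + Y') = kron X Y + kron X Y'"
  using assms by (intro eq_matI) (auto simp: kron_def div_mod_less distrib_left)

lemma kron_gcone:
  assumes "X \<in> gcone dA UNIV" "Y \<in> gcone dB UNIV"
  shows "kron X Y \<in> pcone dA dB"
  using assms(1)
proof (induction rule: gcone.induct)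
  case zero
  have "kron (0\<^sub>m dA dA) Y = 0\<^sub>m (dA * dB) (dA * dB)"
    using gcone_carrier[OF assms(2)] by (intro eq_matI) (auto simp: kron_def div_mod_less)
  then show ?case using gcone.zero by simp
next
  case (step X u)
  have "kron (prj dA u) Y \<in> pcone dA dB"
    using assms(2)
  proof (induction rule: gcone.induct)
    case zero
    have "kron (prj dA u) (0\<^sub>m dB dB) = 0\<^sub>m (dA * dB) (dA * dB)"
      by (intro eq_matI) (auto simp: kron_def div_mod_less)
    then show ?case using gcone.zero by simp
  next
    case (step Y v)
    then show ?case using gcone_carrier[OF step(1)]
      by (simp add: kron_add_right[of _ dA _ dB] kron_prj gcone.step)
  qed
  then show ?case using step gcone_carrier[OF step(1)] gcone_carrier[OF assms(2)]
    by (simp add: kron_add_left[of _ dA _ _ dB] gcone_add)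
qed

lemma tr_kron:
  assumes "X \<in> carrier_mat dA dA" "Y \<in> carrier_mat dB dB"
  shows "tr (kron X Y) = tr X * tr Y"
  unfolding tr_carrier[OF kron_carrier[OF assms]]
  by (simp add: sum_mult_index kron_index[OF assms] tr_carrier[OF assms(1)] tr_carrier[OF assms(2)] sum_product)

lemma prj_eq_0:
  assumes "(\<Sum>i<d. (cmod (u i))\<^sup>2) = 0" shows "prj d u = 0\<^sub>m d d"
proof -
  have "\<forall>i<d. u i = 0" using assms by (simp add: sum_nonneg_eq_0_iff)
  then show ?thesis by (intro eq_matI) auto
qed

lemma prj_normalize:
  assumes "n = (\<Sum>i<d. (cmod (u i))\<^sup>2)" "n \<noteq> 0"
  shows "prj d (\<lambda>i. of_real (1 / sqrt n) * u i) \<in> states d"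
    "of_real n \<cdot>\<^sub>m prj d (\<lambda>i. of_real (1 / sqrt n) * u i) = prj d u"
proof -
  have n: "0 < n" using assms by (simp add: sum_nonneg less_le)
  have s: "complex_of_real (1 / sqrt n) * of_real (1 / sqrt n) = of_real (1 / n)"
    unfolding of_real_mult[symmetric] using n by (simp add: real_div_sqrt)
  have "tr (prj d (\<lambda>i. of_real (1 / sqrt n) * u i)) = of_real (1 / n) * of_real n"
    unfolding tr_prj ip_smult_left ip_smult_right ip_self assms(1)[symmetric] s[symmetric]
    by (simp add: mult_ac)
  also have "\<dots> = 1" using n by simp
  finally show "prj d (\<lambda>i. of_real (1 / sqrt n) * u i) \<in> states d"
    by (simp add: states_def psd_iff quad_prj_ge0)
  show "of_real n \<cdot>\<^sub>m prj d (\<lambda>i. of_real (1 / sqrt n) * u i) = prj d u"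
  proof (rule eq_matI)
    fix i j assume "i < dim_row (prj d u)" "j < dim_col (prj d u)"
    then have ij: "i < d" "j < d" by auto
    have "of_real n * ((of_real (1 / sqrt n) * u i) * (of_real (1 / sqrt n) * cnj (u j))) =
       of_real n * (of_real (1 / n)) * (u i * cnj (u j))"
      unfolding s[symmetric] by (simp add: mult_ac)
    then show "(of_real n \<cdot>\<^sub>m prj d (\<lambda>i. of_real (1 / sqrt n) * u i)) $$ (i, j) = prj d u $$ (i, j)"
      using ij n by simp
  qed auto
qed

text \<open>Normalizing both factors of a generator moves their squared norms into the weight; a
  generator with a vanishing factor is the zero matrix and is dropped.\<close>

lemma pcone_mat_sum_kron:
  assumes "X \<in> pcone dA dB"
  shows "\<exists>k p \<alpha> \<beta>. (\<forall>x<k. 0 \<le> p x \<and> \<alpha> x \<in> states dA \<and> \<beta> x \<in> states dB) \<and>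
    X = mat_sum (dA * dB) (\<lambda>x. complex_of_real (p x) \<cdot>\<^sub>m kron (\<alpha> x) (\<beta> x)) k"
  using assms
proof (induction rule: gcone.induct)
  case zero
  show ?case by (rule exI[of _ 0]) (simp add: mat_sum_0)
next
  case (step X u)
  then obtain k p \<alpha> \<beta> where IH: "\<forall>x<k. 0 \<le> p x \<and> \<alpha> x \<in> states dA \<and> \<beta> x \<in> states dB"
    "X = mat_sum (dA * dB) (\<lambda>x. complex_of_real (p x) \<cdot>\<^sub>m kron (\<alpha> x) (\<beta> x)) k" by blast
  obtain a b where u: "u = pv dB a b" using step by (auto simp: pvs_def)
  define na where "na = (\<Sum>i<dA. (cmod (a i))\<^sup>2)"
  define nb where "nb = (\<Sum>i<dB. (cmod (b i))\<^sup>2)"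
  show ?case
  proof (cases "na = 0 \<or> nb = 0")
    case True
    have "prj dA a = 0\<^sub>m dA dA \<or> prj dB b = 0\<^sub>m dB dB"
      using True prj_eq_0[of a dA] prj_eq_0[of b dB] by (auto simp: na_def nb_def)
    then have "kron (prj dA a) (prj dB b) = 0\<^sub>m (dA * dB) (dA * dB)"
    proof
      assume z: "prj dA a = 0\<^sub>m dA dA"
      show ?thesis unfolding z by (intro eq_matI) (auto simp: kron_def div_mod_less)
    next
      assume z: "prj dB b = 0\<^sub>m dB dB"
      show ?thesis unfolding z by (intro eq_matI) (auto simp: kron_def div_mod_less)
    qed
    then have "prj (dA * dB) u = 0\<^sub>m (dA * dB) (dA * dB)" by (simp add: u kron_prj)
    then have "X + prj (dA * dB) u = X" using gcone_carrier[OF step(1)] by simp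
    then show ?thesis using IH by metis
  next
    case False
    define a' where "a' = prj dA (\<lambda>i. of_real (1 / sqrt na) * a i)"
    define b' where "b' = prj dB (\<lambda>i. of_real (1 / sqrt nb) * b i)"
    have ab: "a' \<in> states dA" "b' \<in> states dB"
      using prj_normalize(1)[OF na_def] prj_normalize(1)[OF nb_def] False by (auto simp: a'_def b'_def)
    have "0 \<le> na" "0 \<le> nb" by (auto simp: na_def nb_def sum_nonneg)
    have "prj (dA * dB) u = kron (of_real na \<cdot>\<^sub>m a') (of_real nb \<cdot>\<^sub>m b')"
      using prj_normalize(2)[OF na_def] prj_normalize(2)[OF nb_def] False
      unfolding u kron_prj[symmetric] a'_def b'_def by simp
    also have "\<dots> = complex_of_real (na * nb) \<cdot>\<^sub>m kron a' b'"
      by (intro eq_matI) (auto simp: kron_def a'_def b'_def div_mod_less)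
    finally have pu: "prj (dA * dB) u = complex_of_real (na * nb) \<cdot>\<^sub>m kron a' b'" .
    have "X + prj (dA * dB) u = mat_sum (dA * dB) (\<lambda>x. complex_of_real ((p(k := na * nb)) x) \<cdot>\<^sub>m
        kron ((\<alpha>(k := a')) x) ((\<beta>(k := b')) x)) (Suc k)"
    proof -
      have "mat_sum (dA * dB) (\<lambda>x. complex_of_real ((p(k := na * nb)) x) \<cdot>\<^sub>m
        kron ((\<alpha>(k := a')) x) ((\<beta>(k := b')) x)) k = X"
        unfolding IH(2) mat_sum_def by (intro cong_mat refl) (auto intro!: sum.cong)
      moreover have "kron a' b' \<in> carrier_mat (dA * dB) (dA * dB)"
        by (intro kron_carrier) (auto simp: a'_def b'_def)
      ultimately show ?thesis by (subst mat_sum_Suc) (auto simp: pu)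
    qed
    moreover have "\<forall>x<Suc k. 0 \<le> (p(k := na * nb)) x \<and> (\<alpha>(k := a')) x \<in> states dA \<and> (\<beta>(k := b')) x \<in> states dB"
      using IH(1) ab \<open>0 \<le> na\<close> \<open>0 \<le> nb\<close> by (auto simp: less_Suc_eq)
    ultimately show ?thesis by blast
  qed
qed

lemma states_carrier: "\<alpha> \<in> states d \<Longrightarrow> \<alpha> \<in> carrier_mat d d"
  by (simp add: states_def psd_def)

lemma tr_mat_sum_kron_states:
  assumes "\<And>x. x < k \<Longrightarrow> \<alpha> x \<in> states dA" "\<And>x. x < k \<Longrightarrow> \<beta> x \<in> states dB"
  shows "tr (mat_sum (dA * dB) (\<lambda>x. complex_of_real (p x) \<cdot>\<^sub>m kron (\<alpha> x) (\<beta> x)) k) = of_real (\<Sum>x<k. p x)"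
proof -
  have c: "kron (\<alpha> x) (\<beta> x) \<in> carrier_mat (dA * dB) (dA * dB)" if "x < k" for x
    using assms[OF that] by (intro kron_carrier states_carrier)
  have "tr (mat_sum (dA * dB) (\<lambda>x. complex_of_real (p x) \<cdot>\<^sub>m kron (\<alpha> x) (\<beta> x)) k) =
      (\<Sum>x<k. tr (complex_of_real (p x) \<cdot>\<^sub>m kron (\<alpha> x) (\<beta> x)))"
    by (rule tr_mat_sum) (use c in auto)
  also have "\<dots> = (\<Sum>x<k. of_real (p x))"
  proof (intro sum.cong refl)
    fix x assume "x \<in> {..<k}"
    then have x: "x < k" by simp
    have "tr (kron (\<alpha> x) (\<beta> x)) = 1"
      using assms[OF x] tr_kron[OF states_carrier[OF assms(1)[OF x]] states_carrier[OF assms(2)[OF x]]]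
      by (simp add: states_def)
    then show "tr (complex_of_real (p x) \<cdot>\<^sub>m kron (\<alpha> x) (\<beta> x)) = of_real (p x)"
      by (simp add: tr_smult[OF c[OF x]])
  qed
  finally show ?thesis by simp
qed

text \<open>Decomposing every local state into rank-one terms gives generators along product
  vectors; in the other direction the trace is the sum of the weights. Statements about separable
  states become inductions over \<open>pcone\<close> from here on.\<close>

lemma sep_states_iff: "\<sigma> \<in> sep_states dA dB \<longleftrightarrow> \<sigma> \<in> pcone dA dB \<and> tr \<sigma> = 1"
proof
  assume "\<sigma> \<in> sep_states dA dB"
  then obtain k p \<alpha> \<beta> where \<sigma>: "\<sigma> = mat_sum (dA * dB) (\<lambda>x. complex_of_real (p x) \<cdot>\<^sub>m kron (\<alpha> x) (\<beta> x)) k"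
    and h: "\<And>x. x < k \<Longrightarrow> 0 \<le> p x" "\<And>x. x < k \<Longrightarrow> \<alpha> x \<in> states dA" "\<And>x. x < k \<Longrightarrow> \<beta> x \<in> states dB"
    and s: "(\<Sum>x<k. p x) = 1"
    unfolding sep_states_def by blast
  have k: "kron (\<alpha> x) (\<beta> x) \<in> pcone dA dB" if "x < k" for x
    using h[OF that] by (intro kron_gcone psd_gcone) (auto simp: states_def)
  have "tr \<sigma> = of_real (\<Sum>x<k. p x)"
    unfolding \<sigma> by (rule tr_mat_sum_kron_states[of k \<alpha> dA \<beta> dB p]) (fact h)+
  then have "tr \<sigma> = 1" unfolding s by simp
  moreover have "\<sigma> \<in> pcone dA dB"
    unfolding \<sigma> using k h(1) by (intro gcone_mat_sum pcone_smult) auto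
  ultimately show "\<sigma> \<in> pcone dA dB \<and> tr \<sigma> = 1" by simp
next
  assume \<sigma>: "\<sigma> \<in> pcone dA dB \<and> tr \<sigma> = 1"
  then obtain k p \<alpha> \<beta> where h: "\<forall>x<k. 0 \<le> p x \<and> \<alpha> x \<in> states dA \<and> \<beta> x \<in> states dB"
    and e: "\<sigma> = mat_sum (dA * dB) (\<lambda>x. complex_of_real (p x) \<cdot>\<^sub>m kron (\<alpha> x) (\<beta> x)) k"
    using pcone_mat_sum_kron by blast
  have "tr \<sigma> = of_real (\<Sum>x<k. p x)"
    unfolding e by (rule tr_mat_sum_kron_states[of k \<alpha> dA \<beta> dB p]) (use h in blast)+
  then have "(\<Sum>x<k. p x) = 1" using \<sigma> by (metis of_real_eq_1_iff)
  then show "\<sigma> \<in> sep_states dA dB" unfolding sep_states_def using h e by blast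
qed

lemma tr_gcone_nonneg: "X \<in> gcone d V \<Longrightarrow> 0 \<le> tr X"
proof (induction rule: gcone.induct)
  case (step X u)
  then show ?case using gcone_carrier[OF step(1)] by (simp add: tr_add[of _ d] tr_prj ip_self_ge0)
qed (simp add: tr_def)

lemma tr_gcone_eq_0: "X \<in> gcone d V \<Longrightarrow> tr X = 0 \<Longrightarrow> X = 0\<^sub>m d d"
proof (induction rule: gcone.induct)
  case (step X u)
  have "tr X + ip d u u = 0" using step gcone_carrier[OF step(1)] by (simp add: tr_add[of _ d] tr_prj)
  then have "tr X = 0" "ip d u u = 0"
    using tr_gcone_nonneg[OF step(1)] ip_self_ge0[of d u] by (auto simp: add_nonneg_eq_0_iff)
  moreover from this have "prj d u = 0\<^sub>m d d"
    by (intro prj_eq_0) (simp add: ip_self flip: of_real_sum of_real_power)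
  ultimately show ?case using step by simp
qed simp

lemma tr_of_real: "X \<in> gcone d V \<Longrightarrow> tr X = of_real (Re (tr X))"
  using tr_gcone_nonneg[of X d V] by (simp add: less_eq_complex_def complex_eq_iff)

lemma pcone_scale_sep_states:
  assumes "X \<in> pcone dA dB" "Re (tr X) \<noteq> 0"
  shows "complex_of_real (1 / Re (tr X)) \<cdot>\<^sub>m X \<in> sep_states dA dB"
proof -
  have p: "0 \<le> Re (tr X)" using tr_gcone_nonneg[OF assms(1)] by (simp add: less_eq_complex_def)
  have "tr (complex_of_real (1 / Re (tr X)) \<cdot>\<^sub>m X) = complex_of_real (1 / Re (tr X)) * of_real (Re (tr X))"
    using tr_smult[OF gcone_carrier[OF assms(1)]] tr_of_real[OF assms(1)] by metis
  also have "\<dots> = 1" using assms(2) by simp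
  finally show ?thesis unfolding sep_states_iff
    using pcone_smult[OF assms(1), of "1 / Re (tr X)"] p by simp
qed

definition max_mixed :: "nat \<Rightarrow> complex mat" where
  "max_mixed d = complex_of_real (1 / real d) \<cdot>\<^sub>m 1\<^sub>m d"

lemma max_mixed_sep:
  assumes "0 < dA" "0 < dB" shows "max_mixed (dA * dB) \<in> sep_states dA dB"
proof -
  have t: "tr (1\<^sub>m (dA * dB)) = of_nat (dA * dB)" by (simp add: tr_def)
  have "Re (tr (1\<^sub>m (dA * dB))) = real (dA * dB)" unfolding t by simp
  with pcone_scale_sep_states[OF pcone_one, of dA dB] assms show ?thesis
    unfolding max_mixed_def by simp
qed

text \<open>The zero matrix is the delicate point: \<open>sep_cone\<close> reaches it only by
  scaling some separable state by 0, and positive dimensions supply such a state.\<close>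

lemma sep_cone_iff:
  assumes "0 < dA" "0 < dB"
  shows "X \<in> sep_cone dA dB \<longleftrightarrow> X \<in> pcone dA dB"
proof
  assume "X \<in> sep_cone dA dB"
  then show "X \<in> pcone dA dB" by (auto simp: sep_cone_def sep_states_iff intro: pcone_smult)
next
  assume X: "X \<in> pcone dA dB"
  have p: "0 \<le> Re (tr X)" using tr_gcone_nonneg[OF X] by (simp add: less_eq_complex_def)
  show "X \<in> sep_cone dA dB"
  proof (cases "Re (tr X) = 0")
    case True
    then have "tr X = 0" using tr_of_real[OF X] by simp
    then have "X = complex_of_real 0 \<cdot>\<^sub>m max_mixed (dA * dB)"
      using tr_gcone_eq_0[OF X] by (intro eq_matI) (auto simp: max_mixed_def)
    then show ?thesis using max_mixed_sep[OF assms] unfolding sep_cone_def by blast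
  next
    case False
    have "X = complex_of_real (Re (tr X)) \<cdot>\<^sub>m (complex_of_real (1 / Re (tr X)) \<cdot>\<^sub>m X)"
      using False gcone_carrier[OF X] by (intro eq_matI) auto
    then show ?thesis using pcone_scale_sep_states[OF X False] p unfolding sep_cone_def by blast
  qed
qed

text \<open>The choice of \<open>\<phi>\<close> selects the operator read off from a weighted
  measurement: the constant 1 gives the total effect, the identity the feasibility constraint,
  \<open>log 2\<close> the value, an indicator a test, and a negative power the Chernoff
  bound.\<close>

definition wop :: "nat \<Rightarrow> (real \<Rightarrow> real) \<Rightarrow> (complex mat \<times> real) list \<Rightarrow> complex mat" where
  "wop d \<phi> L = mat d d (\<lambda>(i, j). \<Sum>(E, f)\<leftarrow>L. complex_of_real (\<phi> f) * E $$ (i, j))"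

lemma wop_carrier [simp]: "wop d \<phi> L \<in> carrier_mat d d"
  and wop_dim [simp]: "dim_row (wop d \<phi> L) = d" "dim_col (wop d \<phi> L) = d"
  by (auto simp: wop_def)

lemma wop_Nil: "wop d \<phi> [] = 0\<^sub>m d d"
  by (intro eq_matI) (auto simp: wop_def)

lemma wop_Cons: "E \<in> carrier_mat d d \<Longrightarrow> wop d \<phi> ((E, f) # L) = complex_of_real (\<phi> f) \<cdot>\<^sub>m E + wop d \<phi> L"
  by (intro eq_matI) (auto simp: wop_def)

definition wpovm :: "nat \<Rightarrow> nat \<Rightarrow> (complex mat \<times> real) list \<Rightarrow> bool" where
  "wpovm dA dB L \<longleftrightarrow> (\<forall>(E, f)\<in>set L. E \<in> pcone dA dB \<and> 0 < f) \<and> wop (dA * dB) (\<lambda>_. 1) L = 1\<^sub>m (dA * dB)"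

definition feas :: "nat \<Rightarrow> nat \<Rightarrow> (complex mat \<times> real) list \<Rightarrow> bool" where
  "feas dA dB L \<longleftrightarrow> wpovm dA dB L \<and> pord dA dB (wop (dA * dB) (\<lambda>f. f) L) (1\<^sub>m (dA * dB))"

definition wval :: "complex mat \<Rightarrow> (complex mat \<times> real) list \<Rightarrow> real" where
  "wval \<rho> L = (\<Sum>(E, f)\<leftarrow>L. Re (tr (\<rho> * E)) * log 2 f)"

lemma wop_pcone:
  assumes "\<forall>(E, f)\<in>set L. E \<in> pcone dA dB \<and> 0 < f" "\<And>f. 0 < f \<Longrightarrow> 0 \<le> \<phi> f"
  shows "wop (dA * dB) \<phi> L \<in> pcone dA dB"
  using assms(1)
proof (induction L)
  case Nil
  show ?case unfolding wop_Nil by (rule gcone.zero)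
next
  case (Cons x L)
  obtain E f where x: "x = (E, f)" by (cases x)
  with Cons have "E \<in> pcone dA dB" "0 < f" by auto
  then show ?case using Cons x assms(2)
    by (auto simp: wop_Cons[OF gcone_carrier] intro!: gcone_add pcone_smult)
qed

lemma tr_mult_wop:
  assumes "\<forall>(E, f)\<in>set L. E \<in> carrier_mat d d" "X \<in> carrier_mat d d"
  shows "Re (tr (X * wop d \<phi> L)) = (\<Sum>(E, f)\<leftarrow>L. \<phi> f * Re (tr (X * E)))"
  using assms(1)
proof (induction L)
  case Nil
  then show ?case using assms(2) by (simp add: wop_Nil tr_def)
next
  case (Cons x L)
  obtain E f where x: "x = (E, f)" by (cases x)
  with Cons show ?case using assms(2) by (simp add: wop_Cons tr_mult_add[of _ d] tr_mult_smult[of _ d])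
qed

lemma wpovm_carrier: "wpovm dA dB L \<Longrightarrow> \<forall>(E, f)\<in>set L. E \<in> carrier_mat (dA * dB) (dA * dB)"
  unfolding wpovm_def using gcone_carrier by blast

lemma wpovm_sum_prob:
  assumes "wpovm dA dB L" "\<rho> \<in> states (dA * dB)"
  shows "(\<Sum>(E, f)\<leftarrow>L. Re (tr (\<rho> * E))) = 1"
proof -
  have "Re (tr (\<rho> * wop (dA * dB) (\<lambda>_. 1) L)) = (\<Sum>(E, f)\<leftarrow>L. 1 * Re (tr (\<rho> * E)))"
    by (rule tr_mult_wop[OF wpovm_carrier[OF assms(1)] states_carrier[OF assms(2)]])
  moreover have "\<rho> * 1\<^sub>m (dA * dB) = \<rho>" using states_carrier[OF assms(2)] by simp
  ultimately show ?thesis using assms by (simp add: wpovm_def states_def)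
qed

lemma psd_tr_mult_Re_ge0: "psd d X \<Longrightarrow> psd d Y \<Longrightarrow> 0 \<le> Re (tr (X * Y))"
  using psd_tr_mult_ge0[of d X Y] by (simp add: less_eq_complex_def)

lemma sep_states_states: "\<sigma> \<in> sep_states dA dB \<Longrightarrow> \<sigma> \<in> states (dA * dB)"
  unfolding sep_states_iff states_def using gcone_psd by blast

text \<open>This is \<open>ln x \<le> x - 1\<close> at \<open>x = q * f / p\<close>. The correction
  \<open>(p - q * f) / ln 2\<close> may be negative for a single outcome; feasibility makes its sum
  nonnegative.\<close>

lemma rel_ent_term_ge:
  assumes "0 \<le> p" "0 \<le> q" "0 < f"
  shows "ereal (p * log 2 f + (p - q * f) / ln 2) \<le> rel_ent_term p q"
proof (cases "p = 0 \<or> q = 0")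
  case True
  then show ?thesis using assms by (auto simp: rel_ent_term_def divide_nonpos_pos)
next
  case False
  then have pq: "0 < p" "0 < q" using assms by auto
  have "ln (q * f / p) \<le> q * f / p - 1" by (rule ln_le_minus_one) (use pq assms in simp)
  then have "p * ln (q * f / p) \<le> p * (q * f / p - 1)" using pq by simp
  also have "\<dots> = q * f - p" using pq by (simp add: field_simps)
  finally have "p * (ln q + ln f - ln p) \<le> q * f - p" using pq assms by (simp add: ln_div ln_mult)
  then have "(p * ln f + (p - q * f)) / ln 2 \<le> (p * (ln p - ln q)) / ln 2"
    by (intro divide_right_mono) (simp_all add: algebra_simps)
  then show ?thesis using pq assms False by (simp add: rel_ent_term_def log_def ln_div add_divide_distrib)
qed

lemma sum_list_nth: "(\<Sum>x\<leftarrow>L. g x) = (\<Sum>i<length L. g (L ! i))"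
  by (simp add: sum_list_sum_nth atLeast0LessThan)

lemma wval_le_D_SEP_sep:
  assumes pos: "0 < dA" "0 < dB" and L: "feas dA dB L" and \<rho>: "\<rho> \<in> states (dA * dB)"
  shows "ereal (wval \<rho> L) \<le> D_SEP_sep dA dB \<rho>"
  unfolding D_SEP_sep_def
proof (rule INF_greatest)
  fix \<sigma> assume \<sigma>: "\<sigma> \<in> sep_states dA dB"
  have wp: "wpovm dA dB L" using L by (simp add: feas_def)
  define k where "k = length L"
  define E where "E i = fst (L ! i)" for i
  define f where "f i = snd (L ! i)" for i
  define p where "p i = Re (tr (\<rho> * E i))" for i
  define q where "q i = Re (tr (\<sigma> * E i))" for i
  have Ei: "E i \<in> pcone dA dB" "0 < f i" if "i < k" for i
  proof -
    have "L ! i \<in> set L" using that by (simp add: k_def)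
    then show "E i \<in> pcone dA dB" "0 < f i" using wp by (auto simp: wpovm_def E_def f_def case_prod_beta)
  qed
  have "mat_sum (dA * dB) E k = wop (dA * dB) (\<lambda>_. 1) L"
    unfolding mat_sum_def wop_def by (intro cong_mat refl) (simp add: sum_list_nth k_def E_def case_prod_beta)
  then have povm: "sep_povm dA dB k E"
    using wp Ei by (simp add: sep_povm_def wpovm_def sep_cone_iff[OF pos])
  have pq: "0 \<le> p i" "0 \<le> q i" if "i < k" for i
    using gcone_psd[OF Ei(1)[OF that]] \<rho> sep_states_states[OF \<sigma>]
    by (auto simp: p_def q_def states_def psd_tr_mult_Re_ge0)
  have sp: "(\<Sum>i<k. p i) = 1"
    using wpovm_sum_prob[OF wp \<rho>] by (simp add: sum_list_nth k_def p_def E_def case_prod_beta)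
  have "tr (wop (dA * dB) (\<lambda>f. f) L * \<sigma>) \<le> tr (1\<^sub>m (dA * dB) * \<sigma>)"
    using L \<sigma> by (intro pord_tr_mult[of dA dB]) (auto simp: feas_def sep_states_iff)
  moreover have "1\<^sub>m (dA * dB) * \<sigma> = \<sigma>" using states_carrier[OF sep_states_states[OF \<sigma>]] by simp
  ultimately have "Re (tr (\<sigma> * wop (dA * dB) (\<lambda>f. f) L)) \<le> 1"
    using \<sigma> tr_comm[OF wop_carrier states_carrier[OF sep_states_states[OF \<sigma>]]]
    by (simp add: sep_states_iff less_eq_complex_def)
  moreover have "Re (tr (\<sigma> * wop (dA * dB) (\<lambda>f. f) L)) = (\<Sum>i<k. q i * f i)"
    unfolding tr_mult_wop[OF wpovm_carrier[OF wp] states_carrier[OF sep_states_states[OF \<sigma>]]]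
    by (simp add: sum_list_nth k_def q_def E_def f_def case_prod_beta mult.commute)
  ultimately have sq: "(\<Sum>i<k. q i * f i) \<le> 1" by simp
  have "ereal (wval \<rho> L) = ereal (\<Sum>i<k. p i * log 2 (f i))"
    by (simp add: wval_def sum_list_nth k_def p_def E_def f_def case_prod_beta)
  also have "\<dots> \<le> ereal (\<Sum>i<k. p i * log 2 (f i) + (p i - q i * f i) / ln 2)"
    using sq by (simp add: sum.distrib sum_subtractf sp flip: sum_divide_distrib)
  also have "\<dots> = (\<Sum>i<k. ereal (p i * log 2 (f i) + (p i - q i * f i) / ln 2))" by simp
  also have "\<dots> \<le> (\<Sum>i<k. rel_ent_term (p i) (q i))"
    using pq Ei by (intro sum_mono rel_ent_term_ge) auto
  also have "\<dots> \<le> D_SEP dA dB \<rho> \<sigma>"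
    unfolding D_SEP_def p_def q_def by (rule Sup_upper) (use povm in blast)
  finally show "ereal (wval \<rho> L) \<le> D_SEP dA dB \<rho> \<sigma>" .
qed

text \<open>Separation in the plane: the image of \<open>S\<close> under the two affine functions is
  convex and misses the open quadrant below \<open>(c, c)\<close>. For a point with
  \<open>g1 x < c\<close>, \<open>U x\<close> is the largest weight on \<open>g1\<close> that keeps
  the mixture at least \<open>c\<close>, and \<open>l\<close> is the infimum of these
  bounds.\<close>

lemma minimax_two:
  fixes g1 g2 :: "'a \<Rightarrow> real" and mix :: "real \<Rightarrow> 'a \<Rightarrow> 'a \<Rightarrow> 'a"
  assumes mix: "\<And>t x y. x \<in> S \<Longrightarrow> y \<in> S \<Longrightarrow> 0 \<le> t \<Longrightarrow> t \<le> 1 \<Longrightarrow> mix t x y \<in> S"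
    and aff: "\<And>t x y. x \<in> S \<Longrightarrow> y \<in> S \<Longrightarrow> 0 \<le> t \<Longrightarrow> t \<le> 1 \<Longrightarrow> g1 (mix t x y) = t * g1 x + (1 - t) * g1 y"
      "\<And>t x y. x \<in> S \<Longrightarrow> y \<in> S \<Longrightarrow> 0 \<le> t \<Longrightarrow> t \<le> 1 \<Longrightarrow> g2 (mix t x y) = t * g2 x + (1 - t) * g2 y"
    and max: "\<And>x. x \<in> S \<Longrightarrow> c \<le> g1 x \<or> c \<le> g2 x"
  shows "\<exists>l. 0 \<le> l \<and> l \<le> 1 \<and> (\<forall>x\<in>S. c \<le> l * g1 x + (1 - l) * g2 x)"
proof (cases "\<exists>x\<in>S. g1 x < c")
  case False
  then show ?thesis by (intro exI[of _ 1]) auto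
next
  case True
  define U where "U x = (g2 x - c) / (g2 x - g1 x)" for x
  define l where "l = Inf (U ` {x \<in> S. g1 x < c})"
  have ne: "U ` {x \<in> S. g1 x < c} \<noteq> {}" using True by auto
  have U01: "0 \<le> U x" "U x \<le> 1" if "x \<in> S" "g1 x < c" for x
    using that max[OF that(1)] by (auto simp: U_def divide_le_eq_1)
  have bdd: "bdd_below (U ` {x \<in> S. g1 x < c})" using U01 by (intro bdd_belowI[of _ 0]) auto
  have lU: "l \<le> U x" if "x \<in> S" "g1 x < c" for x
    unfolding l_def using that by (intro cInf_lower bdd) auto
  have l0: "0 \<le> l" unfolding l_def using U01 by (intro cInf_greatest ne) auto
  have l1: "l \<le> 1" using lU U01 True by (meson order_trans)
  \<comment> \<open>Points below \<open>c\<close> in \<open>g2\<close> bound \<open>l\<close> from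
    below. No such bound exceeds an upper bound \<open>U x\<close>, since otherwise some mixture of
    the two points would lie below \<open>c\<close> in both functions.\<close>
  have cross: "(c - g2 y) / (g1 y - g2 y) \<le> U x" if x: "x \<in> S" "g1 x < c" and y: "y \<in> S" "g2 y < c" for x y
  proof -
    define a where "a = c - g1 x"
    define b where "b = g2 x - c"
    define a' where "a' = c - g2 y"
    define b' where "b' = g1 y - c"
    have pos: "0 < a" "0 \<le> b" "0 < a'" "0 \<le> b'"
      using x y max[OF x(1)] max[OF y(1)] by (auto simp: a_def b_def a'_def b'_def)
    have "a * a' \<le> b * b'"
    proof (rule ccontr)
      assume "\<not> a * a' \<le> b * b'"
      then have lt: "b * b' < a * a'" by simp
      define s where "s = a + b + a' + b'"
      \<comment> \<open>At this weight both functions differ from \<open>c\<close> by the same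
        amount \<open>(b * b' - a * a') / s\<close>.\<close>
      define t where "t = (a' + b') / s"
      have s: "0 < s" using pos by (simp add: s_def)
      have t: "0 \<le> t" "t \<le> 1" "1 - t = (a + b) / s" using pos s by (auto simp: t_def s_def field_simps)
      have "g1 (mix t x y) - c = (1 - t) * b' - t * a"
        unfolding aff(1)[OF x(1) y(1) t(1,2)] by (simp add: a_def b'_def algebra_simps)
      also have "\<dots> = (b * b' - a * a') / s"
        unfolding t(3) unfolding t_def using s by (simp add: field_simps)
      finally have 1: "g1 (mix t x y) < c" using lt s by (smt (verit) divide_neg_pos)
      have "g2 (mix t x y) - c = t * b - (1 - t) * a'"
        unfolding aff(2)[OF x(1) y(1) t(1,2)] by (simp add: b_def a'_def algebra_simps)
      also have "\<dots> = (b * b' - a * a') / s"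
        unfolding t(3) unfolding t_def using s by (simp add: field_simps)
      finally have 2: "g2 (mix t x y) < c" using lt s by (smt (verit) divide_neg_pos)
      show False using max[OF mix[OF x(1) y(1) t(1,2)]] 1 2 by simp
    qed
    then have "a' * (a + b) \<le> b * (a' + b')" by (simp add: algebra_simps)
    then have "a' / (a' + b') \<le> b / (a + b)" using pos by (simp add: field_simps)
    moreover have e: "g1 y - g2 y = a' + b'" "g2 x - g1 x = a + b" "c - g2 y = a'" "g2 x - c = b"
      by (auto simp: a_def b_def a'_def b'_def)
    ultimately show ?thesis unfolding U_def e by simp
  qed
  have "c \<le> l * g1 x + (1 - l) * g2 x" if x: "x \<in> S" for x
  proof -
    consider "g1 x < c" | "g2 x < c" | "c \<le> g1 x" "c \<le> g2 x" by linarith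
    then show ?thesis
    proof cases
      case 1
      then have d: "0 < g2 x - g1 x" using max[OF x] by simp
      have "l * (g2 x - g1 x) \<le> U x * (g2 x - g1 x)" using lU[OF x 1] d by simp
      also have "\<dots> = g2 x - c" using d by (simp add: U_def)
      finally show ?thesis by (simp add: algebra_simps)
    next
      case 2
      then have d: "0 < g1 x - g2 x" using max[OF x] by simp
      have "(c - g2 x) / (g1 x - g2 x) \<le> l"
        unfolding l_def using cross x 2 by (intro cInf_greatest ne) auto
      then have "c - g2 x \<le> l * (g1 x - g2 x)" using d by (simp add: pos_divide_le_eq)
      then show ?thesis by (simp add: algebra_simps)
    next
      case 3
      then have "l * c + (1 - l) * c \<le> l * g1 x + (1 - l) * g2 x"
        using l0 l1 by (intro add_mono mult_left_mono) auto
      then show ?thesis by (simp add: algebra_simps)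
    qed
  qed
  then show ?thesis using l0 l1 by blast
qed

text \<open>Where \<open>g\<close> is below \<open>c\<close>, some function of \<open>N\<close> is
  at least \<open>c\<close>, and this region is closed under mixing because \<open>g\<close> is
  affine; the induction hypothesis gives one \<open>h\<close> for it, which
  \<open>minimax_two\<close> merges with \<open>g\<close>. Since \<open>S\<close> shrinks in the
  induction, affinity and convex combinations refer to a fixed \<open>T\<close>.\<close>

lemma minimax_finite:
  fixes mix :: "real \<Rightarrow> 'a \<Rightarrow> 'a \<Rightarrow> 'a" and G :: "('a \<Rightarrow> real) set"
  assumes "finite N" "N \<noteq> {}" "N \<subseteq> G" "S \<subseteq> T"
    and mix: "\<And>t x y. x \<in> S \<Longrightarrow> y \<in> S \<Longrightarrow> 0 \<le> t \<Longrightarrow> t \<le> 1 \<Longrightarrow> mix t x y \<in> S"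
    and aff: "\<And>g t x y. g \<in> G \<Longrightarrow> x \<in> T \<Longrightarrow> y \<in> T \<Longrightarrow> 0 \<le> t \<Longrightarrow> t \<le> 1 \<Longrightarrow> g (mix t x y) = t * g x + (1 - t) * g y"
    and conv: "\<And>g h l. g \<in> G \<Longrightarrow> h \<in> G \<Longrightarrow> 0 \<le> l \<Longrightarrow> l \<le> 1 \<Longrightarrow>
      \<exists>k\<in>G. \<forall>x\<in>T. k x = l * g x + (1 - l) * h x"
    and max: "\<And>x. x \<in> S \<Longrightarrow> \<exists>g\<in>N. c \<le> g x"
  shows "\<exists>g\<in>G. \<forall>x\<in>S. c \<le> g x"
  using assms(1-5) max
proof (induction N arbitrary: S rule: finite_ne_induct)
  case (singleton g)
  then show ?case by blast
next
  case (insert g N)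
  define S' where "S' = {x \<in> S. g x < c}"
  have gG: "g \<in> G" using insert by simp
  have "\<exists>h\<in>G. \<forall>x\<in>S'. c \<le> h x"
  proof (rule insert.IH)
    show "mix t x y \<in> S'" if "x \<in> S'" "y \<in> S'" "0 \<le> t" "t \<le> 1" for t x y
    proof -
      have "mix t x y \<in> S" using that insert by (auto simp: S'_def)
      moreover have "g (mix t x y) = t * g x + (1 - t) * g y"
        using that insert gG by (intro aff) (auto simp: S'_def)
      moreover have "t * g x + (1 - t) * g y < c"
      proof (cases "t = 0")
        case True
        then show ?thesis using that by (simp add: S'_def)
      next
        case False
        then have "t * g x < t * c" "(1 - t) * g y \<le> (1 - t) * c"
          using that by (auto simp: S'_def intro!: mult_left_mono)
        then have "t * g x + (1 - t) * g y < t * c + (1 - t) * c" by (rule add_less_le_mono)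
        then show ?thesis by (simp add: algebra_simps)
      qed
      ultimately show ?thesis by (simp add: S'_def)
    qed
    show "\<exists>h\<in>N. c \<le> h x" if "x \<in> S'" for x
      using insert.prems(4)[of x] that by (auto simp: S'_def)
  qed (use insert in \<open>auto simp: S'_def\<close>)
  then obtain h where h: "h \<in> G" "\<And>x. x \<in> S' \<Longrightarrow> c \<le> h x" by blast
  have "\<exists>l. 0 \<le> l \<and> l \<le> 1 \<and> (\<forall>x\<in>S. c \<le> l * g x + (1 - l) * h x)"
  proof (rule minimax_two[where mix = mix])
    show "c \<le> g x \<or> c \<le> h x" if "x \<in> S" for x
      using that h(2)[of x] by (cases "g x < c") (auto simp: S'_def)
  qed (use insert.prems gG h aff in \<open>auto simp: subset_iff\<close>)
  then obtain l where l: "0 \<le> l" "l \<le> 1" "\<forall>x\<in>S. c \<le> l * g x + (1 - l) * h x" by blast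
  obtain k where "k \<in> G" "\<forall>x\<in>T. k x = l * g x + (1 - l) * h x" using conv[OF gG h(1) l(1,2)] by blast
  then show ?case using l(3) insert.prems(2) by (metis subset_iff)
qed

section \<open>A minimax theorem for separable measurements\<close>

lemma floor_eq_close:
  fixes a b :: real
  assumes "\<lfloor>a\<rfloor> = \<lfloor>b\<rfloor>" shows "\<bar>a - b\<bar> \<le> 1"
proof -
  define k where "k = real_of_int \<lfloor>b\<rfloor>"
  have "k \<le> b" "b < k + 1" "k \<le> a" "a < k + 1"
    using floor_correct[of a] floor_correct[of b] unfolding assms k_def by simp_all
  then show ?thesis by linarith
qed

text \<open>Pigeonhole on a grid of cells. Choosing a representative from each nonempty cell keeps
  the net inside \<open>T\<close>, whatever the shape of \<open>T\<close>.\<close>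

lemma finite_entry_net:
  assumes bnd: "\<And>X i j. X \<in> T \<Longrightarrow> i < d \<Longrightarrow> j < d \<Longrightarrow> cmod (X $$ (i, j)) \<le> 1" and \<delta>: "0 < \<delta>"
  shows "\<exists>N. finite N \<and> N \<subseteq> T \<and>
    (\<forall>X\<in>T. \<exists>Y\<in>N. \<forall>i<d. \<forall>j<d. cmod (X $$ (i, j) - Y $$ (i, j)) \<le> \<delta>)"
proof -
  \<comment> \<open>Half of the tolerance each for real and imaginary parts.\<close>
  define e where "e = \<delta> / 2"
  have e: "0 < e" using \<delta> by (simp add: e_def)
  define cell where "cell X = (\<lambda>ij. if ij \<in> {..<d} \<times> {..<d} then (\<lfloor>Re (X $$ ij) / e\<rfloor>, \<lfloor>Im (X $$ ij) / e\<rfloor>) else (0, 0))"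
    for X :: "complex mat"
  define B where "B = {- \<lceil>1 / e\<rceil>..\<lceil>1 / e\<rceil>}"
  have inB: "\<lfloor>x / e\<rfloor> \<in> B" if "\<bar>x\<bar> \<le> 1" for x
  proof -
    have "- (1 / e) \<le> x / e" "x / e \<le> 1 / e" using that e by (auto simp: field_simps)
    then have "\<lfloor>- (1 / e)\<rfloor> \<le> \<lfloor>x / e\<rfloor>" "\<lfloor>x / e\<rfloor> \<le> \<lceil>1 / e\<rceil>" by (linarith, linarith)
    then show ?thesis by (auto simp: B_def ceiling_def)
  qed
  have "cell ` T \<subseteq> {f. \<forall>x. (x \<in> {..<d} \<times> {..<d} \<longrightarrow> f x \<in> B \<times> B) \<and> (x \<notin> {..<d} \<times> {..<d} \<longrightarrow> f x = (0, 0))}"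
    using bnd abs_Re_le_cmod abs_Im_le_cmod
    by (auto simp: cell_def intro!: inB) (meson order_trans)+
  moreover have "finite {f. \<forall>x. (x \<in> {..<d} \<times> {..<d} \<longrightarrow> f x \<in> B \<times> B) \<and> (x \<notin> {..<d} \<times> {..<d} \<longrightarrow> f x = (0, 0))}"
    by (rule finite_set_of_finite_funs) (auto simp: B_def)
  ultimately have fin: "finite (cell ` T)" by (rule finite_subset)
  define N where "N = inv_into T cell ` cell ` T"
  have "\<exists>Y\<in>N. \<forall>i<d. \<forall>j<d. cmod (X $$ (i, j) - Y $$ (i, j)) \<le> \<delta>" if X: "X \<in> T" for X
  proof (intro bexI[of _ "inv_into T cell (cell X)"] allI impI)
    let ?Y = "inv_into T cell (cell X)"
    show "?Y \<in> N" using X by (auto simp: N_def)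
    have eq: "cell ?Y = cell X" using X by (simp add: f_inv_into_f)
    fix i j assume ij: "i < d" "j < d"
    from fun_cong[OF eq, of "(i, j)"] ij
    have fl: "\<lfloor>Re (?Y $$ (i, j)) / e\<rfloor> = \<lfloor>Re (X $$ (i, j)) / e\<rfloor>" "\<lfloor>Im (?Y $$ (i, j)) / e\<rfloor> = \<lfloor>Im (X $$ (i, j)) / e\<rfloor>"
      by (auto simp: cell_def)
    have close: "\<bar>y - x\<bar> \<le> e" if "\<lfloor>x / e\<rfloor> = \<lfloor>y / e\<rfloor>" for x y :: real
    proof -
      have "\<bar>x / e - y / e\<bar> \<le> 1" by (rule floor_eq_close[OF that])
      moreover have "x / e - y / e = (x - y) / e" by (rule diff_divide_distrib[symmetric])
      ultimately have "\<bar>x - y\<bar> / e \<le> 1" using e by (simp only: abs_divide abs_of_pos)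
      then have "\<bar>x - y\<bar> \<le> e" using e by (simp only: divide_le_eq_1_pos)
      then show ?thesis by (simp only: abs_minus_commute)
    qed
    have "cmod (X $$ (i, j) - ?Y $$ (i, j)) \<le> \<bar>Re (X $$ (i, j) - ?Y $$ (i, j))\<bar> + \<bar>Im (X $$ (i, j) - ?Y $$ (i, j))\<bar>"
      by (rule cmod_le)
    also have "\<dots> \<le> e + e"
      unfolding minus_complex.simps by (intro add_mono close fl)
    finally show "cmod (X $$ (i, j) - ?Y $$ (i, j)) \<le> \<delta>" by (simp add: e_def)
  qed
  moreover have "finite N" "N \<subseteq> T" using fin by (auto simp: N_def intro: inv_into_into)
  ultimately show ?thesis by blast
qed

lemma sep_states_convex:
  assumes "x \<in> sep_states dA dB" "y \<in> sep_states dA dB" "0 \<le> t" "t \<le> 1"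
  shows "complex_of_real t \<cdot>\<^sub>m x + complex_of_real (1 - t) \<cdot>\<^sub>m y \<in> sep_states dA dB"
proof -
  have c: "x \<in> carrier_mat (dA * dB) (dA * dB)" "y \<in> carrier_mat (dA * dB) (dA * dB)"
    using assms sep_states_states states_carrier by auto
  have "tr (complex_of_real t \<cdot>\<^sub>m x + complex_of_real (1 - t) \<cdot>\<^sub>m y) = of_real t + of_real (1 - t)"
    using c assms by (simp add: tr_add[of _ "dA * dB"] tr_smult[of _ "dA * dB"] sep_states_iff)
  then have "tr (complex_of_real t \<cdot>\<^sub>m x + complex_of_real (1 - t) \<cdot>\<^sub>m y) = 1" by simp
  moreover have "complex_of_real t \<cdot>\<^sub>m x + complex_of_real (1 - t) \<cdot>\<^sub>m y \<in> pcone dA dB"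
    using assms by (intro gcone_add pcone_smult) (auto simp: sep_states_iff)
  ultimately show ?thesis by (simp add: sep_states_iff)
qed

definition scale_list :: "real \<Rightarrow> (complex mat \<times> real) list \<Rightarrow> (complex mat \<times> real) list" where
  "scale_list l L = map (\<lambda>(E, f). (complex_of_real l \<cdot>\<^sub>m E, f)) L"

lemma wop_scale_list:
  "\<forall>(E, f)\<in>set L. E \<in> carrier_mat d d \<Longrightarrow> wop d \<phi> (scale_list l L) = complex_of_real l \<cdot>\<^sub>m wop d \<phi> L"
proof (induction L)
  case Nil
  then show ?case by (intro eq_matI) (auto simp: wop_Nil scale_list_def)
next
  case (Cons x L)
  obtain E f where x: "x = (E, f)" by (cases x)
  have E: "E \<in> carrier_mat d d" using Cons x by auto
  have "wop d \<phi> (scale_list l (x # L)) = complex_of_real (\<phi> f) \<cdot>\<^sub>m (complex_of_real l \<cdot>\<^sub>m E) + complex_of_real l \<cdot>\<^sub>m wop d \<phi> L"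
    using Cons x E by (simp add: scale_list_def wop_Cons)
  also have "\<dots> = complex_of_real l \<cdot>\<^sub>m wop d \<phi> (x # L)"
    unfolding x wop_Cons[OF E] using E by (intro eq_matI) (auto simp: algebra_simps)
  finally show ?case .
qed

lemma wop_append:
  "\<forall>(E, f)\<in>set L. E \<in> carrier_mat d d \<Longrightarrow> wop d \<phi> (L @ L') = wop d \<phi> L + wop d \<phi> L'"
  by (intro eq_matI) (auto simp: wop_def)

lemma wval_wop:
  assumes "\<forall>(E, f)\<in>set L. E \<in> carrier_mat d d" "\<rho> \<in> carrier_mat d d"
  shows "wval \<rho> L = Re (tr (\<rho> * wop d (log 2) L))"
  unfolding wval_def tr_mult_wop[OF assms] by (simp add: mult.commute)

text \<open>Performing \<open>L\<close> with probability \<open>l\<close> and \<open>L'\<close>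
  otherwise keeps all weights and scales only the effects, so every \<open>wop\<close> is affine in
  the mixture.\<close>

lemma wpovm_mix:
  assumes "wpovm dA dB L" "wpovm dA dB L'" "0 \<le> l" "l \<le> 1"
  shows "wpovm dA dB (scale_list l L @ scale_list (1 - l) L')"
    and "wop (dA * dB) \<phi> (scale_list l L @ scale_list (1 - l) L') =
      complex_of_real l \<cdot>\<^sub>m wop (dA * dB) \<phi> L + complex_of_real (1 - l) \<cdot>\<^sub>m wop (dA * dB) \<phi> L'"
proof -
  note c = wpovm_carrier[OF assms(1)] wpovm_carrier[OF assms(2)]
  have "\<forall>(E, f)\<in>set (scale_list l L). E \<in> carrier_mat (dA * dB) (dA * dB)"
    using c by (auto simp: scale_list_def)
  then show w: "wop (dA * dB) \<phi> (scale_list l L @ scale_list (1 - l) L') =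
      complex_of_real l \<cdot>\<^sub>m wop (dA * dB) \<phi> L + complex_of_real (1 - l) \<cdot>\<^sub>m wop (dA * dB) \<phi> L'" for \<phi>
    by (simp add: wop_append wop_scale_list c)
  have "complex_of_real l \<cdot>\<^sub>m 1\<^sub>m (dA * dB) + complex_of_real (1 - l) \<cdot>\<^sub>m 1\<^sub>m (dA * dB) = 1\<^sub>m (dA * dB)"
    by (intro eq_matI) auto
  then show "wpovm dA dB (scale_list l L @ scale_list (1 - l) L')"
    using assms unfolding wpovm_def w
    by (auto simp: scale_list_def intro!: pcone_smult pcone_smult[of _ _ _ "1 - l", simplified])
qed

text \<open>A product vector of nonzero norm gives, after normalization, a separable state; on one
  of norm zero both forms vanish.\<close>

lemma pord_from_sep_states:
  assumes F: "F \<in> pcone dA dB" and le: "\<And>\<sigma>. \<sigma> \<in> sep_states dA dB \<Longrightarrow> Re (tr (F * \<sigma>)) \<le> b"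
  shows "pord dA dB F (complex_of_real b \<cdot>\<^sub>m 1\<^sub>m (dA * dB))"
  unfolding pord_def
proof
  fix u assume u: "u \<in> pvs dB"
  let ?D = "dA * dB"
  note Fc = gcone_carrier[OF F]
  have qF: "0 \<le> quad ?D F u" using gcone_quad_ge0[OF F] .
  define n where "n = Re (tr (prj ?D u))"
  have ipn: "ip ?D u u = of_real n" unfolding n_def tr_prj ip_self by simp
  have P: "prj ?D u \<in> pcone dA dB" using u by (rule gcone_prj)
  have n0: "0 \<le> n" using tr_gcone_nonneg[OF P] by (simp add: n_def less_eq_complex_def)
  have "Re (quad ?D F u) \<le> b * n"
  proof (cases "n = 0")
    case True
    then have "tr (prj ?D u) = 0" using ipn tr_prj by simp
    then have "prj ?D u = 0\<^sub>m ?D ?D" using tr_gcone_eq_0[OF P] by simp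
    then have "quad ?D F u = 0" using tr_mult_prj[OF Fc, of u] Fc by (simp add: tr_def)
    then show ?thesis using True by simp
  next
    case False
    have "Re (tr (F * (complex_of_real (1 / n) \<cdot>\<^sub>m prj ?D u))) \<le> b"
      using pcone_scale_sep_states[OF P] False by (intro le) (simp add: n_def)
    then have "Re (quad ?D F u) / n \<le> b"
      unfolding tr_mult_smult[OF Fc prj_carrier] tr_mult_prj[OF Fc] by simp
    then show ?thesis using False n0 by (simp add: pos_divide_le_eq less_le)
  qed
  then show "quad ?D F u \<le> quad ?D (complex_of_real b \<cdot>\<^sub>m 1\<^sub>m ?D) u"
    using qF by (simp add: quad_smult ipn less_eq_complex_def)
qed

lemma log2_le: "1 \<le> s \<Longrightarrow> log 2 s \<le> s"
proof -
  assume s: "1 \<le> s"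
  have "ln (s / 2) \<le> s / 2 - 1" by (rule ln_le_minus_one) (use s in simp)
  then have "ln s \<le> s / 2 - 1 + ln 2" using s by (simp add: ln_div)
  also have "\<dots> \<le> s / 2" using ln_2_less_1 by simp
  also have "s / 2 \<le> s * ln 2"
    using mult_left_mono[of "1 / 2" "ln 2" s] s ln_ge_iff[of 2 "1/2"] exp_half_le2 by simp
  finally show ?thesis by (simp add: log_def divide_le_eq)
qed

text \<open>Mixing \<open>\<sigma>\<close> with the maximally mixed state keeps the likelihood ratios \<open>f\<close> bounded.\<close>

lemma bounded_weights:
  assumes pos: "0 < dA" "0 < dB" and \<rho>: "\<rho> \<in> states (dA * dB)" and c: "ereal c < D_SEP_sep dA dB \<rho>"
    and \<sigma>: "\<sigma> \<in> sep_states dA dB"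
  shows "\<exists>L. wpovm dA dB L \<and> (\<forall>(E, f)\<in>set L. f \<le> 2 * real (dA * dB) + 1) \<and>
    c - 2 \<le> wval \<rho> L - Re (tr (wop (dA * dB) (\<lambda>f. f) L * (\<sigma> + max_mixed (dA * dB)))) / 2"
proof -
  define D where "D = dA * dB"
  have D: "0 < D" using pos by (simp add: D_def)
  define \<tau> where "\<tau> = max_mixed D"
  have \<tau>: "\<tau> \<in> sep_states dA dB" using max_mixed_sep[OF pos] by (simp add: \<tau>_def D_def)
  have \<sigma>c: "\<sigma> \<in> carrier_mat D D" and \<tau>c: "\<tau> \<in> carrier_mat D D" and \<rho>c: "\<rho> \<in> carrier_mat D D"
    using \<sigma> \<tau> \<rho> sep_states_states states_carrier unfolding D_def by auto
  define \<sigma>' where "\<sigma>' = complex_of_real (1/2) \<cdot>\<^sub>m \<sigma> + complex_of_real (1 - 1/2) \<cdot>\<^sub>m \<tau>"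
  have \<sigma>': "\<sigma>' \<in> sep_states dA dB" unfolding \<sigma>'_def by (rule sep_states_convex[OF \<sigma> \<tau>]) auto
  have \<sigma>'c: "\<sigma>' \<in> carrier_mat D D" using \<sigma>' sep_states_states states_carrier unfolding D_def by auto
  have "ereal c < D_SEP dA dB \<rho> \<sigma>'"
    using c \<sigma>' unfolding D_SEP_sep_def by (meson INF_lower less_le_trans)
  then obtain k E where povm: "sep_povm dA dB k E"
    and sup: "ereal c < (\<Sum>x<k. rel_ent_term (Re (tr (\<rho> * E x))) (Re (tr (\<sigma>' * E x))))"
    unfolding D_SEP_def less_Sup_iff by auto
  have E: "E x \<in> pcone dA dB" if "x < k" for x
    using povm that by (auto simp: sep_povm_def sep_cone_iff[OF pos])
  have Ec: "E x \<in> carrier_mat D D" if "x < k" for x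
    using gcone_carrier[OF E[OF that]] by (simp add: D_def)
  define p where "p x = Re (tr (\<rho> * E x))" for x
  define q where "q x = Re (tr (\<sigma>' * E x))" for x
  \<comment> \<open>The bound compares both sides with \<open>tr (E x)\<close>:
    \<open>\<rho>\<close> is at most the identity, while half of \<open>\<sigma>'\<close> is
    maximally mixed.\<close>
  have p0: "0 \<le> p x" and q0: "0 \<le> q x" and pq: "p x \<le> 2 * real D * q x" if x: "x < k" for x
  proof -
    have Ep: "psd D (E x)" using gcone_psd[OF E[OF x]] by (simp add: D_def)
    have "psd D \<rho>" "psd D \<sigma>'" "psd D \<sigma>" using \<rho> \<sigma>' \<sigma> sep_states_states by (auto simp: states_def D_def)
    then show "0 \<le> p x" "0 \<le> q x" using Ep by (auto simp: p_def q_def psd_tr_mult_Re_ge0)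
    have "psd D (1\<^sub>m D - \<rho>)"
      unfolding psd_iff using \<rho>c psd_quad_le_tr[OF \<open>psd D \<rho>\<close>] \<rho>
      by (auto simp: quad_minus states_def D_def)
    then have "0 \<le> Re (tr (E x * (1\<^sub>m D - \<rho>)))" using Ep by (rule psd_tr_mult_Re_ge0[rotated])
    then have p_le: "p x \<le> Re (tr (E x))"
      unfolding tr_mult_minus[OF Ec[OF x] one_carrier_mat \<rho>c] p_def
      using Ec[OF x] tr_comm[OF \<rho>c Ec[OF x]] by simp
    have "q x = Re (tr (E x * \<sigma>')) " unfolding q_def using tr_comm[OF \<sigma>'c Ec[OF x]] by simp
    also have "\<dots> = Re (tr (E x * \<sigma>)) / 2 + Re (tr (E x * \<tau>)) / 2"
      unfolding \<sigma>'_def using Ec[OF x] \<sigma>c \<tau>c by (simp add: tr_mult_add[of _ D] tr_mult_smult[of _ D])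
    also have "Re (tr (E x * \<tau>)) = Re (tr (E x)) / D"
      unfolding \<tau>_def max_mixed_def using Ec[OF x] by (simp add: tr_mult_smult[of _ D])
    finally have "Re (tr (E x)) / D \<le> 2 * q x"
      using psd_tr_mult_Re_ge0[OF Ep \<open>psd D \<sigma>\<close>] by simp
    then have "Re (tr (E x)) \<le> 2 * q x * D" using D by (simp add: divide_le_eq)
    with p_le show "p x \<le> 2 * real D * q x" by (simp add: mult_ac)
  qed
  \<comment> \<open>Adding 1 keeps the weight positive and only raises its logarithm. The constraint
    then evaluates to at most \<open>\<Sum> p + \<Sum> q = 2\<close> on \<open>\<sigma>'\<close>,
    whence the \<open>c - 2\<close>. If \<open>q x = 0\<close>, then \<open>p x = 0\<close> and the
    weight is 1.\<close>
  define f where "f x = p x / q x + 1" for x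
  define L where "L = map (\<lambda>x. (E x, f x)) [0..<k]"
  have f: "0 < f x" "f x \<le> 2 * real D + 1" if x: "x < k" for x
  proof -
    have r: "0 \<le> p x / q x" using p0[OF x] q0[OF x] by simp
    then show "0 < f x" by (simp add: f_def)
    show "f x \<le> 2 * real D + 1"
      using pq[OF x] q0[OF x] by (cases "q x = 0") (auto simp: f_def pos_divide_le_eq less_le)
  qed
  have sl: "(\<Sum>(E, f)\<leftarrow>L. h E f) = (\<Sum>x<k. h (E x) (f x))" for h :: "complex mat \<Rightarrow> real \<Rightarrow> 'b::comm_monoid_add"
    by (simp add: L_def comp_def interv_sum_list_conv_sum_set_nat atLeast0LessThan)
  have wL: "wpovm dA dB L"
  proof -
    have "wop D (\<lambda>_. 1) L = mat_sum D E k"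
      unfolding wop_def mat_sum_def sl by simp
    also have "\<dots> = 1\<^sub>m D" using povm by (simp add: sep_povm_def D_def)
    finally show ?thesis using E f by (auto simp: wpovm_def L_def D_def)
  qed
  have "(\<Sum>x<k. rel_ent_term (p x) (q x)) \<le> (\<Sum>x<k. ereal (p x * log 2 (f x)))"
  proof (rule sum_mono)
    fix x assume "x \<in> {..<k}"
    then have x: "x < k" by simp
    show "rel_ent_term (p x) (q x) \<le> ereal (p x * log 2 (f x))"
    proof (cases "p x = 0")
      case True
      then show ?thesis by (simp add: rel_ent_term_def)
    next
      case False
      then have q: "0 < q x" "0 < p x" using pq[OF x] p0[OF x] q0[OF x] by (cases "q x = 0"; simp)+
      then have "log 2 (p x / q x) \<le> log 2 (f x)" by (simp add: f_def add_pos_pos)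
      then show ?thesis using q False by (simp add: rel_ent_term_def)
    qed
  qed
  also have "\<dots> = ereal (\<Sum>x<k. p x * log 2 (f x))" by simp
  finally have "ereal c < ereal (\<Sum>x<k. p x * log 2 (f x))"
    using sup unfolding p_def q_def by (rule less_le_trans[rotated])
  then have "c < (\<Sum>x<k. p x * log 2 (f x))" by (simp only: less_ereal.simps)
  also have "\<dots> = wval \<rho> L" unfolding wval_def sl p_def ..
  finally have v: "c < wval \<rho> L" .
  have sp: "(\<Sum>x<k. p x) = 1" "(\<Sum>x<k. q x) = 1"
    using wpovm_sum_prob[OF wL \<rho>] wpovm_sum_prob[OF wL sep_states_states[OF \<sigma>']]
    unfolding sl p_def q_def by auto
  have LC: "\<forall>(E, f)\<in>set L. E \<in> carrier_mat D D" using wpovm_carrier[OF wL] by (simp add: D_def)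
  have "Re (tr (\<sigma>' * wop D (\<lambda>f. f) L)) = (\<Sum>x<k. f x * q x)"
    unfolding tr_mult_wop[OF LC \<sigma>'c] sl q_def ..
  also have "\<dots> \<le> (\<Sum>x<k. p x + q x)"
    using p0 by (intro sum_mono) (auto simp: f_def distrib_right)
  finally have s2: "Re (tr (\<sigma>' * wop D (\<lambda>f. f) L)) \<le> 2" by (simp add: sum.distrib sp)
  have "Re (tr (wop D (\<lambda>f. f) L * (\<sigma> + \<tau>))) / 2 = Re (tr (wop D (\<lambda>f. f) L * \<sigma>'))"
    unfolding \<sigma>'_def using \<sigma>c \<tau>c by (simp add: tr_mult_add[of _ D] tr_mult_smult[of _ D] add_divide_distrib)
  also have "\<dots> \<le> 2" using s2 tr_comm[OF wop_carrier \<sigma>'c] by simp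
  finally have "c - 2 \<le> wval \<rho> L - Re (tr (wop D (\<lambda>f. f) L * (\<sigma> + \<tau>))) / 2" using v by simp
  moreover have "\<forall>(E, f)\<in>set L. f \<le> 2 * real D + 1" using f by (auto simp: L_def)
  ultimately show ?thesis using wL unfolding D_def \<tau>_def by blast
qed

text \<open>The payoff \<open>g L X\<close> is affine in the state and in the mixture of lists.
  Bounded weights make it uniformly continuous in the state, so the lists of finitely many net
  points nearly serve every state, and \<open>minimax_finite\<close> merges them into one list. Of
  the loss of 4, \<open>bounded_weights\<close> takes 2, the net 1 and the final normalization
  1.\<close>

lemma exists_feas:
  assumes pos: "0 < dA" "0 < dB" and \<rho>: "\<rho> \<in> states (dA * dB)" and c: "ereal c < D_SEP_sep dA dB \<rho>"
  shows "\<exists>L. feas dA dB L \<and> c - 4 \<le> wval \<rho> L"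
proof -
  define D where "D = dA * dB"
  have D: "0 < D" using pos by (simp add: D_def)
  define \<tau> where "\<tau> = max_mixed D"
  define T where "T = sep_states dA dB"
  have \<tau>: "\<tau> \<in> T" using max_mixed_sep[OF pos] by (simp add: \<tau>_def D_def T_def)
  have Tc: "X \<in> carrier_mat D D" if "X \<in> T" for X
    using that sep_states_states states_carrier unfolding D_def T_def by auto
  have \<rho>c: "\<rho> \<in> carrier_mat D D" using \<rho> states_carrier by (auto simp: D_def)
  define F where "F L = wop D (\<lambda>f. f) L" for L
  have Fc: "F L \<in> carrier_mat D D" for L by (simp add: F_def)
  define g where "g L X = wval \<rho> L - Re (tr (F L * (X + \<tau>))) / 2" for L X
  define M where "M = 2 * real D + 1"
  have "\<forall>X\<in>T. \<exists>L. wpovm dA dB L \<and> (\<forall>(E, f)\<in>set L. f \<le> M) \<and> c - 2 \<le> g L X"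
    using bounded_weights[OF pos \<rho> c] unfolding g_def F_def M_def D_def \<tau>_def T_def by blast
  then obtain Ls where Ls: "\<And>X. X \<in> T \<Longrightarrow> wpovm dA dB (Ls X)" "\<And>X. X \<in> T \<Longrightarrow> \<forall>(E, f)\<in>set (Ls X). f \<le> M"
    "\<And>X. X \<in> T \<Longrightarrow> c - 2 \<le> g (Ls X) X" by metis
  \<comment> \<open>Entries of \<open>F L\<close> are at most \<open>M * D\<close> in modulus, so
    over \<open>D * D\<close> entries a perturbation of size \<open>\<delta>\<close> changes the
    pairing by at most 1.\<close>
  define \<delta> where "\<delta> = 1 / (real D * (real D * (M * real D)))"
  have \<delta>: "0 < \<delta>" using D by (simp add: \<delta>_def M_def add_pos_pos)
  have "cmod (X $$ (i, j)) \<le> 1" if "X \<in> T" "i < D" "j < D" for X i j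
    using psd_entry_le_tr[of D X i j] that sep_states_states[of X dA dB]
    by (auto simp: T_def states_def D_def)
  from finite_entry_net[of T D, OF this \<delta>] obtain N where N: "finite N" "N \<subseteq> T"
    and net: "\<And>X. X \<in> T \<Longrightarrow> \<exists>Y\<in>N. \<forall>i<D. \<forall>j<D. cmod (X $$ (i, j) - Y $$ (i, j)) \<le> \<delta>" by blast
  have close: "c - 3 \<le> g (Ls Y) X"
    if X: "X \<in> T" and Y: "Y \<in> T" and d: "\<forall>i<D. \<forall>j<D. cmod (X $$ (i, j) - Y $$ (i, j)) \<le> \<delta>" for X Y
  proof -
    define L where "L = Ls Y"
    have wL: "wpovm dA dB L" and fM: "\<forall>(E, f)\<in>set L. f \<le> M" using Ls Y by (auto simp: L_def)
    have LC: "\<forall>(E, f)\<in>set L. E \<in> carrier_mat D D" using wpovm_carrier[OF wL] by (simp add: D_def)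
    have FP: "F L \<in> pcone dA dB" using wL unfolding F_def D_def wpovm_def by (intro wop_pcone) auto
    have Fpsd: "psd D (F L)" using gcone_psd[OF FP] by (simp add: D_def)
    have "Re (tr (F L)) = Re (tr (1\<^sub>m D * wop D (\<lambda>f. f) L))" using Fc by (simp add: F_def)
    also have "\<dots> = (\<Sum>(E, f)\<leftarrow>L. f * Re (tr (1\<^sub>m D * E)))" by (rule tr_mult_wop[OF LC]) simp
    also have "\<dots> \<le> (\<Sum>(E, f)\<leftarrow>L. M * Re (tr (1\<^sub>m D * E)))"
    proof (rule sum_list_mono, clarsimp)
      fix E f assume Ef: "(E, f) \<in> set L"
      then have Ep: "psd D E" using wL gcone_psd by (auto simp: wpovm_def D_def)
      have "psd D (1\<^sub>m D)" by (simp add: psd_iff ip_self_ge0)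
      then have "0 \<le> Re (tr (1\<^sub>m D * E))" using Ep by (rule psd_tr_mult_Re_ge0)
      then show "f * Re (tr (1\<^sub>m D * E)) \<le> M * Re (tr (1\<^sub>m D * E))"
        using fM Ef by (intro mult_right_mono) auto
    qed
    also have "\<dots> = Re (tr (1\<^sub>m D * wop D (\<lambda>_. M) L))" by (rule tr_mult_wop[OF LC, symmetric]) simp
    also have "wop D (\<lambda>_. M) L = complex_of_real M \<cdot>\<^sub>m 1\<^sub>m D"
    proof -
      have "wop D (\<lambda>_. M) L = complex_of_real M \<cdot>\<^sub>m wop D (\<lambda>_. 1) L"
      proof (rule eq_matI)
        have "(\<Sum>(E, f)\<leftarrow>L. complex_of_real M * E $$ (i, j)) = complex_of_real M * (\<Sum>(E, f)\<leftarrow>L. E $$ (i, j))" for i j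
          by (induction L) (auto simp: distrib_left)
        then show "wop D (\<lambda>_. M) L $$ (i, j) = (complex_of_real M \<cdot>\<^sub>m wop D (\<lambda>_. 1) L) $$ (i, j)"
          if "i < dim_row (complex_of_real M \<cdot>\<^sub>m wop D (\<lambda>_. 1) L)"
            "j < dim_col (complex_of_real M \<cdot>\<^sub>m wop D (\<lambda>_. 1) L)" for i j
          using that by (simp add: wop_def)
      qed auto
      then show ?thesis using wL by (simp add: wpovm_def D_def)
    qed
    also have "Re (tr (1\<^sub>m D * (complex_of_real M \<cdot>\<^sub>m 1\<^sub>m D))) = M * real D"
      by (simp add: tr_def)
    finally have trF: "Re (tr (F L)) \<le> M * real D" .
    have XY: "X - Y \<in> carrier_mat D D" by (rule minus_carrier_mat[OF Tc[OF Y]])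
    have "cmod (tr (F L * (X - Y))) \<le> (\<Sum>i<D. \<Sum>j<D. (M * real D) * \<delta>)"
      unfolding tr_mult[OF Fc XY]
    proof (intro order_trans[OF norm_sum] sum_mono)
      fix i j assume "i \<in> {..<D}" "j \<in> {..<D}"
      then have ij: "i < D" "j < D" by auto
      have "cmod (F L $$ (i, j)) \<le> M * real D" using psd_entry_le_tr[OF Fpsd ij] trF by simp
      moreover have "cmod ((X - Y) $$ (j, i)) \<le> \<delta>" using d ij Tc[OF X] Tc[OF Y] by simp
      ultimately show "cmod (F L $$ (i, j) * (X - Y) $$ (j, i)) \<le> M * real D * \<delta>"
        unfolding norm_mult by (intro mult_mono) (auto intro: order_trans[OF norm_ge_zero])
    qed
    also have "\<dots> = 1" using D by (simp add: \<delta>_def M_def)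
    finally have "\<bar>Re (tr (F L * (X - Y)))\<bar> \<le> 1" using abs_Re_le_cmod order_trans by blast
    moreover have "tr (F L * (X - Y)) = tr (F L * (X + \<tau>)) - tr (F L * (Y + \<tau>))"
      using Fc Tc[OF X] Tc[OF Y] Tc[OF \<tau>] by (simp add: tr_mult_minus[of _ D] tr_mult_add[of _ D])
    ultimately have "g L Y - 1 \<le> g L X" unfolding g_def by simp
    then show ?thesis using Ls(3)[OF Y] by (simp add: L_def)
  qed
  define mix where "mix t X Y = complex_of_real t \<cdot>\<^sub>m X + complex_of_real (1 - t) \<cdot>\<^sub>m Y" for t and X Y :: "complex mat"
  have "\<exists>h\<in>{g L | L. wpovm dA dB L}. \<forall>X\<in>T. c - 3 \<le> h X"
  proof (rule minimax_finite[where mix = mix and N = "(\<lambda>Y. g (Ls Y)) ` N" and T = T])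
    show "finite ((\<lambda>Y. g (Ls Y)) ` N)" using N by simp
    show "(\<lambda>Y. g (Ls Y)) ` N \<noteq> {}" using net[OF \<tau>] by auto
    show "(\<lambda>Y. g (Ls Y)) ` N \<subseteq> {g L |L. wpovm dA dB L}" using N Ls by auto
    show "mix t x y \<in> T" if "x \<in> T" "y \<in> T" "0 \<le> t" "t \<le> 1" for t x y
      using sep_states_convex that unfolding mix_def T_def by blast
    show "h (mix t x y) = t * h x + (1 - t) * h y"
      if h_in: "h \<in> {g L |L. wpovm dA dB L}" and "x \<in> T" "y \<in> T" "0 \<le> t" "t \<le> 1" for h t x y
    proof -
      obtain L where h: "h = g L" using h_in by blast
      show ?thesis unfolding h g_def mix_def using Fc[of L] Tc[OF that(2)] Tc[OF that(3)] Tc[OF \<tau>]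
        by (simp add: tr_mult_add[of _ D] tr_mult_smult[of _ D]) (simp add: field_simps)
    qed
    show "\<exists>k\<in>{g L |L. wpovm dA dB L}. \<forall>x\<in>T. k x = l * h x + (1 - l) * h' x"
      if h_in: "h \<in> {g L |L. wpovm dA dB L}" "h' \<in> {g L |L. wpovm dA dB L}" and l01: "0 \<le> l" "l \<le> 1" for h h' l
    proof -
      obtain L L' where h: "h = g L" "h' = g L'" and w: "wpovm dA dB L" "wpovm dA dB L'" using h_in by blast
      let ?L = "scale_list l L @ scale_list (1 - l) L'"
      note wm = wpovm_mix[OF w l01]
      have LC: "\<forall>(E, f)\<in>set ?L. E \<in> carrier_mat D D" "\<forall>(E, f)\<in>set L. E \<in> carrier_mat D D"
        "\<forall>(E, f)\<in>set L'. E \<in> carrier_mat D D"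
        using wpovm_carrier[OF wm(1)] wpovm_carrier[OF w(1)] wpovm_carrier[OF w(2)] by (auto simp: D_def)
      have v: "wval \<rho> ?L = l * wval \<rho> L + (1 - l) * wval \<rho> L'"
        unfolding wval_wop[OF LC(1) \<rho>c] wval_wop[OF LC(2) \<rho>c] wval_wop[OF LC(3) \<rho>c]
        using wm(2)[of "log 2"] \<rho>c by (simp add: tr_mult_add[of _ D] tr_mult_smult[of _ D] D_def[symmetric])
      have t: "Re (tr (F ?L * Z)) = l * Re (tr (F L * Z)) + (1 - l) * Re (tr (F L' * Z))"
        if Z: "Z \<in> carrier_mat D D" for Z
      proof -
        have "tr (Z * F ?L) = complex_of_real l * tr (Z * F L) + complex_of_real (1 - l) * tr (Z * F L')"
          using wm(2)[of "\<lambda>f. f"] Z Fc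
          by (simp add: F_def tr_mult_add[of _ D] tr_mult_smult[of _ D] D_def[symmetric])
        then show ?thesis unfolding tr_comm[OF Z Fc] by simp
      qed
      have "g ?L x = l * g L x + (1 - l) * g L' x" if "x \<in> T" for x
        unfolding g_def v using t[of "x + \<tau>"] Tc[OF that] Tc[OF \<tau>] by (simp add: algebra_simps) (simp add: field_simps)
      then show ?thesis using wm(1) unfolding h by blast
    qed
    show "\<exists>h\<in>(\<lambda>Y. g (Ls Y)) ` N. c - 3 \<le> h X" if "X \<in> T" for X
      using net[OF that] close[OF that] N(2) by blast
  qed auto
  then obtain L where wL: "wpovm dA dB L" and gL: "\<And>X. X \<in> T \<Longrightarrow> c - 3 \<le> g L X" by blast
  have LC: "\<forall>(E, f)\<in>set L. E \<in> carrier_mat D D" using wpovm_carrier[OF wL] by (simp add: D_def)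
  \<comment> \<open>The payoff bound says only that the weighted operator has expectation at most
    \<open>2 * s\<close> on separable states. Dividing the weights by \<open>2 * s'\<close> makes
    the list feasible and lowers the value by \<open>log 2 s' + 1 \<le> s + 1\<close>, where
    \<open>s\<close> is just the excess of the value over \<open>c - 3\<close>.\<close>
  define s where "s = wval \<rho> L - (c - 3)"
  define s' where "s' = max s 1"
  have FP: "F L \<in> pcone dA dB" using wL unfolding F_def D_def wpovm_def by (intro wop_pcone) auto
  have Fpsd: "psd D (F L)" using gcone_psd[OF FP] by (simp add: D_def)
  have nn: "0 \<le> Re (tr (F L * X))" if "X \<in> T" for X
    using that sep_states_states[of X dA dB] by (intro psd_tr_mult_Re_ge0[OF Fpsd]) (auto simp: T_def states_def D_def)
  have le: "Re (tr (F L * X)) + Re (tr (F L * \<tau>)) \<le> 2 * s" if "X \<in> T" for X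
  proof -
    have "Re (tr (F L * (X + \<tau>))) = Re (tr (F L * X)) + Re (tr (F L * \<tau>))"
      using Fc[of L] Tc[OF that] Tc[OF \<tau>] by (simp add: tr_mult_add[of _ D])
    moreover have "x + y \<le> 2 * (v - b)" if "z = x + y" "b \<le> v - z / 2" for b v x y z :: real
      using that by (simp add: field_simps)
    ultimately show ?thesis using gL[OF that] unfolding g_def s_def by blast
  qed
  have s0: "0 \<le> s" using le[OF \<tau>] nn[OF \<tau>] by simp
  have s': "1 \<le> s'" "s \<le> s'" by (auto simp: s'_def)
  have pF: "pord dA dB (F L) (complex_of_real (2 * s') \<cdot>\<^sub>m 1\<^sub>m (dA * dB))"
  proof (rule pord_from_sep_states[OF FP])
    fix X assume "X \<in> sep_states dA dB"
    then have "X \<in> T" by (simp add: T_def)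
    from le[OF this] nn[OF \<tau>] s' show "Re (tr (F L * X)) \<le> 2 * s'" by simp
  qed
  define L' where "L' = map (\<lambda>(E, f). (E, f / (2 * s'))) L"
  have sl: "(\<Sum>(E, f)\<leftarrow>L'. h E f) = (\<Sum>(E, f)\<leftarrow>L. h E (f / (2 * s')))" for h :: "complex mat \<Rightarrow> real \<Rightarrow> 'b::monoid_add"
    unfolding L'_def by (induction L) auto
  have w': "wpovm dA dB L'"
  proof -
    have "wop (dA * dB) (\<lambda>_. 1) L' = wop (dA * dB) (\<lambda>_. 1) L" unfolding wop_def sl ..
    then show ?thesis using wL s' by (auto simp: wpovm_def L'_def)
  qed
  have F': "complex_of_real (2 * s') \<cdot>\<^sub>m wop (dA * dB) (\<lambda>f. f) L' = F L"
    unfolding F_def D_def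
  proof (rule eq_matI)
    have "(\<Sum>(E, f)\<leftarrow>L. complex_of_real f * E $$ (i, j)) =
        complex_of_real (2 * s') * (\<Sum>(E, f)\<leftarrow>L. complex_of_real (f / (2 * s')) * E $$ (i, j))" for i j
      using s'(1) by (induction L) (auto simp: distrib_left)
    then show "(complex_of_real (2 * s') \<cdot>\<^sub>m wop (dA * dB) (\<lambda>f. f) L') $$ (i, j) = wop (dA * dB) (\<lambda>f. f) L $$ (i, j)"
      if "i < dim_row (wop (dA * dB) (\<lambda>f. f) L)" "j < dim_col (wop (dA * dB) (\<lambda>f. f) L)" for i j
      using that unfolding wop_def by (simp add: sl)
  qed auto
  have "feas dA dB L'"
    unfolding feas_def pord_def
  proof (intro conjI w' ballI)
    fix u assume "u \<in> pvs dB"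
    then have "quad (dA * dB) (complex_of_real (2 * s') \<cdot>\<^sub>m wop (dA * dB) (\<lambda>f. f) L') u
       \<le> quad (dA * dB) (complex_of_real (2 * s') \<cdot>\<^sub>m 1\<^sub>m (dA * dB)) u"
      using pF unfolding pord_def F' by simp
    then have "complex_of_real (2 * s') * quad (dA * dB) (wop (dA * dB) (\<lambda>f. f) L') u
       \<le> complex_of_real (2 * s') * quad (dA * dB) (1\<^sub>m (dA * dB)) u"
      by (simp add: quad_smult)
    then show "quad (dA * dB) (wop (dA * dB) (\<lambda>f. f) L') u \<le> quad (dA * dB) (1\<^sub>m (dA * dB)) u"
      using s' by (simp add: less_eq_complex_def)
  qed
  moreover have "c - 4 \<le> wval \<rho> L'"
  proof -
    have "wval \<rho> L' = (\<Sum>(E, f)\<leftarrow>L. Re (tr (\<rho> * E)) * log 2 f - log 2 (2 * s') * Re (tr (\<rho> * E)))"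
      unfolding wval_def sl
    proof (intro arg_cong[of _ _ sum_list] map_cong refl, clarsimp)
      fix E f assume "(E, f) \<in> set L"
      then have "0 < f" using wL by (auto simp: wpovm_def)
      then show "Re (tr (\<rho> * E)) * log 2 (f / (2 * s')) =
          Re (tr (\<rho> * E)) * log 2 f - log 2 (2 * s') * Re (tr (\<rho> * E))"
        using s' by (simp add: log_divide algebra_simps)
    qed
    also have "\<dots> = wval \<rho> L - log 2 (2 * s') * (\<Sum>(E, f)\<leftarrow>L. Re (tr (\<rho> * E)))"
      unfolding wval_def by (induction L) (auto simp: algebra_simps)
    also have "\<dots> = wval \<rho> L - log 2 s' - 1"
      using wpovm_sum_prob[OF wL \<rho>] s' by (simp add: log_mult)
    finally have e: "wval \<rho> L' = wval \<rho> L - log 2 s' - 1" .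
    have "log 2 s' \<le> s"
    proof (cases "1 \<le> s")
      case True
      then show ?thesis using log2_le[of s] by (simp add: s'_def)
    next
      case False
      then show ?thesis using s0 by (simp add: s'_def)
    qed
    then show ?thesis using e by (simp add: s_def)
  qed
  ultimately show ?thesis by blast
qed

section \<open>Regularized quantities\<close>

definition kset :: "nat \<Rightarrow> nat \<Rightarrow> complex mat \<Rightarrow> complex mat set" where
  "kset dA dB R = {S \<in> pcone dA dB. psd (dA * dB) (S + R) \<and> psd (dA * dB) (S - R)}"

definition kinf :: "nat \<Rightarrow> nat \<Rightarrow> complex mat \<Rightarrow> real" where
  "kinf dA dB \<rho> = Inf ((\<lambda>S. Re (tr S)) ` kset dA dB (partial_transpose dA dB \<rho>))"

lemma E_kappa_kinf:
  assumes "0 < dA" "0 < dB"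
  shows "E_kappa dA dB \<rho> = log 2 (kinf dA dB \<rho>)"
proof -
  let ?R = "partial_transpose dA dB \<rho>"
  have "S \<in> sep_cone dA dB \<and> lowner_le (dA * dB) (- S) ?R \<and> lowner_le (dA * dB) ?R S \<longleftrightarrow> S \<in> kset dA dB ?R" for S
  proof (cases "S \<in> pcone dA dB")
    case True
    then have c: "S \<in> carrier_mat (dA * dB) (dA * dB)" by (rule gcone_carrier)
    have "?R - - S = S + ?R" using c by (intro eq_matI) auto
    then show ?thesis using True c by (simp add: sep_cone_iff[OF assms] lowner_le_def kset_def)
  next
    case False
    then show ?thesis by (simp add: sep_cone_iff[OF assms] kset_def)
  qed
  then have "{Re (tr S) | S. S \<in> sep_cone dA dB \<and> lowner_le (dA * dB) (- S) ?R \<and> lowner_le (dA * dB) ?R S} =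
    (\<lambda>S. Re (tr S)) ` kset dA dB ?R" by blast
  then show ?thesis unfolding E_kappa_def kinf_def by simp
qed

lemma psd_tr_Re_ge0: "psd d X \<Longrightarrow> 0 \<le> Re (tr X)"
  using tr_gcone_nonneg[OF psd_gcone] by (simp add: less_eq_complex_def)

lemma kset_tr_ge1:
  assumes "\<rho> \<in> states (dA * dB)" "S \<in> kset dA dB (partial_transpose dA dB \<rho>)"
  shows "1 \<le> Re (tr S)"
proof -
  have c: "S \<in> carrier_mat (dA * dB) (dA * dB)" using assms(2) gcone_carrier by (auto simp: kset_def)
  have "0 \<le> Re (tr (S - partial_transpose dA dB \<rho>))"
    using assms(2) by (intro psd_tr_Re_ge0[of "dA * dB"]) (simp add: kset_def)
  then show ?thesis using assms(1) tr_partial_transpose[OF states_carrier[OF assms(1)]]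
    by (simp add: tr_minus[OF c partial_transpose_carrier] states_def)
qed

text \<open>The entries of the partial transpose are entries of the state, hence at most 1 in
  modulus. Its form is therefore at most \<open>D\<close> times the squared norm, and
  \<open>D\<close> times the identity is a separable operator dominating both signs.\<close>

lemma kset_nonempty:
  assumes "\<rho> \<in> states (dA * dB)"
  shows "kset dA dB (partial_transpose dA dB \<rho>) \<noteq> {}"
proof -
  define D where "D = dA * dB"
  define R where "R = partial_transpose dA dB \<rho>"
  define S :: "complex mat" where "S = complex_of_real (real D) \<cdot>\<^sub>m 1\<^sub>m D"
  have Rc: "R \<in> carrier_mat D D" by (simp add: R_def D_def)
  have Sc: "S \<in> carrier_mat D D" by (simp add: S_def)
  have \<rho>: "psd D \<rho>" "tr \<rho> = 1" using assms by (auto simp: states_def D_def)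
  have hR: "herm D R" unfolding R_def D_def by (rule herm_partial_transpose) (use psd_herm \<rho> D_def in auto)
  have ent: "cmod (R $$ (i, j)) \<le> 1" if "i < D" "j < D" for i j
    using psd_entry_le_tr[OF \<rho>(1)] that \<rho>(2) pt_less[of i dA dB j] pt_less[of j dA dB i]
    by (simp add: R_def D_def partial_transpose_index)
  have bnd: "cmod (quad D R u) \<le> real D * (\<Sum>i<D. (cmod (u i))\<^sup>2)" for u
  proof -
    have "cmod (quad D R u) \<le> (\<Sum>i<D. \<Sum>j<D. ((cmod (u i))\<^sup>2 + (cmod (u j))\<^sup>2) / 2)"
      unfolding quad_def
    proof (intro order_trans[OF norm_sum] sum_mono)
      fix i j assume "i \<in> {..<D}" "j \<in> {..<D}"
      then have "cmod (cnj (u i) * R $$ (i, j) * u j) \<le> cmod (u i) * 1 * cmod (u j)"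
        unfolding norm_mult using ent by (intro mult_mono) auto
      also have "\<dots> \<le> ((cmod (u i))\<^sup>2 + (cmod (u j))\<^sup>2) / 2"
        using sum_squares_bound[of "cmod (u i)" "cmod (u j)"] by simp
      finally show "cmod (cnj (u i) * R $$ (i, j) * u j) \<le> ((cmod (u i))\<^sup>2 + (cmod (u j))\<^sup>2) / 2" .
    qed
    also have "\<dots> = real D * (\<Sum>i<D. (cmod (u i))\<^sup>2)"
      by (simp add: sum.distrib add_divide_distrib sum_distrib_left flip: sum_divide_distrib)
    finally show ?thesis .
  qed
  have real: "Im (quad D R u) = 0" for u
  proof -
    have "cnj (quad D R u) = quad D R u" unfolding quad_ip using herm_ip[OF hR, of u u] ip_cnj by metis
    then show ?thesis by (metis Reals_cnj_iff complex_is_Real_iff)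
  qed
  have qS: "quad D S u = of_real (real D * (\<Sum>i<D. (cmod (u i))\<^sup>2))" for u
    unfolding S_def quad_smult[OF one_carrier_mat] quad_one ip_self by simp
  have b: "\<bar>Re (quad D R u)\<bar> \<le> real D * (\<Sum>i<D. (cmod (u i))\<^sup>2)" for u
    using abs_Re_le_cmod bnd order_trans by blast
  have b': "0 \<le> Re (quad D S u + quad D R u)" "0 \<le> Re (quad D S u - quad D R u)" for u
    using b[of u] unfolding plus_complex.simps minus_complex.simps qS Re_complex_of_real by linarith+
  have "psd D (S + R)" "psd D (S - R)"
    unfolding psd_iff quad_add[OF Sc Rc] quad_minus[OF Sc Rc] less_eq_complex_def
    using b' real Rc Sc by (auto simp: qS minus_carrier_mat)
  moreover have "S \<in> pcone dA dB" unfolding S_def D_def by (rule pcone_smult[OF pcone_one]) simp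
  ultimately have "S \<in> kset dA dB R" by (simp add: kset_def D_def)
  then show ?thesis by (auto simp: R_def)
qed

lemma kinf_le:
  assumes "\<rho> \<in> states (dA * dB)" "S \<in> kset dA dB (partial_transpose dA dB \<rho>)"
  shows "kinf dA dB \<rho> \<le> Re (tr S)"
  unfolding kinf_def
  by (rule cInf_lower) (use assms kset_tr_ge1 in \<open>auto intro!: bdd_belowI[of _ 1]\<close>)

lemma kinf_greatest:
  assumes "\<rho> \<in> states (dA * dB)" "\<And>S. S \<in> kset dA dB (partial_transpose dA dB \<rho>) \<Longrightarrow> b \<le> Re (tr S)"
  shows "b \<le> kinf dA dB \<rho>"
  unfolding kinf_def by (rule cInf_greatest) (use assms kset_nonempty in auto)

lemma kinf_ge1: "\<rho> \<in> states (dA * dB) \<Longrightarrow> 1 \<le> kinf dA dB \<rho>"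
  by (rule kinf_greatest) (auto intro: kset_tr_ge1)

text \<open>Twice \<open>S \<otimes> S' + R \<otimes> R'\<close> is
  \<open>(S + R) \<otimes> (S' + R') + (S - R) \<otimes> (S' - R')\<close>, a sum of products of
  positive factors; for the other sign exchange \<open>S' + R'\<close> and
  \<open>S' - R'\<close>.\<close>

lemma kset_bip:
  assumes pos: "0 < dB" "0 < dA'" "0 < dB'"
    and S: "S \<in> kset dA dB R" "S' \<in> kset dA' dB' R'"
    and R: "R \<in> carrier_mat (dA * dB) (dA * dB)" "R' \<in> carrier_mat (dA' * dB') (dA' * dB')"
  shows "bip_tensor dA dB dA' dB' S S' \<in> kset (dA * dA') (dB * dB') (bip_tensor dA dB dA' dB' R R')"
proof -
  let ?b = "bip_tensor dA dB dA' dB'"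
  let ?N = "(dA * dA') * (dB * dB')"
  have c: "S \<in> carrier_mat (dA * dB) (dA * dB)" "S' \<in> carrier_mat (dA' * dB') (dA' * dB')"
    using S gcone_carrier by (auto simp: kset_def)
  have half: "psd ?N (complex_of_real (1/2) \<cdot>\<^sub>m X)" if "psd ?N X" for X
    using gcone_smult[of X ?N UNIV "1/2"] that unfolding psd_eq_gcone by simp
  have add: "psd ?N (X + Y)" if "psd ?N X" "psd ?N Y" for X Y
    using gcone_add that unfolding psd_eq_gcone by blast
  have e1: "?b S S' + ?b R R' = complex_of_real (1/2) \<cdot>\<^sub>m (?b (S + R) (S' + R') + ?b (S - R) (S' - R'))"
    using c R by (intro eq_matI) (simp_all add: bip_index bi_less, simp_all add: field_simps)
  have 1: "psd ?N (?b S S' + ?b R R')"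
    unfolding e1 by (intro half add psd_bip) (use S in \<open>auto simp: kset_def\<close>)
  have e2: "?b S S' - ?b R R' = complex_of_real (1/2) \<cdot>\<^sub>m (?b (S + R) (S' - R') + ?b (S - R) (S' + R'))"
    using c R by (intro eq_matI) (simp_all add: bip_index bi_less, simp_all add: field_simps)
  have 2: "psd ?N (?b S S' - ?b R R')"
    unfolding e2 by (intro half add psd_bip) (use S in \<open>auto simp: kset_def\<close>)
  show ?thesis using 1 2 pcone_bip[OF pos] S by (simp add: kset_def)
qed

lemma states_bip:
  assumes "\<rho> \<in> states (dA * dB)" "\<rho>' \<in> states (dA' * dB')"
  shows "bip_tensor dA dB dA' dB' \<rho> \<rho>' \<in> states ((dA * dA') * (dB * dB'))"
  using assms psd_bip[of dA dB \<rho> dA' dB' \<rho>'] tr_bip[of \<rho> dA dB \<rho>' dA' dB'] psdD(1) by (auto simp: states_def)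

text \<open>The two infima are taken one after the other, each after dividing by the other factor,
  which is at least 1; this avoids choosing minimizers.\<close>

lemma kinf_bip_le:
  assumes pos: "0 < dB" "0 < dA'" "0 < dB'"
    and \<rho>: "\<rho> \<in> states (dA * dB)" "\<rho>' \<in> states (dA' * dB')"
  shows "kinf (dA * dA') (dB * dB') (bip_tensor dA dB dA' dB' \<rho> \<rho>') \<le> kinf dA dB \<rho> * kinf dA' dB' \<rho>'"
proof -
  let ?k = "kinf (dA * dA') (dB * dB') (bip_tensor dA dB dA' dB' \<rho> \<rho>')"
  let ?R = "partial_transpose dA dB \<rho>" and ?R' = "partial_transpose dA' dB' \<rho>'"
  have le: "?k \<le> Re (tr S) * Re (tr S')" if S: "S \<in> kset dA dB ?R" "S' \<in> kset dA' dB' ?R'" for S S'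
  proof -
    have p: "S \<in> pcone dA dB" "S' \<in> pcone dA' dB'" using S by (auto simp: kset_def)
    have "?k \<le> Re (tr (bip_tensor dA dB dA' dB' S S'))"
      using kset_bip[OF pos S] by (intro kinf_le states_bip \<rho>) (simp add: partial_transpose_bip[OF pos])
    also have "\<dots> = Re (tr S) * Re (tr S')"
      unfolding tr_bip[OF gcone_carrier[OF p(1)] gcone_carrier[OF p(2)]]
      by (subst tr_of_real[OF p(1)]) simp
    finally show ?thesis .
  qed
  have k1: "1 \<le> kinf dA dB \<rho>" by (rule kinf_ge1[OF \<rho>(1)])
  have "?k / Re (tr S') \<le> kinf dA dB \<rho>" if S': "S' \<in> kset dA' dB' ?R'" for S'
    using le[OF _ S'] kset_tr_ge1[OF \<rho>(2) S'] by (intro kinf_greatest[OF \<rho>(1)]) (simp add: pos_divide_le_eq)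
  then have "?k / kinf dA dB \<rho> \<le> Re (tr S')" if S': "S' \<in> kset dA' dB' ?R'" for S'
    using that kset_tr_ge1[OF \<rho>(2) S'] k1 by (force simp: pos_divide_le_eq mult.commute)
  then have "?k / kinf dA dB \<rho> \<le> kinf dA' dB' \<rho>'" by (intro kinf_greatest[OF \<rho>(2)])
  then show ?thesis using k1 by (simp add: pos_divide_le_eq mult.commute)
qed

lemma E_kappa_ge0: "0 < dA \<Longrightarrow> 0 < dB \<Longrightarrow> \<rho> \<in> states (dA * dB) \<Longrightarrow> 0 \<le> E_kappa dA dB \<rho>"
  using kinf_ge1[of \<rho> dA dB] by (simp add: E_kappa_kinf zero_le_log_cancel_iff)

lemma E_kappa_subadditive:
  assumes pos: "0 < dA" "0 < dB" "0 < dA'" "0 < dB'"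
    and \<rho>: "\<rho> \<in> states (dA * dB)" "\<rho>' \<in> states (dA' * dB')"
  shows "E_kappa (dA * dA') (dB * dB') (bip_tensor dA dB dA' dB' \<rho> \<rho>') \<le> E_kappa dA dB \<rho> + E_kappa dA' dB' \<rho>'"
proof -
  have k: "1 \<le> kinf dA dB \<rho>" "1 \<le> kinf dA' dB' \<rho>'"
    "1 \<le> kinf (dA * dA') (dB * dB') (bip_tensor dA dB dA' dB' \<rho> \<rho>')"
    using \<rho> by (auto intro: kinf_ge1 states_bip)
  have "log 2 (kinf (dA * dA') (dB * dB') (bip_tensor dA dB dA' dB' \<rho> \<rho>')) \<le> log 2 (kinf dA dB \<rho> * kinf dA' dB' \<rho>')"
    using kinf_bip_le[OF pos(2-4) \<rho>] k by simp
  then show ?thesis using pos k by (simp add: E_kappa_kinf log_mult)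
qed

text \<open>The state \<open>S\<^sup>\<Gamma> / tr S\<close> is a feasible second argument: separable effects have positive
  partial transposes, so \<open>tr (\<rho> * E) = tr (\<rho>\<^sup>\<Gamma> * E\<^sup>\<Gamma>) \<le> tr (S * E\<^sup>\<Gamma>) = tr (S\<^sup>\<Gamma> * E)\<close>.\<close>

lemma D_SEP_sep_le_log_tr:
  assumes pos: "0 < dA" "0 < dB" and \<rho>: "\<rho> \<in> states (dA * dB)"
    and S: "S \<in> kset dA dB (partial_transpose dA dB \<rho>)"
  shows "D_SEP_sep dA dB \<rho> \<le> ereal (log 2 (Re (tr S)))"
proof -
  define D where "D = dA * dB"
  let ?pt = "partial_transpose dA dB"
  have SP: "S \<in> pcone dA dB" using S by (simp add: kset_def)
  define t where "t = Re (tr S)"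
  have t: "1 \<le> t" using kset_tr_ge1[OF \<rho> S] by (simp add: t_def)
  have Sc: "S \<in> carrier_mat D D" using gcone_carrier[OF SP] by (simp add: D_def)
  have \<rho>c: "\<rho> \<in> carrier_mat D D" using states_carrier[OF \<rho>] by (simp add: D_def)
  have pS: "?pt S \<in> pcone dA dB" using SP by (rule pcone_partial_transpose)
  have "tr (?pt S) = tr S" using tr_partial_transpose Sc by (simp add: D_def)
  then have \<sigma>: "complex_of_real (1 / t) \<cdot>\<^sub>m ?pt S \<in> sep_states dA dB"
    using pcone_scale_sep_states[OF pS] t by (simp add: t_def)
  have le: "D_SEP dA dB \<rho> (complex_of_real (1 / t) \<cdot>\<^sub>m ?pt S) \<le> ereal (log 2 t)"
    unfolding D_SEP_def
  proof (rule Sup_least, clarify)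
    fix k E assume povm: "sep_povm dA dB k E"
    define p where "p x = Re (tr (\<rho> * E x))" for x
    define q where "q x = Re (tr ((complex_of_real (1 / t) \<cdot>\<^sub>m ?pt S) * E x))" for x
    have E: "E x \<in> pcone dA dB" if "x < k" for x
      using povm that by (auto simp: sep_povm_def sep_cone_iff[OF pos])
    have Ec: "E x \<in> carrier_mat D D" if "x < k" for x
      using gcone_carrier[OF E[OF that]] by (simp add: D_def)
    have p0: "0 \<le> p x" if "x < k" for x
      using gcone_psd[OF E[OF that]] \<rho> by (auto simp: p_def states_def psd_tr_mult_Re_ge0)
    have pq: "p x \<le> t * q x" if x: "x < k" for x
    proof -
      have pE: "psd D (?pt (E x))" using gcone_psd[OF pcone_partial_transpose[OF E[OF x]]] by (simp add: D_def)
      have "psd D (S - ?pt \<rho>)" using S by (simp add: kset_def D_def)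
      then have "0 \<le> Re (tr (?pt (E x) * (S - ?pt \<rho>)))" using pE by (intro psd_tr_mult_Re_ge0)
      also have "tr (?pt (E x) * (S - ?pt \<rho>)) = tr (?pt (E x) * S) - tr (?pt (E x) * ?pt \<rho>)"
        using Sc by (intro tr_mult_minus[of _ D]) (auto simp: D_def)
      also have "tr (?pt (E x) * ?pt \<rho>) = tr (E x * \<rho>)"
        using tr_partial_transpose_mult[of "E x" dA dB "?pt \<rho>"] partial_transpose_twice[of \<rho> dA dB] Ec[OF x] \<rho>c
        by (simp add: D_def)
      also have "tr (E x * \<rho>) = tr (\<rho> * E x)" by (rule tr_comm[OF Ec[OF x] \<rho>c])
      also have "tr (?pt (E x) * S) = tr (E x * ?pt S)"
        using tr_partial_transpose_mult[of "E x" dA dB S] Ec[OF x] Sc by (simp add: D_def)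
      finally have le: "p x \<le> Re (tr (E x * ?pt S))" by (simp add: p_def)
      have "q x = Re (tr (E x * (complex_of_real (1 / t) \<cdot>\<^sub>m ?pt S)))"
        unfolding q_def by (subst tr_comm[OF _ Ec[OF x]]) (simp_all add: D_def)
      also have "\<dots> = Re (tr (E x * ?pt S)) / t"
        using Ec[OF x] by (simp add: tr_mult_smult[of _ D] D_def)
      finally show ?thesis using le t by simp
    qed
    have sp: "(\<Sum>x<k. p x) = 1"
    proof -
      have "tr (\<rho> * mat_sum D E k) = (\<Sum>x<k. tr (\<rho> * E x))" by (rule tr_mult_mat_sum) (use Ec \<rho>c in auto)
      then show ?thesis using povm \<rho> \<rho>c by (simp add: sep_povm_def D_def[symmetric] p_def states_def flip: Re_sum)
    qed
    have "(\<Sum>x<k. rel_ent_term (p x) (q x)) \<le> (\<Sum>x<k. ereal (p x * log 2 t))"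
    proof (rule sum_mono)
      fix x assume "x \<in> {..<k}"
      then have x: "x < k" by simp
      show "rel_ent_term (p x) (q x) \<le> ereal (p x * log 2 t)"
      proof (cases "p x = 0")
        case True
        then show ?thesis by (simp add: rel_ent_term_def)
      next
        case False
        then have pp: "0 < p x" using p0[OF x] by simp
        with pq[OF x] have "0 < t * q x" by linarith
        then have q: "0 < q x" using t by (simp add: zero_less_mult_iff)
        then have "p x / q x \<le> t" using pq[OF x] by (simp add: pos_divide_le_eq)
        then have "log 2 (p x / q x) \<le> log 2 t" using pp q t by simp
        then show ?thesis using pp q by (simp add: rel_ent_term_def)
      qed
    qed
    also have "\<dots> = ereal (log 2 t)" by (simp add: sp flip: sum_distrib_right)
    finally show "(\<Sum>x<k. rel_ent_term (Re (tr (\<rho> * E x))) (Re (tr ((complex_of_real (1 / t) \<cdot>\<^sub>m ?pt S) * E x)))) \<le> ereal (log 2 t)"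
      by (simp add: p_def q_def)
  qed
  show ?thesis unfolding D_SEP_sep_def t_def[symmetric] by (rule order.trans[OF INF_lower[where f = "D_SEP dA dB \<rho>", OF \<sigma>] le])
qed

lemma one_smult_mat [simp]: "(1::complex) \<cdot>\<^sub>m A = A"
  by (intro eq_matI) auto

lemma wpovm_singleton: "0 < f \<Longrightarrow> wpovm dA dB [(1\<^sub>m (dA * dB), f)]"
  unfolding wpovm_def using pcone_one by (simp add: wop_Cons wop_Nil)

lemma D_SEP_sep_ge0:
  assumes pos: "0 < dA" "0 < dB" and \<rho>: "\<rho> \<in> states (dA * dB)"
  shows "0 \<le> D_SEP_sep dA dB \<rho>"
proof -
  have "feas dA dB [(1\<^sub>m (dA * dB), 1)]"
    using wpovm_singleton[of 1] by (simp add: feas_def wop_Cons wop_Nil pord_def)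
  from wval_le_D_SEP_sep[OF pos this \<rho>] show ?thesis by (simp add: wval_def zero_ereal_def)
qed

text \<open>The bound by \<open>log 2 (tr S)\<close> holds for each feasible \<open>S\<close>;
  exponentiating it first lets the infimum be taken inside the logarithm.\<close>

lemma D_SEP_sep_le_E_kappa:
  assumes pos: "0 < dA" "0 < dB" and \<rho>: "\<rho> \<in> states (dA * dB)"
  shows "D_SEP_sep dA dB \<rho> \<le> ereal (E_kappa dA dB \<rho>)"
proof -
  obtain S where "S \<in> kset dA dB (partial_transpose dA dB \<rho>)" using kset_nonempty[OF \<rho>] by blast
  from D_SEP_sep_le_log_tr[OF pos \<rho> this] D_SEP_sep_ge0[OF pos \<rho>]
  obtain r where r: "D_SEP_sep dA dB \<rho> = ereal r" by (cases "D_SEP_sep dA dB \<rho>") auto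
  have "2 powr r \<le> kinf dA dB \<rho>"
  proof (rule kinf_greatest[OF \<rho>])
    fix S assume S: "S \<in> kset dA dB (partial_transpose dA dB \<rho>)"
    then have "r \<le> log 2 (Re (tr S))" using D_SEP_sep_le_log_tr[OF pos \<rho> S] r by simp
    then show "2 powr r \<le> Re (tr S)" using kset_tr_ge1[OF \<rho> S] by (simp add: le_log_iff)
  qed
  then show ?thesis unfolding r E_kappa_kinf[OF pos] using kinf_ge1[OF \<rho>] by (simp add: le_log_iff)
qed

text \<open>Fekete's lemma, with the limit identified as the infimum: the second conjunct is what
  later bounds the regularized kappa-entanglement by its one-copy value.\<close>

lemma fekete:
  fixes a :: "nat \<Rightarrow> real"
  assumes sub: "\<And>m n. 1 \<le> m \<Longrightarrow> 1 \<le> n \<Longrightarrow> a (m + n) \<le> a m + a n"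
    and low: "\<And>n. 1 \<le> n \<Longrightarrow> c * n \<le> a n"
  shows "\<exists>l. (\<lambda>n. a n / n) \<longlonglongrightarrow> l \<and> (\<forall>n\<ge>1. l \<le> a n / n)"
proof -
  define l where "l = Inf ((\<lambda>n. a n / n) ` {1..})"
  have bdd: "bdd_below ((\<lambda>n. a n / n) ` {1..})"
    using low by (intro bdd_belowI[of _ c]) (auto simp: pos_le_divide_eq)
  have le: "l \<le> a n / n" if "1 \<le> n" for n
    unfolding l_def using that by (intro cInf_lower bdd) auto
  have mult: "a (q * k + r) \<le> q * a k + a r" if "1 \<le> k" "1 \<le> r" for q k r
  proof (induction q)
    case (Suc q)
    have "a (Suc q * k + r) = a (k + (q * k + r))" by (simp add: add_ac)
    also have "\<dots> \<le> a k + a (q * k + r)" using that by (intro sub) auto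
    finally show ?case using Suc by (simp add: algebra_simps)
  qed simp
  have "(\<lambda>n. a n / n) \<longlonglongrightarrow> l"
  proof (rule LIMSEQ_I)
    fix e :: real assume e: "0 < e"
    have "\<exists>x\<in>(\<lambda>n. a n / n) ` {1..}. x < l + e / 2"
      using e unfolding l_def by (intro cInf_lessD) auto
    then obtain k where k: "1 \<le> k" "a k / k < l + e / 2" by auto
    define B where "B = Max ((\<lambda>r. a r) ` {1..k})"
    have B: "a r \<le> B" if "1 \<le> r" "r \<le> k" for r
      unfolding B_def using that by (intro Max_ge) auto
    define C where "C = \<bar>a k\<bar> + \<bar>B\<bar>"
    obtain N where N: "2 * C / e < real N" using reals_Archimedean2 by blast
    show "\<exists>no. \<forall>n\<ge>no. norm (a n / n - l) < e"
    proof (intro exI[of _ "max 1 N"] allI impI)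
      fix n assume "max 1 N \<le> n"
      then have n: "1 \<le> n" "N \<le> n" by auto
      \<comment> \<open>The shift by one puts the remainder \<open>r\<close> in \<open>1..k\<close>
        instead of \<open>0..k - 1\<close>, because nothing is assumed about
        \<open>a 0\<close>.\<close>
      define q where "q = (n - 1) div k"
      define r where "r = (n - 1) mod k + 1"
      have nqr: "n = q * k + r" using n by (simp add: q_def r_def)
      have r: "1 \<le> r" "r \<le> k" using k by (auto simp: r_def Suc_le_eq)
      have "a n \<le> q * a k + a r" unfolding nqr by (rule mult[OF k(1) r(1)])
      also have "\<dots> \<le> q * a k + B" using B[OF r] by simp
      finally have 1: "a n \<le> q * a k + B" .
      have "real q * a k = (real n - r) * (a k / k)" using k nqr by (simp add: field_simps)
      also have "\<dots> = n * (a k / k) - (r / k) * a k" by (simp add: left_diff_distrib diff_divide_distrib)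
      also have "\<dots> \<le> n * (a k / k) + \<bar>a k\<bar>"
      proof -
        have "\<bar>(r / k) * a k\<bar> \<le> 1 * \<bar>a k\<bar>" unfolding abs_mult using r k by (intro mult_right_mono) auto
        then show ?thesis by linarith
      qed
      finally have "a n \<le> n * (a k / k) + C" using 1 by (simp add: C_def)
      then have "a n / n \<le> a k / k + C / n" using n by (simp add: field_simps)
      also have "C / n < e / 2"
      proof -
        have "2 * C / e < real n" using N n by linarith
        then show ?thesis using e n by (simp add: field_simps)
      qed
      finally have "a n / n < l + e" using k by linarith
      then show "norm (a n / n - l) < e" using le[OF n(1)] by simp
    qed
  qed
  then show ?thesis using le by blast
qed

section \<open>Products of weighted measurements\<close>

definition lprod :: "nat \<Rightarrow> nat \<Rightarrow> nat \<Rightarrow> nat \<Rightarrow> (complex mat \<times> real) list \<Rightarrow> (complex mat \<times> real) list \<Rightarrow> (complex mat \<times> real) list" where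
  "lprod dA dB dA' dB' L L' = concat (map (\<lambda>(E, f). map (\<lambda>(E', f'). (bip_tensor dA dB dA' dB' E E', f * f')) L') L)"

lemma sum_list_lprod:
  fixes h :: "complex mat \<Rightarrow> real \<Rightarrow> 'a :: monoid_add"
  shows "(\<Sum>(E, f)\<leftarrow>lprod dA dB dA' dB' L L'. h E f) =
    (\<Sum>(E, f)\<leftarrow>L. \<Sum>(E', f')\<leftarrow>L'. h (bip_tensor dA dB dA' dB' E E') (f * f'))"
  by (induction L) (auto simp: lprod_def comp_def case_prod_unfold)

lemma sum_list_product:
  fixes g h :: "_ \<Rightarrow> 'a :: comm_semiring_0"
  shows "(\<Sum>x\<leftarrow>L. g x) * (\<Sum>y\<leftarrow>L'. h y) = (\<Sum>x\<leftarrow>L. \<Sum>y\<leftarrow>L'. g x * h y)"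
  by (simp add: sum_list_mult_const sum_list_const_mult)

text \<open>Multiplicative \<open>\<phi>\<close> covers the three uses: the constant 1 for
  completeness, the identity for feasibility, and powers for the Chernoff bound.\<close>

lemma wop_lprod:
  assumes "\<forall>(E, f)\<in>set L. 0 < f" "\<forall>(E, f)\<in>set L'. 0 < f"
    and \<phi>: "\<And>x y. 0 < x \<Longrightarrow> 0 < y \<Longrightarrow> \<phi> (x * y) = \<phi> x * \<phi> y"
  shows "wop ((dA * dA') * (dB * dB')) \<phi> (lprod dA dB dA' dB' L L') =
    bip_tensor dA dB dA' dB' (wop (dA * dB) \<phi> L) (wop (dA' * dB') \<phi> L')"
    (is "wop ?N _ _ = ?B")
proof (rule eq_matI)
  fix r c assume "r < dim_row ?B" "c < dim_col ?B"
  then have rc: "r < ?N" "c < ?N" by auto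
  have "wop ?N \<phi> (lprod dA dB dA' dB' L L') $$ (r, c) =
    (\<Sum>(E, f)\<leftarrow>L. \<Sum>(E', f')\<leftarrow>L'. complex_of_real (\<phi> (f * f')) * bip_tensor dA dB dA' dB' E E' $$ (r, c))"
    using rc unfolding wop_def by (simp add: sum_list_lprod)
  also have "\<dots> = (\<Sum>(E, f)\<leftarrow>L. \<Sum>(E', f')\<leftarrow>L'.
      (complex_of_real (\<phi> f) * E $$ (bi1 dB dA' dB' r, bi1 dB dA' dB' c)) *
      (complex_of_real (\<phi> f') * E' $$ (bi2 dB dA' dB' r, bi2 dB dA' dB' c)))"
  proof (intro arg_cong[of _ _ sum_list] map_cong refl, clarify, intro arg_cong[of _ _ sum_list] map_cong refl, clarify)
    fix E f E' f' assume "(E, f) \<in> set L" "(E', f') \<in> set L'"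
    then have "0 < f" "0 < f'" using assms(1,2) by auto
    then show "complex_of_real (\<phi> (f * f')) * bip_tensor dA dB dA' dB' E E' $$ (r, c) =
      complex_of_real (\<phi> f) * E $$ (bi1 dB dA' dB' r, bi1 dB dA' dB' c) *
      (complex_of_real (\<phi> f') * E' $$ (bi2 dB dA' dB' r, bi2 dB dA' dB' c))"
      by (simp add: \<phi> bip_index[OF rc])
  qed
  also have "\<dots> = ?B $$ (r, c)"
    unfolding bip_index[OF rc] wop_def using bi_less[OF rc(1)] bi_less[OF rc(2)]
    by (simp add: sum_list_product case_prod_unfold)
  finally show "wop ?N \<phi> (lprod dA dB dA' dB' L L') $$ (r, c) = ?B $$ (r, c)" .
qed auto

lemma wpovm_lprod:
  assumes pos: "0 < dB" "0 < dA'" "0 < dB'" and "wpovm dA dB L" "wpovm dA' dB' L'"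
  shows "wpovm (dA * dA') (dB * dB') (lprod dA dB dA' dB' L L')"
proof -
  have "\<forall>(E, f)\<in>set L. 0 < f" "\<forall>(E, f)\<in>set L'. 0 < f" using assms by (auto simp: wpovm_def)
  from wop_lprod[OF this, of "\<lambda>_. 1"]
  have "wop ((dA * dA') * (dB * dB')) (\<lambda>_. 1) (lprod dA dB dA' dB' L L') = 1\<^sub>m ((dA * dA') * (dB * dB'))"
    using assms by (simp add: wpovm_def bip_one[OF pos])
  moreover have "E \<in> pcone (dA * dA') (dB * dB') \<and> 0 < f" if m: "(E, f) \<in> set (lprod dA dB dA' dB' L L')" for E f
  proof -
    obtain E1 f1 E2 f2 where "(E1, f1) \<in> set L" "(E2, f2) \<in> set L'" and
      e: "E = bip_tensor dA dB dA' dB' E1 E2" "f = f1 * f2"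
      using m by (auto simp: lprod_def)
    then have "E1 \<in> pcone dA dB" "0 < f1" "E2 \<in> pcone dA' dB'" "0 < f2" using assms(4,5) by (auto simp: wpovm_def)
    then show ?thesis unfolding e using pcone_bip[OF pos] by simp
  qed
  ultimately show ?thesis unfolding wpovm_def by blast
qed

lemma pord_trans: "pord dA dB X Y \<Longrightarrow> pord dA dB Y Z \<Longrightarrow> pord dA dB X Z"
  unfolding pord_def using order_trans by blast

text \<open>The weighted operators are replaced by identities one factor at a time; at each
  replacement the other factor is separable, as the two tensoring lemmas for \<open>pord\<close>
  demand.\<close>

lemma feas_lprod:
  assumes pos: "0 < dB" "0 < dA'" "0 < dB'" and L: "feas dA dB L" "feas dA' dB' L'"
  shows "feas (dA * dA') (dB * dB') (lprod dA dB dA' dB' L L')"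
proof -
  have w: "wpovm dA dB L" "wpovm dA' dB' L'" using L by (auto simp: feas_def)
  have fpos: "\<forall>(E, f)\<in>set L. 0 < f" "\<forall>(E, f)\<in>set L'. 0 < f" using w by (auto simp: wpovm_def)
  have "pord (dA * dA') (dB * dB')
      (bip_tensor dA dB dA' dB' (wop (dA * dB) (\<lambda>f. f) L) (wop (dA' * dB') (\<lambda>f. f) L'))
      (bip_tensor dA dB dA' dB' (1\<^sub>m (dA * dB)) (wop (dA' * dB') (\<lambda>f. f) L'))"
    using L w by (intro pord_bip_left[OF pos] wop_pcone) (auto simp: feas_def wpovm_def)
  moreover have "pord (dA * dA') (dB * dB')
      (bip_tensor dA dB dA' dB' (1\<^sub>m (dA * dB)) (wop (dA' * dB') (\<lambda>f. f) L'))
      (bip_tensor dA dB dA' dB' (1\<^sub>m (dA * dB)) (1\<^sub>m (dA' * dB')))"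
    using L by (intro pord_bip_right[OF pos] pcone_one) (auto simp: feas_def)
  ultimately show ?thesis
    using wpovm_lprod[OF pos w] wop_lprod[OF fpos, of "\<lambda>f. f" dA dA' dB dB'] pord_trans
    unfolding feas_def bip_one[OF pos] by auto
qed

lemma Re_tr_mult_psd: "psd d X \<Longrightarrow> psd d Y \<Longrightarrow> tr (X * Y) = of_real (Re (tr (X * Y)))"
  using psd_tr_mult_ge0[of d X Y] by (simp add: less_eq_complex_def complex_eq_iff)

text \<open>The logarithm of a product of weights splits, and in each part the probabilities of the
  other system sum to 1.\<close>

lemma wval_lprod:
  assumes w: "wpovm dA dB L" "wpovm dA' dB' L'" and \<rho>: "\<rho> \<in> states (dA * dB)" "\<rho>' \<in> states (dA' * dB')"
  shows "wval (bip_tensor dA dB dA' dB' \<rho> \<rho>') (lprod dA dB dA' dB' L L') = wval \<rho> L + wval \<rho>' L'"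
proof -
  let ?p = "\<lambda>E. Re (tr (\<rho> * E))" and ?p' = "\<lambda>E. Re (tr (\<rho>' * E))"
  have t: "Re (tr (bip_tensor dA dB dA' dB' \<rho> \<rho>' * bip_tensor dA dB dA' dB' E E')) = ?p E * ?p' E'"
    if E: "E \<in> pcone dA dB" "E' \<in> pcone dA' dB'" for E E'
  proof -
    have "psd (dA * dB) \<rho>" "psd (dA * dB) E" using \<rho> E gcone_psd by (auto simp: states_def)
    then have e: "tr (\<rho> * E) = of_real (?p E)" by (rule Re_tr_mult_psd)
    show ?thesis
      unfolding tr_bip_mult[OF states_carrier[OF \<rho>(1)] gcone_carrier[OF E(1)] states_carrier[OF \<rho>(2)] gcone_carrier[OF E(2)]]
      by (subst e) simp
  qed
  have "wval (bip_tensor dA dB dA' dB' \<rho> \<rho>') (lprod dA dB dA' dB' L L') =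
    (\<Sum>(E, f)\<leftarrow>L. \<Sum>(E', f')\<leftarrow>L'. (?p E * log 2 f) * ?p' E' + ?p E * (?p' E' * log 2 f'))"
    unfolding wval_def sum_list_lprod
  proof (intro arg_cong[of _ _ sum_list] map_cong refl, clarify, intro arg_cong[of _ _ sum_list] map_cong refl, clarify)
    fix E f E' f' assume m: "(E, f) \<in> set L" "(E', f') \<in> set L'"
    then have E: "E \<in> pcone dA dB" "E' \<in> pcone dA' dB'" "0 < f" "0 < f'" using w by (auto simp: wpovm_def)
    show "Re (tr (bip_tensor dA dB dA' dB' \<rho> \<rho>' * bip_tensor dA dB dA' dB' E E')) * log 2 (f * f') =
      (?p E * log 2 f) * ?p' E' + ?p E * (?p' E' * log 2 f')"
      unfolding t[OF E(1,2)] using E by (simp add: log_mult algebra_simps)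
  qed
  also have "\<dots> = (\<Sum>(E, f)\<leftarrow>L. ?p E * log 2 f) * (\<Sum>(E', f')\<leftarrow>L'. ?p' E') +
      (\<Sum>(E, f)\<leftarrow>L. ?p E) * (\<Sum>(E', f')\<leftarrow>L'. ?p' E' * log 2 f')"
    by (simp add: sum_list_product case_prod_unfold sum_list_addf)
  also have "\<dots> = wval \<rho> L + wval \<rho>' L'"
    unfolding wpovm_sum_prob[OF w(1) \<rho>(1)] wpovm_sum_prob[OF w(2) \<rho>(2)] by (simp add: wval_def)
  finally show ?thesis .
qed

lemma D_SEP_sep_finite:
  assumes pos: "0 < dA" "0 < dB" and \<rho>: "\<rho> \<in> states (dA * dB)"
  shows "D_SEP_sep dA dB \<rho> = ereal (real_of_ereal (D_SEP_sep dA dB \<rho>))"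
  using D_SEP_sep_le_E_kappa[OF assms] D_SEP_sep_ge0[OF assms] by (cases "D_SEP_sep dA dB \<rho>") auto

text \<open>Near-optimal feasible lists for the two factors multiply to a feasible list; the 8 is
  twice the loss of 4 in \<open>exists_feas\<close>.\<close>

lemma D_SEP_sep_almost_superadditive:
  assumes pos: "0 < dA" "0 < dB" "0 < dA'" "0 < dB'"
    and \<rho>: "\<rho> \<in> states (dA * dB)" "\<rho>' \<in> states (dA' * dB')"
  shows "real_of_ereal (D_SEP_sep dA dB \<rho>) + real_of_ereal (D_SEP_sep dA' dB' \<rho>') - 8
    \<le> real_of_ereal (D_SEP_sep (dA * dA') (dB * dB') (bip_tensor dA dB dA' dB' \<rho> \<rho>'))"
    (is "?d + ?d' - 8 \<le> ?d''")
proof (rule field_le_epsilon)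
  fix e :: real assume e: "0 < e"
  have "ereal (?d - e / 2) < D_SEP_sep dA dB \<rho>"
    by (subst D_SEP_sep_finite[OF pos(1,2) \<rho>(1)]) (use e in simp)
  from exists_feas[OF pos(1,2) \<rho>(1) this] obtain L where L: "feas dA dB L" "?d - e / 2 - 4 \<le> wval \<rho> L" by blast
  have "ereal (?d' - e / 2) < D_SEP_sep dA' dB' \<rho>'"
    by (subst D_SEP_sep_finite[OF pos(3,4) \<rho>(2)]) (use e in simp)
  from exists_feas[OF pos(3,4) \<rho>(2) this] obtain L' where L': "feas dA' dB' L'" "?d' - e / 2 - 4 \<le> wval \<rho>' L'" by blast
  have "ereal (wval (bip_tensor dA dB dA' dB' \<rho> \<rho>') (lprod dA dB dA' dB' L L'))
     \<le> D_SEP_sep (dA * dA') (dB * dB') (bip_tensor dA dB dA' dB' \<rho> \<rho>')"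
    using pos by (intro wval_le_D_SEP_sep feas_lprod L L' states_bip \<rho>) auto
  also have "\<dots> = ereal ?d''"
    using pos \<rho> by (intro D_SEP_sep_finite states_bip) auto
  finally show "?d + ?d' - 8 \<le> ?d'' + e"
    using L L' wval_lprod[of dA dB L dA' dB' L'] \<rho> by (simp add: feas_def)
qed

section \<open>Sequences attached to the tensor powers of one state\<close>

locale bipartite_state =
  fixes dA dB :: nat and \<rho> :: "complex mat"
  assumes state: "\<rho> \<in> states (dA * dB)"
begin

text \<open>An empty matrix has trace 0, so the existence of a state excludes local dimension
  0.\<close>

lemma dims_pos: "0 < dA" "0 < dB"
proof -
  have "dA * dB \<noteq> 0"
  proof
    assume "dA * dB = 0"
    then have "tr \<rho> = 0" unfolding tr_carrier[OF states_carrier[OF state]] by (simp only: lessThan_0 sum.empty)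
    then show False using state by (simp add: states_def)
  qed
  then show "0 < dA" "0 < dB" by auto
qed

lemma dims_pow_pos: "0 < dA ^ n" "0 < dB ^ n"
  using dims_pos by auto

abbreviation \<rho>n :: "nat \<Rightarrow> complex mat" where
  "\<rho>n n \<equiv> bip_power dA dB \<rho> n"

lemma state_pow: "\<rho>n n \<in> states (dA ^ n * dB ^ n)"
  by (rule states_bip_power[OF state])

lemma \<rho>n_add: "\<rho>n (m + n) = bip_tensor (dA ^ m) (dB ^ m) (dA ^ n) (dB ^ n) (\<rho>n m) (\<rho>n n)"
  by (rule bip_power_add[OF dims_pos states_carrier[OF state]])

definition Dn :: "nat \<Rightarrow> real" where
  "Dn n = real_of_ereal (D_SEP_sep (dA ^ n) (dB ^ n) (\<rho>n n))"

definition Kn :: "nat \<Rightarrow> real" where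
  "Kn n = E_kappa (dA ^ n) (dB ^ n) (\<rho>n n)"

lemma D_SEP_sep_Dn: "D_SEP_sep (dA ^ n) (dB ^ n) (\<rho>n n) = ereal (Dn n)"
  unfolding Dn_def by (rule D_SEP_sep_finite[OF dims_pow_pos state_pow])

lemma Dn_le_Kn: "Dn n \<le> Kn n"
  using D_SEP_sep_le_E_kappa[OF dims_pow_pos state_pow, of n] by (simp add: D_SEP_sep_Dn Kn_def)

lemma Kn_subadditive: "Kn (m + n) \<le> Kn m + Kn n"
  using E_kappa_subadditive[OF dims_pow_pos dims_pow_pos state_pow state_pow, of m n]
  by (simp add: Kn_def \<rho>n_add power_add)

lemma Dn_almost_superadditive: "Dn m + Dn n - 8 \<le> Dn (m + n)"
  using D_SEP_sep_almost_superadditive[OF dims_pow_pos dims_pow_pos state_pow state_pow, of m n]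
  by (simp add: Dn_def \<rho>n_add power_add)

lemma Kn_limit:
  obtains k where "(\<lambda>n. Kn n / n) \<longlonglongrightarrow> k" "k \<le> Kn 1"
proof -
  have "\<exists>l. (\<lambda>n. Kn n / n) \<longlonglongrightarrow> l \<and> (\<forall>n\<ge>1. l \<le> Kn n / n)"
    using Kn_subadditive E_kappa_ge0[OF dims_pow_pos state_pow]
    by (intro fekete[where c = 0]) (auto simp: Kn_def)
  then show ?thesis using that by force
qed

lemma Kn_le: "1 \<le> n \<Longrightarrow> Kn n \<le> n * Kn 1"
proof (induction n rule: dec_induct)
  case (step n)
  then show ?case using Kn_subadditive[of n 1] by (simp add: algebra_simps)
qed simp

lemma Dn_limit:
  obtains l where "(\<lambda>n. Dn n / n) \<longlonglongrightarrow> l"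
proof -
  \<comment> \<open>The constant turns superadditivity up to 8 into exact subadditivity, since it is
    counted twice on the right-hand side and once on the left.\<close>
  define a where "a n = 8 - Dn n" for n
  have "\<exists>l. (\<lambda>n. a n / n) \<longlonglongrightarrow> l \<and> (\<forall>n\<ge>1. l \<le> a n / n)"
  proof (rule fekete[where c = "- Kn 1"])
    show "a (m + n) \<le> a m + a n" for m n using Dn_almost_superadditive[of m n] by (simp add: a_def)
    show "- Kn 1 * real n \<le> a n" if "1 \<le> n" for n
      using Dn_le_Kn[of n] Kn_le[OF that] by (simp add: a_def mult.commute)
  qed
  then obtain l where l: "(\<lambda>n. a n / n) \<longlonglongrightarrow> l" by blast
  have "(\<lambda>n. 8 / real n) \<longlonglongrightarrow> 0" by (rule lim_const_over_n)
  from tendsto_diff[OF this l] have "(\<lambda>n. 8 / real n - a n / real n) \<longlonglongrightarrow> 0 - l" .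
  moreover have "8 / real n - a n / real n = Dn n / n" for n by (simp add: a_def diff_divide_distrib)
  ultimately show ?thesis using that by simp
qed

end

section \<open>The maximally entangled state and the converse\<close>

lemma tr_smult_mult:
  assumes "X \<in> carrier_mat d d" "Y \<in> carrier_mat d d"
  shows "tr ((c \<cdot>\<^sub>m X) * Y) = c * tr (X * Y)"
  using assms by (simp add: mult_smult_assoc_mat[of _ d d _ d] tr_smult[of _ d])

lemma tr_add_mult:
  assumes "X \<in> carrier_mat d d" "Y \<in> carrier_mat d d" "Z \<in> carrier_mat d d"
  shows "tr ((X + Y) * Z) = tr (X * Z) + tr (Y * Z)"
  using assms by (simp add: add_mult_distrib_mat[of _ d d] tr_add[of _ d])

text \<open>The maximally entangled vector of local dimension \<open>d\<close>.\<close>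

definition mes_vec :: "nat \<Rightarrow> nat \<Rightarrow> complex" where
  "mes_vec d r = (if r div d = r mod d then complex_of_real (1 / sqrt (real d)) else 0)"

definition mes :: "nat \<Rightarrow> complex mat" where
  "mes d = prj (d * d) (mes_vec d)"

lemma mes_carrier [simp]: "mes d \<in> carrier_mat (d * d) (d * d)"
  by (simp add: mes_def)

lemma mes_dim [simp]: "dim_row (mes d) = d * d" "dim_col (mes d) = d * d"
  by (simp_all add: mes_def)

lemma mes_index:
  assumes "0 < d" "r < d * d" "c < d * d"
  shows "mes d $$ (r, c) = (if r div d = r mod d \<and> c div d = c mod d then 1 / of_nat d else 0)"
proof -
  have "complex_of_real (1 / sqrt (real d)) * complex_of_real (1 / sqrt (real d)) = complex_of_real (1 / real d)"
    unfolding of_real_mult[symmetric] using assms by (simp add: real_div_sqrt)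
  then show ?thesis using assms by (simp add: mes_def mes_vec_def)
qed

lemma Phi2_mes: "Phi2 = prj 4 (mes_vec 2)"
proof -
  have e: "phi_vec $ i = mes_vec 2 i" if "i < 4" for i
  proof -
    have "i \<in> {0, 1, 2, 3}" using that by auto
    then show ?thesis by (auto simp: phi_vec_def mes_vec_def)
  qed
  show ?thesis unfolding Phi2_def prj_def by (intro cong_mat refl) (simp add: e)
qed

text \<open>Composite indices agree exactly if both of their components do, so the diagonal vectors
  \<open>|a a>\<close> of the factors multiply to those of the larger dimension.\<close>

lemma bip_power_Phi2: "bip_power 2 2 Phi2 m = mes (2 ^ m)"
proof (induction m)
  case 0
  show ?case by (intro eq_matI) (auto simp: mes_def mes_vec_def)
next
  case (Suc m)
  have "tv (2 ^ m) 2 2 (mes_vec (2 ^ m)) (mes_vec 2) = mes_vec (2 ^ m * 2)"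
  proof
    fix r :: nat
    have pos: "0 < (2::nat) ^ m" "0 < (2::nat)" by auto
    obtain a a' b b' where r: "r = (a * 2 + a') * (2 ^ m * 2) + (b * 2 + b')" "a' < 2" "b < 2 ^ m" "b' < 2"
      using bi_cases[OF pos(1) pos(2) pos(2), of r] by blast
    have l: "b * 2 + b' < 2 ^ m * 2" using r by simp
    have i: "a * 2 + a' = b * 2 + b' \<longleftrightarrow> a = b \<and> a' = b'" using r by presburger
    have q: "complex_of_real (1 / sqrt (real (2 ^ m))) * complex_of_real (1 / sqrt (real 2)) = complex_of_real (1 / sqrt (real (2 ^ m * 2)))"
      by (simp add: real_sqrt_mult)
    show "tv (2 ^ m) 2 2 (mes_vec (2 ^ m)) (mes_vec 2) r = mes_vec (2 ^ m * 2) r"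
      unfolding r(1) tv_def bi_enc[OF r(2-4)] mes_vec_def
      unfolding div_mod_mult_add[OF r(3)] div_mod_mult_add[OF r(4)] div_mod_mult_add[OF l] i
      using q by auto
  qed
  moreover have "bip_power 2 2 Phi2 (Suc m) = bip_tensor (2 ^ m) (2 ^ m) 2 2 (prj (2 ^ m * 2 ^ m) (mes_vec (2 ^ m))) (prj (2 * 2) (mes_vec 2))"
    using Suc by (simp add: mes_def Phi2_mes)
  ultimately show ?case unfolding bip_prj by (simp add: mes_def mult.commute)
qed

lemma ip_pv: "ip (dA * dB) (pv dB a b) (pv dB a' b') = ip dA a a' * ip dB b b'"
proof -
  have "ip (dA * dB) (pv dB a b) (pv dB a' b') = (\<Sum>i<dA. \<Sum>j<dB. (cnj (a i) * a' i) * (cnj (b j) * b' j))"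
    unfolding ip_def sum_mult_index by (intro sum.cong refl) (simp add: pv_def)
  then show ?thesis by (simp add: ip_def sum_product)
qed

text \<open>Up to \<open>1 / sqrt d\<close>, the overlap of \<open>|a>|b>\<close> with the maximally
  entangled vector is the inner product of the conjugate of \<open>a\<close> with \<open>b\<close>,
  so the Cauchy-Schwarz inequality bounds it.\<close>

lemma pord_mes:
  assumes d: "0 < d"
  shows "pord d d (mes d) (complex_of_real (1 / real d) \<cdot>\<^sub>m 1\<^sub>m (d * d))"
  unfolding pord_def
proof
  fix u assume "u \<in> pvs d"
  then obtain a b where u: "u = pv d a b" by (auto simp: pvs_def)
  let ?A = "\<Sum>i<d. (cmod (a i))\<^sup>2" and ?B = "\<Sum>i<d. (cmod (b i))\<^sup>2"
  have "ip (d * d) (mes_vec d) u = (\<Sum>i<d. \<Sum>j<d. if i = j then complex_of_real (1 / sqrt d) * (a i * b j) else 0)"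
    unfolding ip_def sum_mult_index by (intro sum.cong refl) (auto simp: mes_vec_def u pv_def)
  also have "\<dots> = complex_of_real (1 / sqrt d) * ip d (\<lambda>i. cnj (a i)) b"
    by (simp add: ip_def sum_distrib_left)
  finally have "(cmod (ip (d * d) (mes_vec d) u))\<^sup>2 = (cmod (ip d (\<lambda>i. cnj (a i)) b))\<^sup>2 / d"
    using d by (simp add: norm_mult norm_divide power_mult_distrib power_divide)
  also have "\<dots> \<le> ?A * ?B / d"
    using cauchy_schwarz_ip[of d "\<lambda>i. cnj (a i)" b] by (intro divide_right_mono) auto
  finally have le: "(cmod (ip (d * d) (mes_vec d) u))\<^sup>2 \<le> ?A * ?B / d" .
  have "quad (d * d) (complex_of_real (1 / real d) \<cdot>\<^sub>m 1\<^sub>m (d * d)) u = complex_of_real (?A * ?B / d)"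
    unfolding quad_smult[OF one_carrier_mat] quad_one u unfolding ip_pv unfolding ip_self by simp
  then show "quad (d * d) (mes d) u \<le> quad (d * d) (complex_of_real (1 / real d) \<cdot>\<^sub>m 1\<^sub>m (d * d)) u"
    using le unfolding mes_def quad_prj by (simp only: less_eq_complex_def Re_complex_of_real Im_complex_of_real)
qed

lemma psd_mes: "psd (d * d) (mes d)"
  unfolding psd_iff mes_def using quad_prj_ge0 by simp

lemma ip_mes_vec: "0 < d \<Longrightarrow> ip (d * d) (mes_vec d) (mes_vec d) = 1"
proof -
  assume d: "0 < d"
  have "ip (d * d) (mes_vec d) (mes_vec d) = (\<Sum>i<d. \<Sum>j<d. if i = j then complex_of_real (1 / real d) else 0)"
    unfolding ip_def sum_mult_index
  proof (intro sum.cong refl)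
    fix i j assume "i \<in> {..<d}" "j \<in> {..<d}"
    moreover have "complex_of_real (1 / sqrt (real d)) * complex_of_real (1 / sqrt (real d)) = complex_of_real (1 / real d)"
      unfolding of_real_mult[symmetric] using d by (simp add: real_div_sqrt)
    ultimately show "cnj (mes_vec d (i * d + j)) * mes_vec d (i * d + j) = (if i = j then complex_of_real (1 / real d) else 0)"
      by (simp add: mes_vec_def)
  qed
  then show ?thesis using d by simp
qed

lemma tr_mes: "0 < d \<Longrightarrow> tr (mes d) = 1"
  by (simp add: mes_def tr_prj ip_mes_vec)

lemma tr_mes_mes: "0 < d \<Longrightarrow> tr (mes d * mes d) = 1"
  using tr_mult_prj[OF mes_carrier, of d "mes_vec d"] unfolding mes_def quad_prj by (simp add: ip_mes_vec)

lemma pcone_diag: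
  assumes h: "\<And>k. 0 \<le> h k"
  shows "mat (dA * dB) (dA * dB) (\<lambda>(i, j). if i = j then complex_of_real (h i) else 0) \<in> pcone dA dB"
proof -
  define u where "u k = (\<lambda>i. complex_of_real (sqrt (h k)) * pv dB (\<lambda>x. if x = k div dB then 1 else 0) (\<lambda>x. if x = k mod dB then 1 else 0) i)" for k :: nat
  have e: "i div dB = k div dB \<and> i mod dB = k mod dB \<longleftrightarrow> i = k" for i k by (metis div_mult_mod_eq)
  have u: "u k i = (if i = k then complex_of_real (sqrt (h k)) else 0)" for k i
    using e[of i k] unfolding u_def pv_def by auto
  have "mat (dA * dB) (dA * dB) (\<lambda>(i, j). if i = j then complex_of_real (h i) else 0) =
      mat (dA * dB) (dA * dB) (\<lambda>(i, j). \<Sum>k<dA * dB. u k i * cnj (u k j))"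
  proof (rule eq_matI)
    fix i j assume "i < dim_row (mat (dA * dB) (dA * dB) (\<lambda>(i, j). \<Sum>k<dA * dB. u k i * cnj (u k j)))"
      "j < dim_col (mat (dA * dB) (dA * dB) (\<lambda>(i, j). \<Sum>k<dA * dB. u k i * cnj (u k j)))"
    then have ij: "i < dA * dB" "j < dA * dB" by auto
    have "(\<Sum>k<dA * dB. u k i * cnj (u k j)) = u i i * cnj (u i j)"
      by (rule sum_one_point[OF ij(1)]) (simp add: u)
    moreover have "complex_of_real (sqrt (h i)) * complex_of_real (sqrt (h i)) = complex_of_real (h i)"
      unfolding of_real_mult[symmetric] using h by simp
    ultimately show "mat (dA * dB) (dA * dB) (\<lambda>(i, j). if i = j then complex_of_real (h i) else 0) $$ (i, j) =
       mat (dA * dB) (dA * dB) (\<lambda>(i, j). \<Sum>k<dA * dB. u k i * cnj (u k j)) $$ (i, j)"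
      using ij by (cases "i = j") (simp_all add: u)
  qed auto
  also have "\<dots> \<in> pcone dA dB" by (rule gcone_sum_prj) (auto simp: u_def intro: pvs_scale)
  finally show ?thesis .
qed

text \<open>Orthogonality of characters; the bound on \<open>z\<close> excludes the nonzero
  multiples of \<open>N\<close>.\<close>

lemma sum_cis_roots:
  fixes z :: int
  assumes "\<bar>z\<bar> < int N"
  shows "(\<Sum>s<N. cis (2 * pi * z / N) ^ s) = (if z = 0 then of_nat N else 0)"
proof (cases "z = 0")
  case False
  let ?x = "cis (2 * pi * z / N)"
  have N: "0 < N" using assms by simp
  have "?x \<noteq> 1"
  proof
    assume "?x = 1"
    then have "cos (2 * pi * z / N) = 1" by (simp add: complex_eq_iff)
    then obtain n :: int where "2 * pi * z / N = n * 2 * pi" using cos_one_2pi_int by auto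
    then have "real_of_int z = real_of_int n * N" using N by (simp add: field_simps)
    then have "z = n * int N" by (metis of_int_eq_iff of_int_mult of_int_of_nat_eq)
    then have "\<bar>n\<bar> * int N < int N" "n \<noteq> 0" using assms False by (auto simp: abs_mult)
    then show False using N by (simp add: mult_less_cancel_right2)
  qed
  moreover have "?x ^ N = 1"
  proof -
    have "?x ^ N = cis (2 * pi * z)" using N by (simp add: DeMoivre)
    also have "\<dots> = 1" by (simp add: cis_multiple_2pi)
    finally show ?thesis .
  qed
  ultimately show ?thesis using False geometric_sum[of ?x N] by simp
qed simp

text \<open>In base \<open>2 * d\<close> the number \<open>2 * d * a\<^sup>2 + a\<close> has
  \<open>a\<close> as last digit, and adding two such digits produces no carry. Equal sums thus have
  equal sums of the numbers and of their squares, and these determine an unordered pair.\<close>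

lemma sidon:
  fixes a b a' b' d :: nat
  assumes "a < d" "b < d" "a' < d" "b' < d"
    and eq: "(2 * d * a\<^sup>2 + a) + (2 * d * b'\<^sup>2 + b') = (2 * d * b\<^sup>2 + b) + (2 * d * a'\<^sup>2 + a')"
  shows "(a = b \<and> a' = b') \<or> (a = a' \<and> b = b')"
proof -
  have l: "a + b' < 2 * d" "b + a' < 2 * d" using assms by auto
  have e: "(a\<^sup>2 + b'\<^sup>2) * (2 * d) + (a + b') = (b\<^sup>2 + a'\<^sup>2) * (2 * d) + (b + a')"
    using eq by (simp add: algebra_simps)
  have s: "a + b' = b + a'" using arg_cong[OF e, of "\<lambda>x. x mod (2 * d)"] l by (simp only: div_mod_mult_add)
  have q: "a\<^sup>2 + b'\<^sup>2 = b\<^sup>2 + a'\<^sup>2" using arg_cong[OF e, of "\<lambda>x. x div (2 * d)"] l by (simp only: div_mod_mult_add)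
  have s': "int a - int b = int a' - int b'" using s by linarith
  have "(int a)\<^sup>2 + (int b')\<^sup>2 = (int b)\<^sup>2 + (int a')\<^sup>2" using arg_cong[OF q, of int] by simp
  then have "(int a - int b) * (int a + int b) = (int a' - int b') * (int a' + int b')"
    by (simp add: power2_eq_square algebra_simps)
  then have "(int a - int b) * (int a + int b - (int a' + int b')) = 0" by (simp add: s' algebra_simps)
  then have "int a = int b \<or> int a + int b = int a' + int b'" by auto
  then show ?thesis using s' by auto
qed

text \<open>Averaging \<open>|u><u| \<otimes> |\<chi> u\<^sup>*><\<chi> u\<^sup>*|\<close> over vectors \<open>u\<close> of roots of unity with Sidon exponents
  kills all matrix entries except those on the diagonal and between the \<open>|a a>\<close>.\<close>

lemma pcone_phase_average:
  fixes \<chi> :: "nat \<Rightarrow> complex"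
  assumes d: "0 < d"
  shows "mat (d * d) (d * d) (\<lambda>(r, c). if r = c \<or> (r div d = r mod d \<and> c div d = c mod d)
    then \<chi> (r mod d) * cnj (\<chi> (c mod d)) else 0) \<in> pcone d d" (is "?M \<in> _")
proof -
  define g where "g a = 2 * d * a\<^sup>2 + a" for a :: nat
  \<comment> \<open>The exponent \<open>z\<close> below combines four values of \<open>g\<close>,
    two with each sign, so it stays below \<open>N\<close> in modulus and the average over the roots
    of unity vanishes exactly if \<open>z \<noteq> 0\<close>.\<close>
  define N where "N = 2 * g d + 1"
  have N0: "N \<noteq> 0" by (simp add: N_def)
  define \<theta> where "\<theta> a = 2 * pi * g a / N" for a
  define u where "u s = pv d (\<lambda>a. cis (s * \<theta> a)) (\<lambda>b. \<chi> b * cis (- (s * \<theta> b)))" for s :: nat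
  have gle: "g a \<le> g d" if "a < d" for a
    unfolding g_def using that by (intro add_mono mult_le_mono power_mono) auto
  define A where "A = mat (d * d) (d * d) (\<lambda>(r, c). \<Sum>s<N. u s r * cnj (u s c))"
  have A: "A \<in> pcone d d" unfolding A_def by (rule gcone_sum_prj) (simp add: u_def)
  have "?M = complex_of_real (1 / real N) \<cdot>\<^sub>m A"
  proof (rule eq_matI)
    fix r c assume "r < dim_row (complex_of_real (1 / real N) \<cdot>\<^sub>m A)" "c < dim_col (complex_of_real (1 / real N) \<cdot>\<^sub>m A)"
    then have rc: "r < d * d" "c < d * d" by (auto simp: A_def)
    define a b a' b' where ab: "a = r div d" "b = r mod d" "a' = c div d" "b' = c mod d"
    have lt: "a < d" "b < d" "a' < d" "b' < d" using div_mod_less[OF rc(1)] div_mod_less[OF rc(2)] by (auto simp: ab)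
    define z where "z = int (g a) - int (g b) - int (g a') + int (g b')"
    have z: "\<bar>z\<bar> < int N"
      using gle[OF lt(1)] gle[OF lt(2)] gle[OF lt(3)] gle[OF lt(4)] unfolding z_def N_def by linarith
    have "u s r * cnj (u s c) = (\<chi> b * cnj (\<chi> b')) * cis (2 * pi * z / N) ^ s" for s
    proof -
      have "u s r * cnj (u s c) = (\<chi> b * cnj (\<chi> b')) *
          (cis (s * \<theta> a) * cis (- (s * \<theta> b)) * (cis (- (s * \<theta> a')) * cis (s * \<theta> b')))"
        by (simp add: u_def pv_def ab cis_cnj mult_ac)
      also have "cis (s * \<theta> a) * cis (- (s * \<theta> b)) * (cis (- (s * \<theta> a')) * cis (s * \<theta> b')) =
          cis (s * (\<theta> a - \<theta> b - \<theta> a' + \<theta> b'))"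
        unfolding cis_mult by (rule arg_cong[of _ _ cis]) (simp add: algebra_simps)
      also have "\<theta> a - \<theta> b - \<theta> a' + \<theta> b' = 2 * pi * z / N"
        by (simp add: \<theta>_def z_def diff_divide_distrib add_divide_distrib algebra_simps)
      also have "cis (s * (2 * pi * z / N)) = cis (2 * pi * z / N) ^ s" by (rule DeMoivre[symmetric])
      finally show ?thesis .
    qed
    then have "(\<Sum>s<N. u s r * cnj (u s c)) = (\<chi> b * cnj (\<chi> b')) * (if z = 0 then of_nat N else 0)"
      by (simp only: sum_distrib_left[symmetric] sum_cis_roots[OF z])
    then have e: "(complex_of_real (1 / real N) \<cdot>\<^sub>m A) $$ (r, c) = (if z = 0 then \<chi> b * cnj (\<chi> b') else 0)"
      using rc N0 by (simp add: A_def)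
    have "z = 0 \<longleftrightarrow> g a + g b' = g b + g a'" unfolding z_def by linarith
    also have "\<dots> \<longleftrightarrow> (a = b \<and> a' = b') \<or> (a = a' \<and> b = b')"
      using sidon[OF lt] unfolding g_def by auto
    also have "a = a' \<and> b = b' \<longleftrightarrow> r = c" unfolding ab by (metis div_mult_mod_eq)
    finally show "?M $$ (r, c) = (complex_of_real (1 / real N) \<cdot>\<^sub>m A) $$ (r, c)"
      unfolding e using rc by (auto simp: ab)
  qed (auto simp: A_def)
  then show ?thesis using pcone_smult[OF A, of "1 / real N"] by simp
qed

text \<open>With trivial \<open>\<chi>\<close> the phase average is \<open>d \<Phi>\<close> plus the
  projections on \<open>|a b>\<close> with \<open>a \<noteq> b\<close>; the missing
  \<open>|a a>\<close> are added as a diagonal.\<close>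

lemma pcone_one_plus_mes:
  assumes d: "0 < d"
  shows "1\<^sub>m (d * d) + complex_of_real (real d) \<cdot>\<^sub>m mes d \<in> pcone d d"
proof -
  have "1\<^sub>m (d * d) + complex_of_real (real d) \<cdot>\<^sub>m mes d =
    mat (d * d) (d * d) (\<lambda>(r, c). if r = c \<or> (r div d = r mod d \<and> c div d = c mod d) then 1 * cnj 1 else 0) +
    mat (d * d) (d * d) (\<lambda>(r, c). if r = c then complex_of_real (if r div d = r mod d then 1 else 0) else 0)"
    (is "?L = ?A + ?B")
  proof (rule eq_matI)
    fix r c assume "r < dim_row (?A + ?B)" "c < dim_col (?A + ?B)"
    then have "r < d * d" "c < d * d" by auto
    then show "?L $$ (r, c) = (?A + ?B) $$ (r, c)"
      using d by (auto simp: mes_index)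
  qed (auto simp: mes_def)
  also have "\<dots> \<in> pcone d d"
    by (intro gcone_add pcone_phase_average[OF d, of "\<lambda>_. 1"] pcone_diag) auto
  finally show ?thesis .
qed

text \<open>Summing the phase averages over the nontrivial characters \<open>\<chi>\<close> of \<open>\<int>/d\<close> gives \<open>-1\<close>
  between different \<open>|a a>\<close>.\<close>

lemma pcone_one_minus_mes:
  assumes d: "0 < d"
  shows "1\<^sub>m (d * d) - mes d \<in> pcone d d"
proof -
  define \<chi> where "\<chi> t b = cis (2 * pi * b / d) ^ t" for t b :: nat
  define M where "M t = mat (d * d) (d * d) (\<lambda>(r, c). if r = c \<or> (r div d = r mod d \<and> c div d = c mod d)
    then \<chi> t (r mod d) * cnj (\<chi> t (c mod d)) else 0)" for t
  have M: "M t \<in> pcone d d" for t unfolding M_def by (rule pcone_phase_average[OF d])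
  \<comment> \<open>On \<open>|a b>\<close> with \<open>a \<noteq> b\<close> the
    \<open>d - 1\<close> averages sum to \<open>d - 1\<close>, while \<open>d\<close> is wanted; on
    \<open>|a a>\<close> the value \<open>d - 1\<close> is already right.\<close>
  define B where "B = mat (d * d) (d * d) (\<lambda>(r, c). if r = c then complex_of_real (if r div d = r mod d then 0 else 1) else 0)"
  have B: "B \<in> pcone d d" unfolding B_def by (rule pcone_diag) auto
  have S: "mat_sum (d * d) (\<lambda>t. M (Suc t)) (d - 1) \<in> pcone d d" by (rule gcone_mat_sum) (rule M)
  have "complex_of_real (real d) \<cdot>\<^sub>m (1\<^sub>m (d * d) - mes d) = mat_sum (d * d) (\<lambda>t. M (Suc t)) (d - 1) + B"
    (is "?L = ?R")
  proof (rule eq_matI)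
    fix r c assume "r < dim_row ?R" "c < dim_col ?R"
    then have rc: "r < d * d" "c < d * d" by (auto simp: B_def)
    define a b a' b' where ab: "a = r div d" "b = r mod d" "a' = c div d" "b' = c mod d"
    have lt: "a < d" "b < d" "a' < d" "b' < d" using div_mod_less[OF rc(1)] div_mod_less[OF rc(2)] by (auto simp: ab)
    define z where "z = int b - int b'"
    have z: "\<bar>z\<bar> < int d" using lt by (simp add: z_def)
    have \<chi>: "\<chi> t b * cnj (\<chi> t b') = cis (2 * pi * z / d) ^ t" for t
    proof -
      have "cis (2 * pi * b / d) * cnj (cis (2 * pi * b' / d)) = cis (2 * pi * z / d)"
        unfolding cis_cnj cis_mult by (rule arg_cong[of _ _ cis]) (simp add: z_def diff_divide_distrib algebra_simps)
      then show ?thesis unfolding \<chi>_def by (simp add: power_mult_distrib[symmetric])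
    qed
    have "(\<Sum>t<d. \<chi> t b * cnj (\<chi> t b')) = (\<Sum>t<Suc (d - 1). \<chi> t b * cnj (\<chi> t b'))" using d by simp
    also have "\<dots> = \<chi> 0 b * cnj (\<chi> 0 b') + (\<Sum>t<d - 1. \<chi> (Suc t) b * cnj (\<chi> (Suc t) b'))"
      by (rule sum.lessThan_Suc_shift)
    finally have s: "(\<Sum>t<d - 1. \<chi> (Suc t) b * cnj (\<chi> (Suc t) b')) = (if b = b' then of_nat d else 0) - 1"
      unfolding \<chi> sum_cis_roots[OF z] by (simp add: z_def algebra_simps split: if_splits)
    have m: "mat_sum (d * d) (\<lambda>t. M (Suc t)) (d - 1) $$ (r, c) =
       (if r = c \<or> (a = b \<and> a' = b') then (if b = b' then of_nat d else 0) - 1 else 0)"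
    proof -
      define Q where "Q \<longleftrightarrow> r = c \<or> (a = b \<and> a' = b')"
      have "M (Suc t) $$ (r, c) = (if Q then \<chi> (Suc t) b * cnj (\<chi> (Suc t) b') else 0)" for t
        using rc by (simp add: M_def Q_def ab)
      then have "mat_sum (d * d) (\<lambda>t. M (Suc t)) (d - 1) $$ (r, c) =
          (if Q then \<Sum>t<d - 1. \<chi> (Suc t) b * cnj (\<chi> (Suc t) b') else 0)"
        using rc by (cases Q) (simp_all add: mat_sum_def)
      then show ?thesis unfolding s unfolding Q_def .
    qed
    have eqrc: "r = c \<longleftrightarrow> a = a' \<and> b = b'" unfolding ab by (metis div_mult_mod_eq)
    have "?L $$ (r, c) = of_nat d * ((if r = c then 1 else 0) - (if a = b \<and> a' = b' then 1 / of_nat d else 0))"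
      using rc d by (auto simp: mes_index ab)
    also have "\<dots> = of_nat d * (if r = c then 1 else 0) - (if a = b \<and> a' = b' then 1 else 0)"
      using d by (simp add: right_diff_distrib)
    also have "\<dots> = ?R $$ (r, c)"
    proof -
      have "?R $$ (r, c) = (if r = c \<or> (a = b \<and> a' = b') then (if b = b' then of_nat d else 0) - 1 else 0) +
          (if r = c then (if a = b then 0 else 1) else 0)"
        using rc m by (simp add: B_def ab)
      then show ?thesis unfolding eqrc by auto
    qed
    finally show "?L $$ (r, c) = ?R $$ (r, c)" .
  qed (auto simp: B_def mes_def)
  then have "complex_of_real (real d) \<cdot>\<^sub>m (1\<^sub>m (d * d) - mes d) \<in> pcone d d" using gcone_add[OF S B] by simp
  from pcone_smult[OF this, of "1 / real d"]
  have "complex_of_real (1 / real d) \<cdot>\<^sub>m (complex_of_real (real d) \<cdot>\<^sub>m (1\<^sub>m (d * d) - mes d)) \<in> pcone d d" by simp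
  moreover have "complex_of_real (1 / real d) \<cdot>\<^sub>m (complex_of_real (real d) \<cdot>\<^sub>m (1\<^sub>m (d * d) - mes d)) = 1\<^sub>m (d * d) - mes d"
    using d by (intro eq_matI) (auto simp: mes_def)
  ultimately show ?thesis by simp
qed

section \<open>Adjoints of linear maps and the converse bound\<close>

definition unit_mat :: "nat \<Rightarrow> nat \<Rightarrow> nat \<Rightarrow> complex mat" where
  "unit_mat d i j = mat d d (\<lambda>(k, l). if k = i \<and> l = j then 1 else 0)"

lemma unit_mat_carrier [simp]: "unit_mat d i j \<in> carrier_mat d d"
  by (simp add: unit_mat_def)

lemma tr_mult_unit_mat:
  assumes "Z \<in> carrier_mat d d" "i < d" "j < d"
  shows "tr (Z * unit_mat d j i) = Z $$ (i, j)"
proof -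
  have "tr (Z * unit_mat d j i) = (\<Sum>k<d. \<Sum>l<d. if l = j then if k = i then Z $$ (k, l) else 0 else 0)"
    unfolding tr_mult[OF assms(1) unit_mat_carrier] by (intro sum.cong refl) (auto simp: unit_mat_def)
  also have "\<dots> = Z $$ (i, j)" using assms by simp
  finally show ?thesis .
qed

lemma linear_map_unit_mat_expansion:
  assumes lin: "linear_map d d' \<Xi>" and X: "X \<in> carrier_mat d' d'" and Y: "Y \<in> carrier_mat d d"
  shows "tr (X * \<Xi> Y) = (\<Sum>i<d. \<Sum>j<d. Y $$ (i, j) * tr (X * \<Xi> (unit_mat d i j)))"
proof -
  define R where "R A = mat d d (\<lambda>(i, j). if (i, j) \<in> A then Y $$ (i, j) else 0)" for A
  have Rc: "R A \<in> carrier_mat d d" for A by (simp add: R_def)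
  have Xc: "\<Xi> Z \<in> carrier_mat d' d'" if "Z \<in> carrier_mat d d" for Z
    using lin that by (simp add: linear_map_def)
  have exp: "tr (X * \<Xi> (R A)) = (\<Sum>(i, j)\<in>A. Y $$ (i, j) * tr (X * \<Xi> (unit_mat d i j)))"
    if "finite A" "A \<subseteq> {..<d} \<times> {..<d}" for A
    using that
  proof (induction A rule: finite_induct)
    case empty
    have "R {} = 0 \<cdot>\<^sub>m R {}" by (intro eq_matI) (auto simp: R_def)
    then have "\<Xi> (R {}) = 0 \<cdot>\<^sub>m \<Xi> (R {})" using lin Rc[of "{}"] unfolding linear_map_def by metis
    then have "tr (X * \<Xi> (R {})) = 0 * tr (X * \<Xi> (R {}))"
      using tr_mult_smult[OF X Xc[OF Rc[of "{}"]], of 0] by metis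
    then show ?case by simp
  next
    case (insert p A)
    obtain i j where p: "p = (i, j)" by (cases p)
    have "R (insert p A) = R A + Y $$ (i, j) \<cdot>\<^sub>m unit_mat d i j"
      using insert p by (intro eq_matI) (auto simp: R_def unit_mat_def)
    then have "\<Xi> (R (insert p A)) = \<Xi> (R A) + Y $$ (i, j) \<cdot>\<^sub>m \<Xi> (unit_mat d i j)"
      using lin Rc[of A] unfolding linear_map_def by (simp add: smult_carrier_mat)
    then show ?case
      using insert p Xc[OF Rc] Xc[OF unit_mat_carrier] X
      by (simp add: tr_mult_add[of _ d'] tr_mult_smult[of _ d'])
  qed
  have "tr (X * \<Xi> (R ({..<d} \<times> {..<d}))) =
      (\<Sum>(i, j)\<in>{..<d} \<times> {..<d}. Y $$ (i, j) * tr (X * \<Xi> (unit_mat d i j)))"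
    by (intro exp) auto
  moreover have "R ({..<d} \<times> {..<d}) = Y"
  proof (rule eq_matI)
    show "R ({..<d} \<times> {..<d}) $$ (i, j) = Y $$ (i, j)" if "i < dim_row Y" "j < dim_col Y" for i j
      using that carrier_matD[OF Y] by (simp add: R_def)
  qed (simp_all add: R_def carrier_matD[OF Y])
  ultimately have "tr (X * \<Xi> Y) = (\<Sum>(i, j)\<in>{..<d} \<times> {..<d}. Y $$ (i, j) * tr (X * \<Xi> (unit_mat d i j)))"
    by simp
  then show ?thesis by (simp add: sum.cartesian_product)
qed

text \<open>Pairing with matrix units recovers every entry, which gives the uniqueness that the
  \<open>THE\<close> in \<open>adjoint_map\<close> asks for.\<close>

lemma adjoint_map_eq:
  assumes Z: "Z \<in> carrier_mat d d" and eq: "\<And>Y. Y \<in> carrier_mat d d \<Longrightarrow> tr (X * \<Xi> Y) = tr (Z * Y)"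
  shows "adjoint_map d d' \<Xi> X = Z"
  unfolding adjoint_map_def
proof (rule the_equality)
  fix Z' assume Z': "Z' \<in> carrier_mat d d \<and> (\<forall>Y\<in>carrier_mat d d. tr (X * \<Xi> Y) = tr (Z' * Y))"
  show "Z' = Z"
  proof (rule eq_matI)
    fix i j assume "i < dim_row Z" "j < dim_col Z"
    then have ij: "i < d" "j < d" using Z by auto
    have "tr (Z' * unit_mat d j i) = tr (Z * unit_mat d j i)" using Z' eq by (metis unit_mat_carrier)
    then show "Z' $$ (i, j) = Z $$ (i, j)" using tr_mult_unit_mat ij Z Z' by metis
  qed (use Z Z' in auto)
qed (use assms in auto)

lemma adjoint_map_correct:
  assumes lin: "linear_map d d' \<Xi>" and X: "X \<in> carrier_mat d' d'"
  shows "adjoint_map d d' \<Xi> X \<in> carrier_mat d d"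
    and "Y \<in> carrier_mat d d \<Longrightarrow> tr (X * \<Xi> Y) = tr (adjoint_map d d' \<Xi> X * Y)"
proof -
  define Z where "Z = mat d d (\<lambda>(i, j). tr (X * \<Xi> (unit_mat d j i)))"
  have Z: "Z \<in> carrier_mat d d" by (simp add: Z_def)
  have e: "tr (X * \<Xi> Y) = tr (Z * Y)" if Y: "Y \<in> carrier_mat d d" for Y
  proof -
    have "tr (X * \<Xi> Y) = (\<Sum>i<d. \<Sum>j<d. Z $$ (j, i) * Y $$ (i, j))"
      unfolding linear_map_unit_mat_expansion[OF lin X Y] by (intro sum.cong refl) (simp add: Z_def mult.commute)
    also have "\<dots> = tr (Z * Y)" unfolding tr_mult[OF Z Y] by (rule sum.swap)
    finally show ?thesis .
  qed
  have a: "adjoint_map d d' \<Xi> X = Z" by (rule adjoint_map_eq[OF Z e])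
  show "adjoint_map d d' \<Xi> X \<in> carrier_mat d d" unfolding a by (rule Z)
  show "tr (X * \<Xi> Y) = tr (adjoint_map d d' \<Xi> X * Y)" if "Y \<in> carrier_mat d d"
    unfolding a by (rule e[OF that])
qed

text \<open>Positivity is the case \<open>k = 1\<close> of complete positivity, where the ampliation
  is the map itself.\<close>

lemma cptp_states:
  assumes "cptp d d' \<Xi>" "\<rho> \<in> states d" shows "\<Xi> \<rho> \<in> states d'"
proof -
  have lin: "linear_map d d' \<Xi>" using assms by (simp add: cptp_def completely_positive_def)
  have \<rho>: "\<rho> \<in> carrier_mat d d" using states_carrier[OF assms(2)] .
  have X: "\<Xi> \<rho> \<in> carrier_mat d' d'" using lin \<rho> by (simp add: linear_map_def)
  have "ampliation 1 d d' \<Xi> \<rho> = \<Xi> \<rho>"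
  proof (rule eq_matI)
    fix r c assume "r < dim_row (\<Xi> \<rho>)" "c < dim_col (\<Xi> \<rho>)"
    then have rc: "r < d'" "c < d'" using X by auto
    have "mat d d (\<lambda>(i, j). \<rho> $$ (0 * d + i, 0 * d + j)) = \<rho>" using \<rho> by (intro eq_matI) auto
    then show "ampliation 1 d d' \<Xi> \<rho> $$ (r, c) = \<Xi> \<rho> $$ (r, c)" using rc by (simp add: ampliation_def)
  qed (use X in \<open>auto simp: ampliation_def\<close>)
  moreover have "psd (1 * d') (ampliation 1 d d' \<Xi> \<rho>)"
    using assms unfolding cptp_def completely_positive_def states_def by (metis mem_Collect_eq mult_1)
  ultimately show ?thesis using assms \<rho> by (simp add: states_def cptp_def)
qed

lemma DNE_trace_norm_ge0:
  assumes "\<Theta> \<in> DNE dA dB (2 ^ m) (2 ^ m)" "\<rho> \<in> states (dA * dB)"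
  shows "herm (2 ^ m * 2 ^ m) (\<Theta> \<rho> - bip_power 2 2 Phi2 m)"
    and "0 \<le> trace_norm (2 ^ m * 2 ^ m) (\<Theta> \<rho> - bip_power 2 2 Phi2 m)"
proof -
  have "\<Theta> \<rho> \<in> states (2 ^ m * 2 ^ m)" using assms by (auto simp: DNE_def intro: cptp_states)
  then show "herm (2 ^ m * 2 ^ m) (\<Theta> \<rho> - bip_power 2 2 Phi2 m)"
    unfolding bip_power_Phi2 by (intro herm_minus_psd psd_mes) (simp add: states_def)
  then show "0 \<le> trace_norm (2 ^ m * 2 ^ m) (\<Theta> \<rho> - bip_power 2 2 Phi2 m)" by (rule trace_norm_ge0)
qed

text \<open>Pulling the separable test \<open>(1 + d \<Phi>) / (d + 1)\<close>, which accepts \<open>\<Phi>\<close> with certainty and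
  separable states with probability at most \<open>2 / d\<close>, back through a DNE map yields a separable test.\<close>

lemma distillation_converse:
  assumes pos: "0 < dA" "0 < dB" and \<rho>: "\<rho> \<in> states (dA * dB)"
    and \<Theta>: "\<Theta> \<in> DNE dA dB (2 ^ m) (2 ^ m)"
    and err: "1 / 2 * trace_norm (2 ^ m * 2 ^ m) (\<Theta> \<rho> - bip_power 2 2 Phi2 m) \<le> e"
  shows "ereal ((1 - 2 * e) * real m - 3) \<le> D_SEP_sep dA dB \<rho>"
proof -
  define d where "d = (2::nat) ^ m"
  have d: "0 < d" by (simp add: d_def)
  define D where "D = dA * dB"
  have cptp: "cptp D (d * d) \<Theta>" and sep: "\<And>\<sigma>. \<sigma> \<in> sep_states dA dB \<Longrightarrow> \<Theta> \<sigma> \<in> sep_states d d"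
    and adj: "\<And>\<sigma>. \<sigma> \<in> sep_states d d \<Longrightarrow> adjoint_map D (d * d) \<Theta> \<sigma> \<in> sep_cone dA dB"
    using \<Theta> unfolding DNE_def d_def D_def by auto
  have lin: "linear_map D (d * d) \<Theta>" using cptp by (simp add: cptp_def completely_positive_def)
  have \<Theta>c: "\<Theta> Y \<in> carrier_mat (d * d) (d * d)" if "Y \<in> carrier_mat D D" for Y
    using lin that by (simp add: linear_map_def)
  have pull: "\<exists>T\<in>pcone dA dB. \<forall>Y\<in>carrier_mat D D. tr (X * \<Theta> Y) = tr (T * Y)" if X: "X \<in> pcone d d" for X
  proof -
    obtain l \<sigma> where l: "0 \<le> l" "\<sigma> \<in> sep_states d d" "X = complex_of_real l \<cdot>\<^sub>m \<sigma>"
      using X unfolding sep_cone_iff[OF d d, symmetric] unfolding sep_cone_def by blast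
    have \<sigma>c: "\<sigma> \<in> carrier_mat (d * d) (d * d)" using l(2) sep_states_states states_carrier by blast
    let ?Z = "adjoint_map D (d * d) \<Theta> \<sigma>"
    have Z: "?Z \<in> pcone dA dB" using adj[OF l(2)] sep_cone_iff[OF pos] by blast
    have "tr (X * \<Theta> Y) = tr ((complex_of_real l \<cdot>\<^sub>m ?Z) * Y)" if Y: "Y \<in> carrier_mat D D" for Y
    proof -
      have "tr (X * \<Theta> Y) = complex_of_real l * tr (\<sigma> * \<Theta> Y)"
        unfolding l(3) by (rule tr_smult_mult[OF \<sigma>c \<Theta>c[OF Y]])
      also have "tr (\<sigma> * \<Theta> Y) = tr (?Z * Y)" by (rule adjoint_map_correct(2)[OF lin \<sigma>c Y])
      also have "complex_of_real l * tr (?Z * Y) = tr ((complex_of_real l \<cdot>\<^sub>m ?Z) * Y)"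
        by (rule tr_smult_mult[OF adjoint_map_correct(1)[OF lin \<sigma>c] Y, symmetric])
      finally show ?thesis .
    qed
    then show ?thesis using pcone_smult[OF Z l(1)] by blast
  qed
  define E where "E = complex_of_real (1 / (real d + 1)) \<cdot>\<^sub>m (1\<^sub>m (d * d) + complex_of_real (real d) \<cdot>\<^sub>m mes d)"
  define E' where "E' = complex_of_real (real d / (real d + 1)) \<cdot>\<^sub>m (1\<^sub>m (d * d) - mes d)"
  have EP: "E \<in> pcone d d" unfolding E_def by (intro pcone_smult pcone_one_plus_mes d) simp
  have EP': "E' \<in> pcone d d" unfolding E'_def by (intro pcone_smult pcone_one_minus_mes d) simp
  have Ec: "E \<in> carrier_mat (d * d) (d * d)" "E' \<in> carrier_mat (d * d) (d * d)"
    using EP EP' gcone_carrier by auto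
  have EE: "E + E' = 1\<^sub>m (d * d)"
  proof (rule eq_matI)
    fix i j assume "i < dim_row (1\<^sub>m (d * d) :: complex mat)" "j < dim_col (1\<^sub>m (d * d) :: complex mat)"
    then have ij: "i < d * d" "j < d * d" by auto
    have n: "complex_of_real (real d) + 1 \<noteq> 0"
    proof
      assume "complex_of_real (real d) + 1 = 0"
      then have "real d + 1 = 0" by (metis Re_complex_of_real one_complex.simps(1) plus_complex.simps(1) zero_complex.simps(1))
      then show False by linarith
    qed
    have "1 / (complex_of_real (real d) + 1) * (x + complex_of_real (real d) * y) +
       complex_of_real (real d) / (complex_of_real (real d) + 1) * (x - y) = x" for x y
    proof -
      have "1 / (complex_of_real (real d) + 1) * (x + complex_of_real (real d) * y) +
       complex_of_real (real d) / (complex_of_real (real d) + 1) * (x - y) =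
       ((complex_of_real (real d) + 1) * x) / (complex_of_real (real d) + 1)"
        by (simp only: times_divide_eq_left times_divide_eq_right add_divide_distrib[symmetric] mult_1_left)
          (rule arg_cong[of _ _ "\<lambda>y. y / _"], simp add: algebra_simps)
      then show ?thesis unfolding nonzero_mult_div_cancel_left[OF n] .
    qed
    from this[of "1\<^sub>m (d * d) $$ (i, j)" "mes d $$ (i, j)"]
    show "(E + E') $$ (i, j) = 1\<^sub>m (d * d) $$ (i, j)"
      using ij mes_carrier[of d] unfolding E_def E'_def by (simp add: carrier_matD)
  qed (use Ec in auto)
  obtain T where T: "T \<in> pcone dA dB" and TE: "\<And>Y. Y \<in> carrier_mat D D \<Longrightarrow> tr (E * \<Theta> Y) = tr (T * Y)"
    using pull[OF EP] by blast
  obtain T' where T': "T' \<in> pcone dA dB" and TE': "\<And>Y. Y \<in> carrier_mat D D \<Longrightarrow> tr (E' * \<Theta> Y) = tr (T' * Y)"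
    using pull[OF EP'] by blast
  have Tc: "T \<in> carrier_mat D D" "T' \<in> carrier_mat D D" using T T' gcone_carrier by (auto simp: D_def)
  \<comment> \<open>Trace preservation of \<open>\<Theta>\<close> means that its adjoint preserves
    the identity; matrix units serve as test operators.\<close>
  have TT: "T + T' = 1\<^sub>m D"
  proof (rule eq_matI)
    fix i j assume "i < dim_row (1\<^sub>m D :: complex mat)" "j < dim_col (1\<^sub>m D :: complex mat)"
    then have ij: "i < D" "j < D" by auto
    let ?Y = "unit_mat D j i"
    have "tr ((T + T') * ?Y) = tr (T * ?Y) + tr (T' * ?Y)"
      by (rule tr_add_mult[OF Tc unit_mat_carrier])
    also have "\<dots> = tr (E * \<Theta> ?Y) + tr (E' * \<Theta> ?Y)" by (simp add: TE TE')
    also have "\<dots> = tr ((E + E') * \<Theta> ?Y)"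
      by (rule tr_add_mult[OF Ec \<Theta>c[OF unit_mat_carrier], symmetric])
    also have "\<dots> = tr (\<Theta> ?Y)" unfolding EE by (simp only: left_mult_one_mat[OF \<Theta>c[OF unit_mat_carrier]])
    also have "\<dots> = tr (1\<^sub>m D * ?Y)" using cptp by (simp add: cptp_def left_mult_one_mat[of _ D D])
    finally have "tr ((T + T') * ?Y) = tr (1\<^sub>m D * ?Y)" .
    then show "(T + T') $$ (i, j) = 1\<^sub>m D $$ (i, j)"
      using tr_mult_unit_mat ij Tc by (metis add_carrier_mat one_carrier_mat)
  qed (use Tc in auto)
  \<comment> \<open>Separable states pass \<open>T\<close> with probability at most
    \<open>2 / d\<close>, so each outcome contributes at most 1/2 to the constraint. The logarithms
    of the weights are \<open>m - 2\<close> and \<open>-1\<close>, which costs at most 3 in the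
    value.\<close>
  define L where "L = [(T, real d / 4), (T', 1 / 2)]"
  have wL: "wpovm dA dB L"
  proof -
    have "wop D (\<lambda>_. 1) L = T + T'" using Tc by (simp add: L_def wop_Cons wop_Nil)
    then show ?thesis using T T' d TT by (simp add: wpovm_def L_def D_def)
  qed
  have \<rho>c: "\<rho> \<in> carrier_mat D D" using states_carrier[OF \<rho>] by (simp add: D_def)
  define p where "p = Re (tr (\<rho> * T))"
  have sp: "p + Re (tr (\<rho> * T')) = 1" using wpovm_sum_prob[OF wL \<rho>] by (simp add: L_def p_def)
  have "psd D \<rho>" using \<rho> by (simp add: states_def D_def)
  then have p01: "0 \<le> Re (tr (\<rho> * T'))" "0 \<le> p"
    using gcone_psd[OF T'] gcone_psd[OF T] by (auto simp: psd_tr_mult_Re_ge0 D_def p_def)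
  have pge: "1 - 2 * e \<le> p"
  proof -
    define \<Delta> where "\<Delta> = \<Theta> \<rho> - mes d"
    have h: "herm (d * d) \<Delta>" using DNE_trace_norm_ge0(1)[OF \<Theta> \<rho>] by (simp add: \<Delta>_def bip_power_Phi2 d_def)
    have q01: "0 \<le> quad (d * d) E u" "quad (d * d) E u \<le> ip (d * d) u u" for u
    proof -
      show 0: "0 \<le> quad (d * d) E u" using gcone_quad_ge0[OF EP] .
      have "quad (d * d) (E + E') u = ip (d * d) u u" unfolding EE by simp
      then have "ip (d * d) u u = quad (d * d) E u + quad (d * d) E' u" by (simp add: quad_add[OF Ec])
      then show "quad (d * d) E u \<le> ip (d * d) u u" using gcone_quad_ge0[OF EP', of u] by simp
    qed
    have "\<bar>Re (tr (E * \<Delta>))\<bar> \<le> trace_norm (d * d) \<Delta>" by (rule tr_mult_le_trace_norm[OF h Ec(1) q01])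
    also have "\<dots> \<le> 2 * e" using err by (simp add: \<Delta>_def bip_power_Phi2 d_def)
    finally have 1: "\<bar>Re (tr (E * \<Delta>))\<bar> \<le> 2 * e" .
    have "tr (E * \<Delta>) = tr (E * \<Theta> \<rho>) - tr (E * mes d)"
      unfolding \<Delta>_def by (rule tr_mult_minus[OF Ec(1) \<Theta>c[OF \<rho>c] mes_carrier])
    moreover have "tr (E * mes d) = 1"
    proof -
      have "tr (E * mes d) = complex_of_real (1 / (real d + 1)) * (tr (mes d) + complex_of_real (real d) * tr (mes d * mes d))"
        unfolding E_def
        by (simp add: tr_smult_mult[of _ "d * d"] tr_add_mult[of _ "d * d"] left_mult_one_mat[of _ "d * d" "d * d"])
      also have "\<dots> = complex_of_real (1 / (real d + 1)) * complex_of_real (1 + real d)"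
        by (simp add: tr_mes[OF d] tr_mes_mes[OF d])
      also have "1 / (real d + 1) = inverse (1 + real d)" by (simp add: inverse_eq_divide add.commute)
      also have "complex_of_real (inverse (1 + real d)) * complex_of_real (1 + real d) = 1"
        unfolding of_real_mult[symmetric] using d by simp
      finally show ?thesis .
    qed
    moreover have "tr (E * \<Theta> \<rho>) = tr (\<rho> * T)" using TE[OF \<rho>c] tr_comm[OF Tc(1) \<rho>c] by simp
    ultimately show ?thesis using 1 by (simp add: p_def)
  qed
  have "pord dA dB (wop (dA * dB) (\<lambda>f. f) L) (complex_of_real 1 \<cdot>\<^sub>m 1\<^sub>m (dA * dB))"
  proof (rule pord_from_sep_states)
    show "wop (dA * dB) (\<lambda>f. f) L \<in> pcone dA dB" using wL unfolding wpovm_def by (intro wop_pcone) auto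
    fix \<sigma> assume \<sigma>: "\<sigma> \<in> sep_states dA dB"
    have \<sigma>c: "\<sigma> \<in> carrier_mat D D" using sep_states_states[OF \<sigma>] states_carrier by (simp add: D_def)
    have \<sigma>'P: "\<Theta> \<sigma> \<in> pcone d d" "tr (\<Theta> \<sigma>) = 1" using sep[OF \<sigma>] by (auto simp: sep_states_iff)
    have "tr (mes d * \<Theta> \<sigma>) \<le> tr ((complex_of_real (1 / real d) \<cdot>\<^sub>m 1\<^sub>m (d * d)) * \<Theta> \<sigma>)"
      by (rule pord_tr_mult[OF pord_mes[OF d] _ _ \<sigma>'P(1)]) auto
    also have "\<dots> = complex_of_real (1 / real d)"
      using \<sigma>'P \<Theta>c[OF \<sigma>c] by (simp add: tr_smult_mult[of _ "d * d"] left_mult_one_mat[of _ "d * d" "d * d"])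
    finally have fid: "Re (tr (mes d * \<Theta> \<sigma>)) \<le> 1 / real d" by (simp add: less_eq_complex_def)
    have "tr (T * \<sigma>) = tr (E * \<Theta> \<sigma>)" using TE[OF \<sigma>c] by simp
    also have "\<dots> = complex_of_real (1 / (real d + 1)) * (tr (\<Theta> \<sigma>) + complex_of_real (real d) * tr (mes d * \<Theta> \<sigma>))"
      unfolding E_def using \<Theta>c[OF \<sigma>c]
      by (simp add: tr_smult_mult[of _ "d * d"] tr_add_mult[of _ "d * d"] left_mult_one_mat[of _ "d * d" "d * d"])
    finally have "Re (tr (T * \<sigma>)) = 1 / (real d + 1) * (1 + real d * Re (tr (mes d * \<Theta> \<sigma>)))"
      using \<sigma>'P(2) unfolding of_real_mult[symmetric] by simp
    also have "\<dots> \<le> 1 / (real d + 1) * 2"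
      using fid d by (intro mult_left_mono) (auto simp: field_simps)
    also have "\<dots> \<le> 2 / real d" using d by (simp add: frac_le)
    finally have q: "Re (tr (T * \<sigma>)) \<le> 2 / real d" .
    have t: "Re (tr (\<sigma> * wop D (\<lambda>f. f) L)) = real d / 4 * Re (tr (\<sigma> * T)) + 1 / 2 * Re (tr (\<sigma> * T'))"
      using tr_mult_wop[OF wpovm_carrier[OF wL] states_carrier[OF sep_states_states[OF \<sigma>]], of "\<lambda>f. f"]
      by (simp add: L_def D_def)
    have s1: "Re (tr (\<sigma> * T)) + Re (tr (\<sigma> * T')) = 1"
      using wpovm_sum_prob[OF wL sep_states_states[OF \<sigma>]] by (simp add: L_def)
    have "0 \<le> Re (tr (\<sigma> * T))"
      using sep_states_states[OF \<sigma>] gcone_psd[OF T] by (auto simp: states_def intro: psd_tr_mult_Re_ge0)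
    then have "1 / 2 * Re (tr (\<sigma> * T')) \<le> 1 / 2" using s1 by simp
    moreover have "real d / 4 * Re (tr (\<sigma> * T)) \<le> real d / 4 * (2 / real d)"
      using q tr_comm[OF Tc(1) \<sigma>c] by (intro mult_left_mono) auto
    moreover have "real d / 4 * (2 / real d) = 1 / 2" using d by simp
    ultimately have "Re (tr (\<sigma> * wop D (\<lambda>f. f) L)) \<le> 1" unfolding t by linarith
    then show "Re (tr (wop (dA * dB) (\<lambda>f. f) L * \<sigma>)) \<le> 1"
      using tr_comm[OF \<sigma>c, of "wop D (\<lambda>f. f) L"] by (simp add: D_def)
  qed
  then have "feas dA dB L" using wL by (simp add: feas_def)
  then have "ereal (wval \<rho> L) \<le> D_SEP_sep dA dB \<rho>" by (rule wval_le_D_SEP_sep[OF pos _ \<rho>])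
  moreover have "(1 - 2 * e) * real m - 3 \<le> wval \<rho> L"
  proof -
    have "log 2 (real d / 4) = real m - 2"
    proof -
      have "real d / 4 = 2 powr (real m - 2)" by (simp add: d_def powr_diff powr_realpow)
      then show ?thesis by simp
    qed
    moreover have "log 2 (1 / 2 :: real) = - 1" by (simp add: log_divide)
    ultimately have "wval \<rho> L = p * (real m - 2) - (1 - p)" using sp by (simp add: wval_def L_def p_def)
    moreover have "(1 - 2 * e) * real m \<le> p * real m" using pge by (intro mult_right_mono) auto
    moreover have "p \<le> 1" using p01 sp by simp
    moreover have "p * (real m - 2) = p * real m - 2 * p" by (simp add: algebra_simps)
    ultimately show ?thesis by linarith
  qed
  ultimately show ?thesis by (meson ereal_less_eq(3) order_trans)
qed

section \<open>Measure-and-prepare protocols\<close>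

text \<open>One outcome of a measure-and-prepare map under ampliation: each block of
  \<open>X\<close> is traced against \<open>T\<close> and replaced by a multiple of
  \<open>P\<close>. Since the term is additive in \<open>T\<close> and in \<open>P\<close>, its
  positivity can be checked on rank-one operators.\<close>

definition amp_term :: "nat \<Rightarrow> nat \<Rightarrow> nat \<Rightarrow> complex mat \<Rightarrow> complex mat \<Rightarrow> complex mat \<Rightarrow> complex mat" where
  "amp_term k d d' X T P = mat (k * d') (k * d') (\<lambda>(r, c).
     (\<Sum>i<d. \<Sum>j<d. T $$ (i, j) * X $$ ((r div d') * d + j, (c div d') * d + i)) * P $$ (r mod d', c mod d'))"

lemma amp_term_carrier [simp]: "amp_term k d d' X T P \<in> carrier_mat (k * d') (k * d')"
  by (simp add: amp_term_def)

text \<open>For rank-one \<open>T\<close> and \<open>P\<close> the map has the single Kraus operator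
  \<open>|w><t|\<close>; the vector on the right is its adjoint \<open>|t><w|\<close> applied to
  every block of \<open>v\<close>.\<close>

lemma quad_amp_term_prj:
  "quad (k * d') (amp_term k d d' X (prj d t) (prj d' w)) v =
    quad (k * d) X (\<lambda>r. t (r mod d) * (\<Sum>j<d'. cnj (w j) * v ((r div d) * d' + j)))"
proof -
  let ?s = "\<lambda>p. \<Sum>j<d'. cnj (w j) * v (p * d' + j)"
  have "quad (k * d') (amp_term k d d' X (prj d t) (prj d' w)) v =
    (\<Sum>p<k. \<Sum>i'<d'. \<Sum>q<k. \<Sum>j'<d'. cnj (v (p * d' + i')) *
      ((\<Sum>i<d. \<Sum>j<d. (t i * cnj (t j)) * X $$ (p * d + j, q * d + i)) * (w i' * cnj (w j'))) * v (q * d' + j'))"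
    unfolding quad_def sum_mult_index by (intro sum.cong refl) (simp add: amp_term_def mult_add_less)
  also have "\<dots> = (\<Sum>p<k. \<Sum>q<k. \<Sum>i'<d'. \<Sum>j'<d'. cnj (v (p * d' + i')) *
      ((\<Sum>i<d. \<Sum>j<d. (t i * cnj (t j)) * X $$ (p * d + j, q * d + i)) * (w i' * cnj (w j'))) * v (q * d' + j'))"
    by (intro sum.cong refl sum.swap)
  also have "\<dots> = (\<Sum>p<k. \<Sum>q<k. (\<Sum>i<d. \<Sum>j<d. (t i * cnj (t j)) * X $$ (p * d + j, q * d + i)) * (cnj (?s p) * ?s q))"
  proof (intro sum.cong refl)
    fix p q
    let ?c = "\<Sum>i<d. \<Sum>j<d. (t i * cnj (t j)) * X $$ (p * d + j, q * d + i)"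
    have "cnj (?s p) * ?s q = (\<Sum>i'<d'. \<Sum>j'<d'. (w i' * cnj (v (p * d' + i'))) * (cnj (w j') * v (q * d' + j')))"
      by (simp add: sum_product)
    then show "(\<Sum>i'<d'. \<Sum>j'<d'. cnj (v (p * d' + i')) * (?c * (w i' * cnj (w j'))) * v (q * d' + j')) = ?c * (cnj (?s p) * ?s q)"
      by (simp only: sum_distrib_left) (intro sum.cong refl, simp only: mult_ac)
  qed
  also have "\<dots> = (\<Sum>p<k. \<Sum>q<k. \<Sum>j<d. \<Sum>i<d. cnj (t j * ?s p) * X $$ (p * d + j, q * d + i) * (t i * ?s q))"
  proof (intro sum.cong refl)
    fix p q
    have "(\<Sum>i<d. \<Sum>j<d. (t i * cnj (t j)) * X $$ (p * d + j, q * d + i)) * (cnj (?s p) * ?s q) =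
      (\<Sum>i<d. \<Sum>j<d. cnj (t j * ?s p) * X $$ (p * d + j, q * d + i) * (t i * ?s q))"
      unfolding sum_distrib_right[of _ _ "cnj (?s p) * ?s q"] complex_cnj_mult by (intro sum.cong refl) (simp only: mult_ac)
    then show "(\<Sum>i<d. \<Sum>j<d. (t i * cnj (t j)) * X $$ (p * d + j, q * d + i)) * (cnj (?s p) * ?s q) =
      (\<Sum>j<d. \<Sum>i<d. cnj (t j * ?s p) * X $$ (p * d + j, q * d + i) * (t i * ?s q))"
      by (subst sum.swap) simp
  qed
  also have "\<dots> = (\<Sum>p<k. \<Sum>j<d. \<Sum>q<k. \<Sum>i<d. cnj (t j * ?s p) * X $$ (p * d + j, q * d + i) * (t i * ?s q))"
    by (intro sum.cong refl sum.swap)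
  also have "\<dots> = quad (k * d) X (\<lambda>r. t (r mod d) * ?s (r div d))"
    unfolding quad_def sum_mult_index by (intro sum.cong refl) simp
  finally show ?thesis .
qed

lemma psd_amp_term:
  assumes X: "psd (k * d) X" and T: "T \<in> gcone d UNIV" and P: "P \<in> gcone d' UNIV"
  shows "psd (k * d') (amp_term k d d' X T P)"
proof -
  have add: "psd n (Y + Z)" if "psd n Y" "psd n Z" for n Y Z
    using gcone_add that unfolding psd_eq_gcone by blast
  have zero: "psd n (0\<^sub>m n n)" for n by (simp add: psd_iff)
  show ?thesis using T
  proof (induction rule: gcone.induct)
    case zero
    have "amp_term k d d' X (0\<^sub>m d d) P = 0\<^sub>m (k * d') (k * d')"
      by (intro eq_matI) (auto simp: amp_term_def)
    then show ?case using \<open>psd (k * d') (0\<^sub>m (k * d') (k * d'))\<close> by simp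
  next
    case (step T t)
    have "psd (k * d') (amp_term k d d' X (prj d t) P)" using P
    proof (induction rule: gcone.induct)
      case zero
      have "amp_term k d d' X (prj d t) (0\<^sub>m d' d') = 0\<^sub>m (k * d') (k * d')"
        using div_mod_less by (intro eq_matI) (auto simp: amp_term_def)
      then show ?case using \<open>psd (k * d') (0\<^sub>m (k * d') (k * d'))\<close> by simp
    next
      case (step P w)
      have "amp_term k d d' X (prj d t) (P + prj d' w) = amp_term k d d' X (prj d t) P + amp_term k d d' X (prj d t) (prj d' w)"
        using gcone_carrier[OF step(1)] div_mod_less
        by (intro eq_matI) (auto simp: amp_term_def distrib_left simp del: prj_index)
      moreover have "psd (k * d') (amp_term k d d' X (prj d t) (prj d' w))"
        unfolding psd_iff quad_amp_term_prj using psdD(2)[OF X] by simp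
      ultimately show ?case using step.IH add by simp
    qed
    moreover have "amp_term k d d' X (T + prj d t) P = amp_term k d d' X T P + amp_term k d d' X (prj d t) P"
      using gcone_carrier[OF step(1)]
      by (intro eq_matI) (simp_all add: amp_term_def sum.distrib distrib_right)
    ultimately show ?case using step.IH add by simp
  qed
qed

definition measure_prepare :: "complex mat \<Rightarrow> complex mat \<Rightarrow> complex mat \<Rightarrow> complex mat \<Rightarrow> complex mat \<Rightarrow> complex mat" where
  "measure_prepare T T' P W X = tr (T * X) \<cdot>\<^sub>m P + tr (T' * X) \<cdot>\<^sub>m W"

lemma measure_prepare_cptp:
  assumes T: "psd d T" "psd d T'" "T + T' = 1\<^sub>m d" and P: "P \<in> states d'" "W \<in> states d'"
  shows "cptp d d' (measure_prepare T T' P W)"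
proof -
  let ?\<Xi> = "measure_prepare T T' P W"
  have c: "T \<in> carrier_mat d d" "T' \<in> carrier_mat d d" "P \<in> carrier_mat d' d'" "W \<in> carrier_mat d' d'"
    using T P psdD states_carrier by auto
  have lin: "linear_map d d' ?\<Xi>"
    unfolding linear_map_def
  proof (intro conjI ballI allI)
    fix X :: "complex mat" assume X: "X \<in> carrier_mat d d"
    show "?\<Xi> X \<in> carrier_mat d' d'" using c by (simp add: measure_prepare_def)
    show "?\<Xi> (X + Y) = ?\<Xi> X + ?\<Xi> Y" if Y: "Y \<in> carrier_mat d d" for Y
      using c X Y unfolding measure_prepare_def
      by (intro eq_matI) (simp_all add: tr_mult_add[of _ d] distrib_right)
    show "?\<Xi> (a \<cdot>\<^sub>m X) = a \<cdot>\<^sub>m ?\<Xi> X" for a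
      using c X unfolding measure_prepare_def
      by (intro eq_matI) (simp_all add: tr_mult_smult[of _ d] distrib_left)
  qed
  have "psd (k * d') (ampliation k d d' ?\<Xi> X)" if X: "psd (k * d) X" for k X
  proof -
    have "ampliation k d d' ?\<Xi> X = amp_term k d d' X T P + amp_term k d d' X T' W"
    proof (rule eq_matI)
      fix r s assume "r < dim_row (amp_term k d d' X T P + amp_term k d d' X T' W)"
        "s < dim_col (amp_term k d d' X T P + amp_term k d d' X T' W)"
      then have rs: "r < k * d'" "s < k * d'" by (auto simp: amp_term_def)
      let ?B = "mat d d (\<lambda>(i, j). X $$ ((r div d') * d + i, (s div d') * d + j))"
      have "tr (U * ?B) = (\<Sum>i<d. \<Sum>j<d. U $$ (i, j) * X $$ ((r div d') * d + j, (s div d') * d + i))"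
        if "U \<in> carrier_mat d d" for U
        by (subst tr_mult[OF that]) simp_all
      then show "ampliation k d d' ?\<Xi> X $$ (r, s) = (amp_term k d d' X T P + amp_term k d d' X T' W) $$ (r, s)"
        using rs c div_mod_less[OF rs(1)] div_mod_less[OF rs(2)]
        by (simp add: ampliation_def measure_prepare_def amp_term_def)
    qed (auto simp: ampliation_def amp_term_def)
    moreover have "psd (k * d') (amp_term k d d' X T P)" "psd (k * d') (amp_term k d d' X T' W)"
      using X T P by (auto intro!: psd_amp_term psd_gcone simp: states_def)
    ultimately show ?thesis using gcone_add unfolding psd_eq_gcone by metis
  qed
  moreover have "tr (?\<Xi> X) = tr X" if X: "X \<in> carrier_mat d d" for X
  proof -
    have "tr (?\<Xi> X) = tr (T * X) * tr P + tr (T' * X) * tr W"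
      using c by (simp add: measure_prepare_def tr_add[of _ d'] tr_smult[of _ d'])
    also have "\<dots> = tr ((T + T') * X)" using P by (simp add: states_def tr_add_mult[OF c(1,2) X])
    finally show ?thesis using X by (simp add: T(3) left_mult_one_mat[of _ d d])
  qed
  ultimately show ?thesis using lin by (simp add: cptp_def completely_positive_def)
qed

text \<open>The adjoint sends \<open>X\<close> to \<open>tr (X * P)\<close> times \<open>T\<close>
  plus \<open>tr (X * W)\<close> times \<open>T'\<close>, a nonnegative combination of separable
  effects. The adjoint condition is therefore automatic, and only the action on separable states has
  to be assumed.\<close>

lemma measure_prepare_DNE:
  assumes pos: "0 < dA" "0 < dB" "0 < dA'" "0 < dB'"
    and T: "T \<in> pcone dA dB" "T' \<in> pcone dA dB" "T + T' = 1\<^sub>m (dA * dB)"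
    and P: "P \<in> states (dA' * dB')" "W \<in> states (dA' * dB')"
    and sep: "\<And>\<sigma>. \<sigma> \<in> sep_states dA dB \<Longrightarrow> measure_prepare T T' P W \<sigma> \<in> sep_states dA' dB'"
  shows "measure_prepare T T' P W \<in> DNE dA dB dA' dB'"
proof -
  let ?\<Xi> = "measure_prepare T T' P W"
  let ?D = "dA * dB" and ?D' = "dA' * dB'"
  have c: "T \<in> carrier_mat ?D ?D" "T' \<in> carrier_mat ?D ?D" "P \<in> carrier_mat ?D' ?D'" "W \<in> carrier_mat ?D' ?D'"
    using T P gcone_carrier states_carrier by auto
  have "adjoint_map ?D ?D' ?\<Xi> X \<in> sep_cone dA dB" if X: "X \<in> sep_states dA' dB'" for X
  proof -
    have Xs: "psd ?D' X" and Xc: "X \<in> carrier_mat ?D' ?D'"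
      using sep_states_states[OF X] states_carrier by (auto simp: states_def)
    have P': "psd ?D' P" "psd ?D' W" using P by (auto simp: states_def)
    let ?Z = "tr (X * P) \<cdot>\<^sub>m T + tr (X * W) \<cdot>\<^sub>m T'"
    have "adjoint_map ?D ?D' ?\<Xi> X = ?Z"
    proof (rule adjoint_map_eq)
      show "?Z \<in> carrier_mat ?D ?D" using c by simp
      fix Y :: "complex mat" assume Y: "Y \<in> carrier_mat ?D ?D"
      have "tr (X * ?\<Xi> Y) = tr (T * Y) * tr (X * P) + tr (T' * Y) * tr (X * W)"
        unfolding measure_prepare_def using c Xc by (simp add: tr_mult_add[of _ ?D'] tr_mult_smult[of _ ?D'])
      also have "\<dots> = tr (?Z * Y)"
        using c Y by (simp add: tr_add_mult[of _ ?D] tr_smult_mult[of _ ?D])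
      finally show "tr (X * ?\<Xi> Y) = tr (?Z * Y)" .
    qed
    also have "?Z = complex_of_real (Re (tr (X * P))) \<cdot>\<^sub>m T + complex_of_real (Re (tr (X * W))) \<cdot>\<^sub>m T'"
      using Re_tr_mult_psd[OF Xs P'(1)] Re_tr_mult_psd[OF Xs P'(2)] by simp
    also have "\<dots> \<in> pcone dA dB"
      using psd_tr_mult_Re_ge0[OF Xs P'(1)] psd_tr_mult_Re_ge0[OF Xs P'(2)] T by (intro gcone_add pcone_smult)
    finally show ?thesis using sep_cone_iff[OF pos(1,2)] by blast
  qed
  moreover have "cptp ?D ?D' ?\<Xi>" using T P gcone_psd by (intro measure_prepare_cptp) auto
  ultimately show ?thesis unfolding DNE_def using sep by auto
qed

text \<open>The state is a combination of the separable operators \<open>1 + d \<Phi>\<close> and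
  \<open>1 - \<Phi>\<close>. Comparing coefficients gives \<open>a\<close> and \<open>b\<close>, and
  \<open>b = (1 - t d) / (d^2 - 1)\<close> is nonnegative by the bound on \<open>t\<close>.\<close>

lemma isotropic_sep:
  assumes d: "2 \<le> d" and t: "0 \<le> t" "t \<le> 1 / real d"
  shows "complex_of_real t \<cdot>\<^sub>m mes d + complex_of_real ((1 - t) / (real d ^ 2 - 1)) \<cdot>\<^sub>m (1\<^sub>m (d * d) - mes d) \<in> pcone d d"
proof -
  have d0: "0 < d" using d by simp
  have "4 \<le> real d ^ 2" using power_mono[of 2 "real d" 2] d by simp
  then have n: "0 < real d ^ 2 - 1" by simp
  define a where "a = t / (real d + 1)"
  define b where "b = (1 - t) / (real d ^ 2 - 1) - t / (real d + 1)"
  have f: "real d ^ 2 - 1 = (real d + 1) * (real d - 1)" by (simp add: power2_eq_square algebra_simps)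
  have dd: "real d - 1 \<noteq> 0" "real d + 1 \<noteq> 0" using d by auto
  have "b = (1 - t * d) / (real d ^ 2 - 1)"
  proof -
    have "t / (real d + 1) = t * (real d - 1) / (real d ^ 2 - 1)" unfolding f using dd by simp
    then show ?thesis unfolding b_def by (simp add: diff_divide_distrib[symmetric] algebra_simps)
  qed
  moreover have "t * d \<le> 1" using t d0 by (simp add: field_simps)
  ultimately have b0: "0 \<le> b" using n by simp
  have a0: "0 \<le> a" using t by (simp add: a_def)
  have "complex_of_real a \<cdot>\<^sub>m (1\<^sub>m (d * d) + complex_of_real (real d) \<cdot>\<^sub>m mes d) + complex_of_real b \<cdot>\<^sub>m (1\<^sub>m (d * d) - mes d) \<in> pcone d d"
    by (intro gcone_add pcone_smult pcone_one_plus_mes pcone_one_minus_mes d0 a0 b0)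
  moreover have "complex_of_real a \<cdot>\<^sub>m (1\<^sub>m (d * d) + complex_of_real (real d) \<cdot>\<^sub>m mes d) + complex_of_real b \<cdot>\<^sub>m (1\<^sub>m (d * d) - mes d)
    = complex_of_real t \<cdot>\<^sub>m mes d + complex_of_real ((1 - t) / (real d ^ 2 - 1)) \<cdot>\<^sub>m (1\<^sub>m (d * d) - mes d)" (is "?L = ?R")
  proof (rule eq_matI)
    fix i j assume "i < dim_row ?R" "j < dim_col ?R"
    then have ij: "i < d * d" "j < d * d" by auto
    have ab: "a + b = (1 - t) / (real d ^ 2 - 1)" by (simp add: a_def b_def)
    have "a * (real d + 1) = t" unfolding a_def
      by (simp only: times_divide_eq_left nonzero_mult_div_cancel_right[OF dd(2)])
    then have adb: "a * d + a = t" by (simp add: distrib_left)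
    have "complex_of_real a * (x + complex_of_real (real d) * y) + complex_of_real b * (x - y) =
      complex_of_real (a * d + a) * y + complex_of_real (a + b) * (x - y)" for x y :: complex
      by (simp add: algebra_simps)
    from this[of "1\<^sub>m (d * d) $$ (i, j)" "mes d $$ (i, j)"]
    have "complex_of_real a * (1\<^sub>m (d * d) $$ (i, j) + complex_of_real (real d) * mes d $$ (i, j)) +
       complex_of_real b * (1\<^sub>m (d * d) $$ (i, j) - mes d $$ (i, j)) =
      complex_of_real t * mes d $$ (i, j) + complex_of_real ((1 - t) / (real d ^ 2 - 1)) * (1\<^sub>m (d * d) $$ (i, j) - mes d $$ (i, j))"
      unfolding ab adb .
    then show "?L $$ (i, j) = ?R $$ (i, j)" using ij by (simp only: index_add_mat index_smult_mat index_minus_mat mes_dim index_one_mat(2,3))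
  qed auto
  ultimately show ?thesis by simp
qed

text \<open>A separable input passes the test with probability at most \<open>1 / d\<close>, which
  is the range where the isotropic output is separable. On \<open>\<rho>\<close> the output differs
  from \<open>\<Phi>\<close> by the rejection probability times \<open>W - \<Phi>\<close>, whose
  trace norm is at most 2.\<close>

lemma distillation_achieves:
  assumes pos: "0 < dA" "0 < dB" and \<rho>: "\<rho> \<in> states (dA * dB)"
    and T: "T \<in> pcone dA dB" "T' \<in> pcone dA dB" "T + T' = 1\<^sub>m (dA * dB)"
    and small: "pord dA dB T (complex_of_real (1 / 2 ^ m) \<cdot>\<^sub>m 1\<^sub>m (dA * dB))"
    and m: "m = 0 \<Longrightarrow> T' = 0\<^sub>m (dA * dB) (dA * dB)"
    and err: "Re (tr (\<rho> * T')) \<le> e"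
  shows "\<exists>\<Theta>\<in>DNE dA dB (2 ^ m) (2 ^ m). 1 / 2 * trace_norm (2 ^ m * 2 ^ m) (\<Theta> \<rho> - bip_power 2 2 Phi2 m) \<le> e"
proof -
  define d where "d = (2::nat) ^ m"
  have d: "0 < d" by (simp add: d_def)
  let ?D = "dA * dB"
  have Tc: "T \<in> carrier_mat ?D ?D" "T' \<in> carrier_mat ?D ?D" using T gcone_carrier by auto
  define P where "P = mes d"
  \<comment> \<open>For \<open>m = 0\<close> the dimension is 1 and no state is orthogonal to
    \<open>\<Phi>\<close>, so \<open>W\<close> is a placeholder; the hypothesis \<open>m\<close>
    then makes \<open>T'\<close> vanish.\<close>
  define W where "W = (if m = 0 then mes d else complex_of_real (1 / (real d ^ 2 - 1)) \<cdot>\<^sub>m (1\<^sub>m (d * d) - mes d))"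
  have P: "P \<in> states (d * d)" by (simp add: P_def states_def psd_mes tr_mes[OF d])
  have d2: "2 \<le> d" if "m \<noteq> 0" using that by (cases m) (auto simp: d_def)
  have dsq: "0 < real d ^ 2 - 1" if "m \<noteq> 0"
    using power_mono[of 2 "real d" 2] d2[OF that] by simp
  have W: "W \<in> states (d * d)"
  proof (cases "m = 0")
    case True
    then show ?thesis using P by (simp add: W_def P_def)
  next
    case False
    have "psd (d * d) W" unfolding W_def using False dsq[OF False]
      by (auto intro!: gcone_psd[of _ _ "pvs d"] pcone_smult pcone_one_minus_mes d simp del: of_real_divide)
    moreover have "tr W = complex_of_real (1 / (real d ^ 2 - 1)) * (complex_of_real (real d ^ 2 - 1))"
    proof -
      have "tr (1\<^sub>m (d * d) :: complex mat) = complex_of_real (real d ^ 2)" by (simp add: tr_def power2_eq_square)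
      then show ?thesis using False
        by (simp add: W_def tr_smult[of _ "d * d"] tr_minus[of _ "d * d"] tr_mes[OF d] minus_carrier_mat)
    qed
    then have "tr W = 1" unfolding of_real_mult[symmetric] using dsq[OF False] by simp
    ultimately show ?thesis by (simp add: states_def)
  qed
  let ?\<Theta> = "measure_prepare T T' P W"
  have TT: "tr (T * X) + tr (T' * X) = tr X" if X: "X \<in> carrier_mat ?D ?D" for X
    unfolding tr_add_mult[OF Tc X, symmetric] T(3) using X by (simp add: left_mult_one_mat[of _ ?D ?D])
  have re: "tr (U * \<sigma>) = complex_of_real (Re (tr (U * \<sigma>)))" "0 \<le> Re (tr (U * \<sigma>))"
    if "U \<in> pcone dA dB" "psd ?D \<sigma>" for U \<sigma>
    using Re_tr_mult_psd[OF gcone_psd[OF that(1)] that(2)] psd_tr_mult_Re_ge0[OF gcone_psd[OF that(1)] that(2)] by auto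
  have sep: "?\<Theta> \<sigma> \<in> sep_states d d" if \<sigma>: "\<sigma> \<in> sep_states dA dB" for \<sigma>
  proof -
    have \<sigma>p: "psd ?D \<sigma>" and \<sigma>c: "\<sigma> \<in> carrier_mat ?D ?D" and \<sigma>1: "tr \<sigma> = 1"
      using sep_states_states[OF \<sigma>] states_carrier by (auto simp: states_def)
    define t where "t = Re (tr (T * \<sigma>))"
    have t: "tr (T * \<sigma>) = complex_of_real t" "0 \<le> t" using re[OF T(1) \<sigma>p] by (auto simp: t_def)
    have t': "tr (T' * \<sigma>) = complex_of_real (1 - t)" using TT[OF \<sigma>c] t \<sigma>1 by (simp add: algebra_simps)
    have "tr (T * \<sigma>) \<le> tr ((complex_of_real (1 / 2 ^ m) \<cdot>\<^sub>m 1\<^sub>m ?D) * \<sigma>)"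
      using \<sigma> Tc by (intro pord_tr_mult[OF small]) (auto simp: sep_states_iff)
    also have "\<dots> = complex_of_real (1 / real d)"
      using \<sigma>c \<sigma>1 by (simp add: tr_smult_mult[of _ ?D] left_mult_one_mat[of _ ?D ?D] d_def)
    finally have tle: "t \<le> 1 / real d" unfolding t(1) by (simp add: less_eq_complex_def)
    have P1: "tr (?\<Theta> \<sigma>) = 1"
      using measure_prepare_cptp[OF gcone_psd[OF T(1)] gcone_psd[OF T(2)] T(3) P W] \<sigma>c \<sigma>1 by (simp add: cptp_def)
    have "?\<Theta> \<sigma> \<in> pcone d d"
    proof (cases "m = 0")
      case True
      then have T'0: "T' = 0\<^sub>m ?D ?D" by (rule m)
      have "tr (T' * \<sigma>) = 0" unfolding T'0 using \<sigma>c by (simp add: tr_def)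
      then have "?\<Theta> \<sigma> = mes d" using TT[OF \<sigma>c] \<sigma>1 True
        by (intro eq_matI) (auto simp: measure_prepare_def P_def W_def)
      moreover have "mes d = 1\<^sub>m (1 * 1)" using True by (intro eq_matI) (auto simp: d_def mes_def mes_vec_def)
      ultimately show ?thesis using pcone_one[of 1 1] True by (simp add: d_def)
    next
      case False
      have "?\<Theta> \<sigma> = complex_of_real t \<cdot>\<^sub>m mes d + complex_of_real ((1 - t) / (real d ^ 2 - 1)) \<cdot>\<^sub>m (1\<^sub>m (d * d) - mes d)"
        unfolding measure_prepare_def t t' P_def W_def using False
        by (intro eq_matI) auto
      then show ?thesis using isotropic_sep[OF d2[OF False] t(2) tle] by simp
    qed
    then show ?thesis using P1 by (simp add: sep_states_iff)
  qed
  have DNE: "?\<Theta> \<in> DNE dA dB (2 ^ m) (2 ^ m)"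
    using pos P W T sep unfolding d_def by (intro measure_prepare_DNE) auto
  have \<rho>c: "\<rho> \<in> carrier_mat ?D ?D" and \<rho>p: "psd ?D \<rho>" and \<rho>1: "tr \<rho> = 1"
    using \<rho> states_carrier by (auto simp: states_def)
  define e' where "e' = Re (tr (T' * \<rho>))"
  have e': "tr (T' * \<rho>) = complex_of_real e'" "0 \<le> e'" using re[OF T(2) \<rho>p] by (auto simp: e'_def)
  have e1: "tr (T * \<rho>) = 1 - complex_of_real e'" using TT[OF \<rho>c] e' \<rho>1 by (simp add: algebra_simps)
  have ee: "e' \<le> e" using err tr_comm[OF Tc(2) \<rho>c] by (simp add: e'_def)
  have Pc: "P \<in> carrier_mat (d * d) (d * d)" "W \<in> carrier_mat (d * d) (d * d)" using P W states_carrier by auto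
  have "?\<Theta> \<rho> - P = complex_of_real e' \<cdot>\<^sub>m W - complex_of_real e' \<cdot>\<^sub>m P"
    unfolding measure_prepare_def e1 e' using Pc by (intro eq_matI) (auto simp: algebra_simps)
  moreover have "trace_norm (d * d) (complex_of_real e' \<cdot>\<^sub>m W - complex_of_real e' \<cdot>\<^sub>m P) \<le>
      Re (tr (complex_of_real e' \<cdot>\<^sub>m W)) + Re (tr (complex_of_real e' \<cdot>\<^sub>m P))"
  proof (rule trace_norm_psd_minus_le)
    show "psd (d * d) (complex_of_real e' \<cdot>\<^sub>m W)" "psd (d * d) (complex_of_real e' \<cdot>\<^sub>m P)"
      using P W e' gcone_smult[of _ "d * d" UNIV e'] unfolding states_def psd_eq_gcone by auto
  qed
  moreover have "\<dots> = 2 * e'" using P W Pc by (simp add: tr_smult[of _ "d * d"] states_def)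
  ultimately have "1 / 2 * trace_norm (2 ^ m * 2 ^ m) (?\<Theta> \<rho> - bip_power 2 2 Phi2 m) \<le> e"
    using ee unfolding bip_power_Phi2 P_def d_def by simp
  then show ?thesis using DNE by blast
qed

section \<open>The one-shot distillation number\<close>

definition distillable :: "nat \<Rightarrow> nat \<Rightarrow> real \<Rightarrow> complex mat \<Rightarrow> nat set" where
  "distillable dA dB \<epsilon> \<rho> = {m. (INF \<Theta> \<in> DNE dA dB (2 ^ m) (2 ^ m).
        1 / 2 * trace_norm (2 ^ m * 2 ^ m) (\<Theta> \<rho> - bip_power 2 2 Phi2 m)) \<le> \<epsilon>}"

lemma E_d_one_Max: "E_d_one dA dB \<epsilon> \<rho> = Max (distillable dA dB \<epsilon> \<rho>)"
  by (simp add: E_d_one_def distillable_def)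

lemma DNE_errors_bdd_below:
  assumes "\<rho> \<in> states (dA * dB)"
  shows "bdd_below ((\<lambda>\<Theta>. 1 / 2 * trace_norm (2 ^ m * 2 ^ m) (\<Theta> \<rho> - bip_power 2 2 Phi2 m)) ` DNE dA dB (2 ^ m) (2 ^ m))"
  using DNE_trace_norm_ge0(2)[OF _ assms] by (intro bdd_belowI[of _ 0]) auto

lemma distillable_intro:
  assumes "0 < dA" "0 < dB" "\<rho> \<in> states (dA * dB)"
    "T \<in> pcone dA dB" "T' \<in> pcone dA dB" "T + T' = 1\<^sub>m (dA * dB)"
    "pord dA dB T (complex_of_real (1 / 2 ^ m) \<cdot>\<^sub>m 1\<^sub>m (dA * dB))"
    "m = 0 \<Longrightarrow> T' = 0\<^sub>m (dA * dB) (dA * dB)" "Re (tr (\<rho> * T')) \<le> \<epsilon>"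
  shows "m \<in> distillable dA dB \<epsilon> \<rho>"
  using distillation_achieves[OF assms] cINF_lower2[OF DNE_errors_bdd_below[OF assms(3)]]
  unfolding distillable_def by blast

lemma zero_distillable:
  assumes pos: "0 < dA" "0 < dB" and \<rho>: "\<rho> \<in> states (dA * dB)" and \<epsilon>: "0 \<le> \<epsilon>"
  shows "0 \<in> distillable dA dB \<epsilon> \<rho>"
proof (rule distillable_intro[OF pos \<rho>])
  let ?D = "dA * dB"
  show "1\<^sub>m ?D \<in> pcone dA dB" by (rule pcone_one)
  show "0\<^sub>m ?D ?D \<in> pcone dA dB" by (rule gcone.zero)
  have "\<rho> * 0\<^sub>m ?D ?D = 0\<^sub>m ?D ?D" using states_carrier[OF \<rho>] by simp
  then show "Re (tr (\<rho> * 0\<^sub>m ?D ?D)) \<le> \<epsilon>" using \<epsilon> by (simp add: tr_def)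
qed (auto simp: pord_def)

lemma distillable_bound:
  assumes pos: "0 < dA" "0 < dB" and \<rho>: "\<rho> \<in> states (dA * dB)" and \<epsilon>: "\<epsilon> < 1 / 2"
    and m: "m \<in> distillable dA dB \<epsilon> \<rho>"
  shows "(1 - 2 * \<epsilon>) * real m - 3 \<le> real_of_ereal (D_SEP_sep dA dB \<rho>)"
proof (rule field_le_epsilon)
  fix e :: real assume e: "0 < e"
  \<comment> \<open>The infimum over maps need not be attained, so a map with error below
    \<open>\<epsilon> + \<eta>\<close> is used; the choice of \<open>\<eta>\<close> keeps the extra
    loss \<open>2 * \<eta> * m\<close> below \<open>e\<close>.\<close>
  define \<eta> where "\<eta> = e / (2 * (real m + 1))"
  have \<eta>: "0 < \<eta>" using e by (simp add: \<eta>_def)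
  let ?f = "\<lambda>\<Theta>. 1 / 2 * trace_norm (2 ^ m * 2 ^ m) (\<Theta> \<rho> - bip_power 2 2 Phi2 m)"
  \<comment> \<open>An infimum over an empty set of reals would carry no information; the channel
    that always outputs the maximally mixed state is a member.\<close>
  have ne: "DNE dA dB (2 ^ m) (2 ^ m) \<noteq> {}"
  proof -
    let ?D = "dA * dB"
    have P: "1\<^sub>m ?D \<in> pcone dA dB" "0\<^sub>m ?D ?D \<in> pcone dA dB" by (auto intro: pcone_one gcone.zero)
    have M: "max_mixed (2 ^ m * 2 ^ m) \<in> sep_states (2 ^ m) (2 ^ m)" by (rule max_mixed_sep) auto
    have "measure_prepare (1\<^sub>m ?D) (0\<^sub>m ?D ?D) (max_mixed (2 ^ m * 2 ^ m)) (max_mixed (2 ^ m * 2 ^ m)) \<in> DNE dA dB (2 ^ m) (2 ^ m)"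
    proof (rule measure_prepare_DNE)
      fix \<sigma> assume \<sigma>: "\<sigma> \<in> sep_states dA dB"
      have c: "\<sigma> \<in> carrier_mat ?D ?D" "tr \<sigma> = 1" using sep_states_states[OF \<sigma>] states_carrier by (auto simp: states_def)
      have "tr (0\<^sub>m ?D ?D * \<sigma>) = 0" "tr (1\<^sub>m ?D * \<sigma>) = 1" using c by (simp_all add: tr_def[of "0\<^sub>m _ _"] left_mult_one_mat[of _ ?D ?D])
      then have "measure_prepare (1\<^sub>m ?D) (0\<^sub>m ?D ?D) (max_mixed (2 ^ m * 2 ^ m)) (max_mixed (2 ^ m * 2 ^ m)) \<sigma> = max_mixed (2 ^ m * 2 ^ m)"
        unfolding measure_prepare_def by (intro eq_matI) (auto simp: max_mixed_def)
      then show "measure_prepare (1\<^sub>m ?D) (0\<^sub>m ?D ?D) (max_mixed (2 ^ m * 2 ^ m)) (max_mixed (2 ^ m * 2 ^ m)) \<sigma> \<in> sep_states (2 ^ m) (2 ^ m)"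
        using M by simp
    qed (use pos P sep_states_states[OF M] in auto)
    then show ?thesis by blast
  qed
  have "(INF \<Theta> \<in> DNE dA dB (2 ^ m) (2 ^ m). ?f \<Theta>) < \<epsilon> + \<eta>"
    using m \<eta> by (simp add: distillable_def)
  then obtain \<Theta> where \<Theta>: "\<Theta> \<in> DNE dA dB (2 ^ m) (2 ^ m)" "?f \<Theta> < \<epsilon> + \<eta>"
    unfolding cINF_less_iff[OF ne DNE_errors_bdd_below[OF \<rho>]] by blast
  have "ereal ((1 - 2 * (\<epsilon> + \<eta>)) * real m - 3) \<le> D_SEP_sep dA dB \<rho>"
    using \<Theta> by (intro distillation_converse[OF pos \<rho> \<Theta>(1)]) simp
  also have "\<dots> = ereal (real_of_ereal (D_SEP_sep dA dB \<rho>))" by (rule D_SEP_sep_finite[OF pos \<rho>])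
  finally have "(1 - 2 * (\<epsilon> + \<eta>)) * real m - 3 \<le> real_of_ereal (D_SEP_sep dA dB \<rho>)" by simp
  moreover have "2 * \<eta> * real m \<le> e"
  proof -
    have "2 * (e / (2 * x)) * y = e * (y / x)" for x y :: real by (cases "x = 0") (auto simp: field_simps)
    then have "2 * \<eta> * real m = e * (real m / (real m + 1))" unfolding \<eta>_def .
    also have "\<dots> \<le> e * 1" using e by (intro mult_left_mono) auto
    finally show ?thesis by simp
  qed
  moreover have "(1 - 2 * (\<epsilon> + \<eta>)) * real m = (1 - 2 * \<epsilon>) * real m - 2 * \<eta> * real m" by (simp add: algebra_simps)
  ultimately show "(1 - 2 * \<epsilon>) * real m - 3 \<le> real_of_ereal (D_SEP_sep dA dB \<rho>) + e" by linarith
qed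

text \<open>Below error 1/2 the converse bounds \<open>m\<close>, so the \<open>Max\<close> in
  \<open>E_d_one\<close> is a genuine maximum. Such errors suffice for the limit at 0 from the
  right.\<close>

lemma distillable_finite:
  assumes pos: "0 < dA" "0 < dB" and \<rho>: "\<rho> \<in> states (dA * dB)" and \<epsilon>: "\<epsilon> < 1 / 2"
  shows "finite (distillable dA dB \<epsilon> \<rho>)"
proof (rule finite_subset)
  define B where "B = (real_of_ereal (D_SEP_sep dA dB \<rho>) + 3) / (1 - 2 * \<epsilon>)"
  show "distillable dA dB \<epsilon> \<rho> \<subseteq> {..nat \<lfloor>B\<rfloor>}"
  proof
    fix m assume "m \<in> distillable dA dB \<epsilon> \<rho>"
    from distillable_bound[OF assms this] have "real m * (1 - 2 * \<epsilon>) \<le> real_of_ereal (D_SEP_sep dA dB \<rho>) + 3"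
      by (simp add: mult.commute)
    then have "real m \<le> B" using \<epsilon> by (simp add: B_def pos_le_divide_eq)
    then show "m \<in> {..nat \<lfloor>B\<rfloor>}" by (simp add: le_nat_floor)
  qed
qed auto

lemma E_d_one_ge:
  assumes "0 < dA" "0 < dB" "\<rho> \<in> states (dA * dB)" "\<epsilon> < 1 / 2" "m \<in> distillable dA dB \<epsilon> \<rho>"
  shows "m \<le> E_d_one dA dB \<epsilon> \<rho>"
  unfolding E_d_one_Max using distillable_finite[OF assms(1-4)] assms(5) by simp

lemma E_d_one_le:
  assumes "0 < dA" "0 < dB" "\<rho> \<in> states (dA * dB)" "0 \<le> \<epsilon>" "\<epsilon> < 1 / 2"
  shows "(1 - 2 * \<epsilon>) * real (E_d_one dA dB \<epsilon> \<rho>) - 3 \<le> real_of_ereal (D_SEP_sep dA dB \<rho>)"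
proof (rule distillable_bound[OF assms(1-3,5)])
  show "E_d_one dA dB \<epsilon> \<rho> \<in> distillable dA dB \<epsilon> \<rho>"
    unfolding E_d_one_Max using distillable_finite[OF assms(1-3,5)] zero_distillable[OF assms(1-4)]
    by (intro Max_in) auto
qed

section \<open>Achievability and the main theorem\<close>

fun lpow :: "nat \<Rightarrow> nat \<Rightarrow> (complex mat \<times> real) list \<Rightarrow> nat \<Rightarrow> (complex mat \<times> real) list" where
  "lpow dA dB L 0 = [(1\<^sub>m 1, 1)]"
| "lpow dA dB L (Suc n) = lprod (dA ^ n) (dB ^ n) dA dB (lpow dA dB L n) L"

lemma feas_lpow:
  assumes pos: "0 < dA" "0 < dB" and L: "feas dA dB L"
  shows "feas (dA ^ n) (dB ^ n) (lpow dA dB L n)"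
proof (induction n)
  case 0
  show ?case using wpovm_singleton[of 1 1 1] by (simp add: feas_def wop_Cons wop_Nil pord_def)
next
  case (Suc n)
  then show ?case using feas_lprod[of "dB ^ n" dA dB "dA ^ n" "lpow dA dB L n" L] pos L
    by (simp add: mult.commute)
qed

text \<open>Outcomes on different copies are independent, so the expectation of a multiplicative
  function of the weights is a power of the one-copy expectation.\<close>

lemma tr_bip_power_wop_lpow:
  assumes pos: "0 < dA" "0 < dB" and L: "feas dA dB L" and \<rho>: "\<rho> \<in> carrier_mat (dA * dB) (dA * dB)"
    and \<phi>: "\<And>x y. 0 < x \<Longrightarrow> 0 < y \<Longrightarrow> \<phi> (x * y) = \<phi> x * \<phi> y" "\<phi> 1 = 1"
  shows "tr (bip_power dA dB \<rho> n * wop (dA ^ n * dB ^ n) \<phi> (lpow dA dB L n)) = tr (\<rho> * wop (dA * dB) \<phi> L) ^ n"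
proof (induction n)
  case 0
  show ?case by (simp add: wop_Cons wop_Nil \<phi>(2) tr_def)
next
  case (Suc n)
  have fpos: "\<forall>(E, f)\<in>set (lpow dA dB L n). 0 < f" "\<forall>(E, f)\<in>set L. 0 < f"
    using feas_lpow[OF pos L, of n] L by (auto simp: feas_def wpovm_def)
  have d: "dA ^ Suc n * dB ^ Suc n = (dA ^ n * dA) * (dB ^ n * dB)" by simp
  have w: "wop (dA ^ Suc n * dB ^ Suc n) \<phi> (lpow dA dB L (Suc n)) =
     bip_tensor (dA ^ n) (dB ^ n) dA dB (wop (dA ^ n * dB ^ n) \<phi> (lpow dA dB L n)) (wop (dA * dB) \<phi> L)"
    unfolding d lpow.simps by (rule wop_lprod[OF fpos \<phi>(1)])
  show ?case
    unfolding w bip_power.simps tr_bip_mult[OF bip_power_carrier[OF \<rho>] wop_carrier \<rho> wop_carrier] Suc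
    by simp
qed

lemma wop_add: "wop d \<phi> L + wop d \<psi> L = wop d (\<lambda>f. \<phi> f + \<psi> f) L"
proof (rule eq_matI)
  fix i j assume "i < dim_row (wop d (\<lambda>f. \<phi> f + \<psi> f) L)" "j < dim_col (wop d (\<lambda>f. \<phi> f + \<psi> f) L)"
  then have ij: "i < d" "j < d" by auto
  have "(\<Sum>(E, f)\<leftarrow>L. complex_of_real (\<phi> f) * E $$ (i, j)) + (\<Sum>(E, f)\<leftarrow>L. complex_of_real (\<psi> f) * E $$ (i, j)) =
    (\<Sum>(E, f)\<leftarrow>L. complex_of_real (\<phi> f + \<psi> f) * E $$ (i, j))"
    by (induction L) (auto simp: algebra_simps)
  then show "(wop d \<phi> L + wop d \<psi> L) $$ (i, j) = wop d (\<lambda>f. \<phi> f + \<psi> f) L $$ (i, j)"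
    using ij by (simp add: wop_def)
qed auto

text \<open>\<open>h s\<close> is the expectation of \<open>2 powr (s * (R - log 2 f))\<close>. It
  is 1 at 0 with derivative \<open>ln 2 * (R - wval \<rho> L) < 0\<close>, so it drops below 1 for
  small positive \<open>s\<close>.\<close>

lemma chernoff_exponent:
  assumes w: "wpovm dA dB L" and \<rho>: "\<rho> \<in> states (dA * dB)" and R: "R < wval \<rho> L"
  shows "\<exists>s>0. 2 powr (s * R) * Re (tr (\<rho> * wop (dA * dB) (\<lambda>f. f powr (- s)) L)) < 1"
proof -
  define k where "k = length L"
  define p where "p i = Re (tr (\<rho> * fst (L ! i)))" for i
  define f where "f i = snd (L ! i)" for i
  define c where "c i = R * ln 2 - ln (f i)" for i
  define h where "h s = (\<Sum>i<k. p i * exp (s * c i))" for s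
  have f: "0 < f i" if "i < k" for i
  proof -
    have "L ! i \<in> set L" using that by (simp add: k_def)
    then show ?thesis using w by (auto simp: wpovm_def f_def case_prod_unfold)
  qed
  have sp: "(\<Sum>i<k. p i) = 1"
    using wpovm_sum_prob[OF w \<rho>] by (simp add: sum_list_nth k_def p_def case_prod_unfold)
  have v: "wval \<rho> L = (\<Sum>i<k. p i * log 2 (f i))"
    by (simp add: wval_def sum_list_nth k_def p_def f_def case_prod_unfold)
  have h_eq: "2 powr (s * R) * Re (tr (\<rho> * wop (dA * dB) (\<lambda>f. f powr (- s)) L)) = h s" for s
  proof -
    have "Re (tr (\<rho> * wop (dA * dB) (\<lambda>f. f powr (- s)) L)) = (\<Sum>i<k. f i powr (- s) * p i)"
      unfolding tr_mult_wop[OF wpovm_carrier[OF w] states_carrier[OF \<rho>]]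
      by (simp add: sum_list_nth k_def p_def f_def case_prod_unfold)
    then have "2 powr (s * R) * Re (tr (\<rho> * wop (dA * dB) (\<lambda>f. f powr (- s)) L)) =
        (\<Sum>i<k. 2 powr (s * R) * (f i powr (- s) * p i))" by (simp add: sum_distrib_left)
    also have "\<dots> = h s"
      unfolding h_def
    proof (intro sum.cong refl)
      fix i assume "i \<in> {..<k}"
      then have "0 < f i" using f by simp
      then have "2 powr (s * R) * f i powr (- s) = exp (s * c i)"
        by (simp add: powr_def c_def algebra_simps flip: exp_add)
      then show "2 powr (s * R) * (f i powr (- s) * p i) = p i * exp (s * c i)" by (simp add: mult_ac)
    qed
    finally show ?thesis .
  qed
  have "(\<Sum>i<k. p i * c i) = R * ln 2 * (\<Sum>i<k. p i) - ln 2 * wval \<rho> L"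
    unfolding v sum_distrib_left sum_subtractf[symmetric]
    by (intro sum.cong refl) (simp add: c_def log_def algebra_simps)
  also have "\<dots> = ln 2 * (R - wval \<rho> L)" by (simp add: sp algebra_simps)
  also have "\<dots> < 0" using R by (simp add: mult_less_0_iff)
  finally have neg: "(\<Sum>i<k. p i * c i) < 0" .
  have "(h has_real_derivative (\<Sum>i<k. p i * (exp (0 * c i) * (1 * c i)))) (at 0)"
    unfolding h_def[abs_def] by (intro DERIV_sum DERIV_cmult DERIV_exp[THEN DERIV_chain2] DERIV_cmult_right DERIV_ident)
  then have "(h has_real_derivative (\<Sum>i<k. p i * c i)) (at 0)" by simp
  from DERIV_neg_dec_right[OF this neg] obtain \<delta> where \<delta>: "0 < \<delta>" "\<And>s. 0 < s \<Longrightarrow> s < \<delta> \<Longrightarrow> h (0 + s) < h 0"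
    by blast
  have "h (\<delta> / 2) < h 0" using \<delta>(2)[of "\<delta> / 2"] \<delta>(1) by simp
  also have "h 0 = 1" by (simp add: h_def sp)
  finally show ?thesis using \<delta>(1) by (intro exI[of _ "\<delta> / 2"]) (simp only: h_eq half_gt_zero_iff simp_thms)
qed

text \<open>The test accepts if the product of the weights exceeds \<open>2 powr (n * R)\<close>. Separable states pass it rarely
  by Markov's inequality, since weights of feasible lists multiply; the error on \<open>\<rho>\<close> is a Chernoff bound.\<close>

lemma stein_test:
  assumes pos: "0 < dA" "0 < dB" and L: "feas dA dB L" and \<rho>: "\<rho> \<in> states (dA * dB)" and R: "R < wval \<rho> L"
  shows "\<exists>r. 0 \<le> r \<and> r < 1 \<and> (\<forall>n. \<exists>T\<in>pcone (dA ^ n) (dB ^ n). \<exists>T'\<in>pcone (dA ^ n) (dB ^ n).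
    T + T' = 1\<^sub>m (dA ^ n * dB ^ n) \<and>
    pord (dA ^ n) (dB ^ n) T (complex_of_real (2 powr (- (n * R))) \<cdot>\<^sub>m 1\<^sub>m (dA ^ n * dB ^ n)) \<and>
    Re (tr (bip_power dA dB \<rho> n * T')) \<le> r ^ n)"
proof -
  have w: "wpovm dA dB L" using L by (simp add: feas_def)
  obtain s where s: "0 < s" and s1: "2 powr (s * R) * Re (tr (\<rho> * wop (dA * dB) (\<lambda>f. f powr (- s)) L)) < 1"
    using chernoff_exponent[OF w \<rho> R] by blast
  define h where "h = Re (tr (\<rho> * wop (dA * dB) (\<lambda>f. f powr (- s)) L))"
  have \<rho>p: "psd (dA * dB) \<rho>" and \<rho>c: "\<rho> \<in> carrier_mat (dA * dB) (dA * dB)"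
    using \<rho> states_carrier by (auto simp: states_def)
  have wp: "wop (dA * dB) (\<lambda>f. f powr (- s)) L \<in> pcone dA dB"
    using w unfolding wpovm_def by (intro wop_pcone) auto
  have hc: "tr (\<rho> * wop (dA * dB) (\<lambda>f. f powr (- s)) L) = complex_of_real h" and h0: "0 \<le> h"
    using Re_tr_mult_psd[OF \<rho>p gcone_psd[OF wp]] psd_tr_mult_Re_ge0[OF \<rho>p gcone_psd[OF wp]] by (auto simp: h_def)
  define r where "r = 2 powr (s * R) * h"
  have "\<exists>T\<in>pcone (dA ^ n) (dB ^ n). \<exists>T'\<in>pcone (dA ^ n) (dB ^ n).
    T + T' = 1\<^sub>m (dA ^ n * dB ^ n) \<and>
    pord (dA ^ n) (dB ^ n) T (complex_of_real (2 powr (- (n * R))) \<cdot>\<^sub>m 1\<^sub>m (dA ^ n * dB ^ n)) \<and>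
    Re (tr (bip_power dA dB \<rho> n * T')) \<le> r ^ n" for n
  proof -
    define D where "D = dA ^ n * dB ^ n"
    define Ln where "Ln = lpow dA dB L n"
    define \<theta> where "\<theta> = 2 powr (n * R)"
    have \<theta>: "0 < \<theta>" by (simp add: \<theta>_def)
    have fn: "feas (dA ^ n) (dB ^ n) Ln" unfolding Ln_def by (rule feas_lpow[OF pos L])
    then have wn: "wpovm (dA ^ n) (dB ^ n) Ln" by (simp add: feas_def)
    have cone: "wop D \<phi> Ln \<in> pcone (dA ^ n) (dB ^ n)" if "\<And>f. 0 < f \<Longrightarrow> 0 \<le> \<phi> f" for \<phi>
      unfolding D_def by (rule wop_pcone) (use wn that in \<open>auto simp: wpovm_def\<close>)
    define T where "T = wop D (\<lambda>f. if \<theta> \<le> f then 1 else 0) Ln"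
    define T' where "T' = wop D (\<lambda>f. if \<theta> \<le> f then 0 else 1) Ln"
    have 1: "T \<in> pcone (dA ^ n) (dB ^ n)" "T' \<in> pcone (dA ^ n) (dB ^ n)"
      unfolding T_def T'_def by (auto intro!: cone)
    have "(\<lambda>f. (if \<theta> \<le> f then 1 else 0) + (if \<theta> \<le> f then 0 else (1::real))) = (\<lambda>_. 1)" by auto
    then have 2: "T + T' = 1\<^sub>m D" unfolding T_def T'_def wop_add using wn by (simp add: wpovm_def D_def)
    have 3: "pord (dA ^ n) (dB ^ n) T (complex_of_real (2 powr (- (n * R))) \<cdot>\<^sub>m 1\<^sub>m D)"
      unfolding pord_def D_def[symmetric]
    proof
      fix u assume u: "u \<in> pvs (dB ^ n)"
      \<comment> \<open>Markov's inequality in operator form: the indicator of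
        \<open>\<theta> \<le> f\<close> is at most \<open>f / \<theta>\<close>, so \<open>S\<close>
        has nonnegative coefficients.\<close>
      define S where "S = wop D (\<lambda>f. f / \<theta> - (if \<theta> \<le> f then 1 else 0)) Ln"
      have S: "S \<in> pcone (dA ^ n) (dB ^ n)" unfolding S_def using \<theta> by (intro cone) auto
      have "T + S = wop D (\<lambda>f. f / \<theta>) Ln" unfolding T_def S_def wop_add by simp
      moreover have "quad D (T + S) u = quad D T u + quad D S u"
        by (rule quad_add) (auto simp: T_def S_def)
      ultimately have le1: "quad D T u \<le> quad D (wop D (\<lambda>f. f / \<theta>) Ln) u"
        using gcone_quad_ge0[OF S, of u] by (simp add: D_def)
      have q: "quad D (wop D (\<lambda>f. f) Ln) u = complex_of_real \<theta> * quad D (wop D (\<lambda>f. f / \<theta>) Ln) u"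
      proof -
        have "wop D (\<lambda>f. f) Ln = complex_of_real \<theta> \<cdot>\<^sub>m wop D (\<lambda>f. f / \<theta>) Ln"
        proof (rule eq_matI)
          fix i j assume "i < dim_row (complex_of_real \<theta> \<cdot>\<^sub>m wop D (\<lambda>f. f / \<theta>) Ln)"
            "j < dim_col (complex_of_real \<theta> \<cdot>\<^sub>m wop D (\<lambda>f. f / \<theta>) Ln)"
          then have ij: "i < D" "j < D" by auto
          have "(\<Sum>(E, f)\<leftarrow>M. complex_of_real f * E $$ (i, j)) =
            complex_of_real \<theta> * (\<Sum>(E, f)\<leftarrow>M. complex_of_real (f / \<theta>) * E $$ (i, j))" for M
            using \<theta> by (induction M) (auto simp: distrib_left)
          then show "wop D (\<lambda>f. f) Ln $$ (i, j) = (complex_of_real \<theta> \<cdot>\<^sub>m wop D (\<lambda>f. f / \<theta>) Ln) $$ (i, j)"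
            using ij by (simp add: wop_def)
        qed auto
        then show ?thesis by (simp add: quad_smult)
      qed
      have "quad D (wop D (\<lambda>f. f) Ln) u \<le> quad D (1\<^sub>m D) u"
        using fn u unfolding feas_def pord_def D_def by blast
      then have "complex_of_real (1 / \<theta>) * quad D (wop D (\<lambda>f. f) Ln) u \<le> complex_of_real (1 / \<theta>) * quad D (1\<^sub>m D) u"
        using \<theta> by (simp add: less_eq_complex_def divide_right_mono)
      then have "quad D (wop D (\<lambda>f. f / \<theta>) Ln) u \<le> complex_of_real (1 / \<theta>) * quad D (1\<^sub>m D) u"
        unfolding q using \<theta> by simp
      with le1 have "quad D T u \<le> complex_of_real (1 / \<theta>) * quad D (1\<^sub>m D) u" by (rule order_trans)
      then show "quad D T u \<le> quad D (complex_of_real (2 powr (- (n * R))) \<cdot>\<^sub>m 1\<^sub>m D) u"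
        by (simp add: quad_smult \<theta>_def powr_minus_divide)
    qed
    have \<rho>n: "bip_power dA dB \<rho> n \<in> states D" unfolding D_def by (rule states_bip_power[OF \<rho>])
    then have \<rho>nc: "bip_power dA dB \<rho> n \<in> carrier_mat D D" by (rule states_carrier)
    have LC: "\<forall>(E, f)\<in>set Ln. E \<in> carrier_mat D D" using wpovm_carrier[OF wn] by (simp add: D_def)
    have "Re (tr (bip_power dA dB \<rho> n * T')) = (\<Sum>(E, f)\<leftarrow>Ln. (if \<theta> \<le> f then 0 else 1) * Re (tr (bip_power dA dB \<rho> n * E)))"
      unfolding T'_def by (rule tr_mult_wop[OF LC \<rho>nc])
    also have "\<dots> \<le> (\<Sum>(E, f)\<leftarrow>Ln. \<theta> powr s * (f powr (- s) * Re (tr (bip_power dA dB \<rho> n * E))))"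
    proof (rule sum_list_mono, clarify)
      fix E f assume Ef: "(E, f) \<in> set Ln"
      then have E: "E \<in> pcone (dA ^ n) (dB ^ n)" and f: "0 < f" using wn by (auto simp: wpovm_def)
      have p0: "0 \<le> Re (tr (bip_power dA dB \<rho> n * E))"
        using gcone_psd[OF E] \<rho>n by (auto simp: states_def D_def intro: psd_tr_mult_Re_ge0)
      \<comment> \<open>Chernoff's bound: the indicator of \<open>f < \<theta>\<close> is at most
        the \<open>s\<close>-th power of \<open>\<theta> / f\<close>.\<close>
      have "(if \<theta> \<le> f then 0 else 1) \<le> \<theta> powr s * f powr (- s)"
      proof (cases "\<theta> \<le> f")
        case False
        then have "f powr s \<le> \<theta> powr s" using s f by (intro powr_mono2) auto
        then show ?thesis using False f by (simp add: powr_minus_divide pos_le_divide_eq)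
      qed simp
      from mult_right_mono[OF this p0]
      show "(if \<theta> \<le> f then 0 else 1) * Re (tr (bip_power dA dB \<rho> n * E))
         \<le> \<theta> powr s * (f powr (- s) * Re (tr (bip_power dA dB \<rho> n * E)))" by (simp add: mult.assoc)
    qed
    also have "\<dots> = \<theta> powr s * (\<Sum>(E, f)\<leftarrow>Ln. f powr (- s) * Re (tr (bip_power dA dB \<rho> n * E)))"
      by (simp add: case_prod_unfold sum_list_const_mult)
    also have "\<dots> = \<theta> powr s * Re (tr (bip_power dA dB \<rho> n * wop D (\<lambda>f. f powr (- s)) Ln))"
      by (simp only: tr_mult_wop[OF LC \<rho>nc])
    also have "tr (bip_power dA dB \<rho> n * wop D (\<lambda>f. f powr (- s)) Ln) = complex_of_real (h ^ n)"
      unfolding D_def Ln_def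
      by (subst tr_bip_power_wop_lpow[OF pos L \<rho>c]) (auto simp: powr_mult hc)
    also have "\<theta> powr s * Re (complex_of_real (h ^ n)) = r ^ n"
    proof -
      have "\<theta> powr s = (2 powr (s * R)) ^ n"
        by (simp add: \<theta>_def powr_powr mult_ac flip: powr_realpow)
      then show ?thesis by (simp add: r_def power_mult_distrib)
    qed
    finally have 4: "Re (tr (bip_power dA dB \<rho> n * T')) \<le> r ^ n" .
    show ?thesis using 1 2 3 4 unfolding D_def by blast
  qed
  moreover have "0 \<le> r" "r < 1" using h0 s1 by (auto simp: r_def h_def)
  ultimately show ?thesis by blast
qed

context bipartite_state
begin

text \<open>The \<open>n\<close> copies are cut into \<open>j\<close> blocks of \<open>k\<close>, to
  which the test for the powers of \<open>L\<close> applies. The fewer than \<open>k\<close>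
  leftover copies are ignored by tensoring the test with the identity, which accounts for the
  subtracted 1 in \<open>n / k - 1\<close>; the other 1 is lost in rounding \<open>j * R\<close>
  down.\<close>

lemma E_d_one_ge_block:
  assumes k: "1 \<le> k" and L: "feas (dA ^ k) (dB ^ k) L" and R: "0 \<le> R" "R < wval (\<rho>n k) L"
    and \<epsilon>: "0 < \<epsilon>" "\<epsilon> < 1 / 2"
  shows "\<forall>\<^sub>F n in sequentially. (real n / real k - 1) * R - 1 \<le> real (E_d_one (dA ^ n) (dB ^ n) \<epsilon> (\<rho>n n))"
proof -
  obtain r where r: "0 \<le> r" "r < 1" and test: "\<And>j. \<exists>T\<in>pcone ((dA ^ k) ^ j) ((dB ^ k) ^ j). \<exists>T'\<in>pcone ((dA ^ k) ^ j) ((dB ^ k) ^ j).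
    T + T' = 1\<^sub>m ((dA ^ k) ^ j * (dB ^ k) ^ j) \<and>
    pord ((dA ^ k) ^ j) ((dB ^ k) ^ j) T (complex_of_real (2 powr (- (j * R))) \<cdot>\<^sub>m 1\<^sub>m ((dA ^ k) ^ j * (dB ^ k) ^ j)) \<and>
    Re (tr (bip_power (dA ^ k) (dB ^ k) (\<rho>n k) j * T')) \<le> r ^ j"
    using stein_test[OF dims_pow_pos L state_pow R(2)] by blast
  have "(\<lambda>j. r ^ j) \<longlonglongrightarrow> 0" using r by (intro LIMSEQ_realpow_zero)
  then have "\<forall>\<^sub>F j in sequentially. r ^ j < \<epsilon>" using \<epsilon>(1) by (rule order_tendstoD)
  then obtain J where J: "\<And>j. J \<le> j \<Longrightarrow> r ^ j < \<epsilon>" by (auto simp: eventually_sequentially)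
  have "(real n / real k - 1) * R - 1 \<le> real (E_d_one (dA ^ n) (dB ^ n) \<epsilon> (\<rho>n n))" if n: "k * J \<le> n" for n
  proof -
    define j where "j = n div k"
    define i where "i = n mod k"
    have nji: "n = k * j + i" by (simp add: j_def i_def)
    have "J \<le> j" unfolding j_def using n k by (simp add: less_eq_div_iff_mult_less_eq mult.commute)
    define a where "a = dA ^ (k * j)"
    define b where "b = dB ^ (k * j)"
    define a' where "a' = dA ^ i"
    define b' where "b' = dB ^ i"
    have dim: "dA ^ n = a * a'" "dB ^ n = b * b'" unfolding nji a_def b_def a'_def b'_def by (auto simp: power_add)
    have p: "0 < a" "0 < b" "0 < a'" "0 < b'" using dims_pos by (auto simp: a_def b_def a'_def b'_def)
    obtain T T' where T: "T \<in> pcone a b" "T' \<in> pcone a b" "T + T' = 1\<^sub>m (a * b)"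
      and small: "pord a b T (complex_of_real (2 powr (- (j * R))) \<cdot>\<^sub>m 1\<^sub>m (a * b))"
      and err: "Re (tr (\<rho>n (k * j) * T')) \<le> r ^ j"
      using test[of j] unfolding bip_power_mult[OF dims_pos states_carrier[OF state], symmetric]
        power_mult[symmetric] a_def[symmetric] b_def[symmetric] by blast
    define m where "m = nat \<lfloor>j * R\<rfloor>"
    have mle: "real m \<le> j * R" "j * R - 1 \<le> real m" unfolding m_def using R by (auto simp: of_nat_nat)
    have "m \<le> E_d_one (dA ^ n) (dB ^ n) \<epsilon> (\<rho>n n)"
    \<comment> \<open>For \<open>m = 0\<close> the inequality is trivial, while
      \<open>distillable_intro\<close> would then ask for \<open>T' = 0\<close>.\<close>
    proof (cases "m = 0")
      case False
      let ?b = "bip_tensor a b a' b'"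
      let ?I = "1\<^sub>m (a' * b') :: complex mat"
      have Tc: "T \<in> carrier_mat (a * b) (a * b)" "T' \<in> carrier_mat (a * b) (a * b)" using T gcone_carrier by auto
      have "m \<in> distillable (dA ^ n) (dB ^ n) \<epsilon> (\<rho>n n)"
      proof (rule distillable_intro[OF dims_pow_pos state_pow])
        show "?b T ?I \<in> pcone (dA ^ n) (dB ^ n)" "?b T' ?I \<in> pcone (dA ^ n) (dB ^ n)"
          unfolding dim using T p by (auto intro: pcone_bip pcone_one)
        show "?b T ?I + ?b T' ?I = 1\<^sub>m (dA ^ n * dB ^ n)"
          unfolding dim bip_add_left[OF Tc, symmetric] T(3) using p by (simp add: bip_one)
        have "pord (a * a') (b * b') (?b T ?I) (?b (complex_of_real (2 powr (- (j * R))) \<cdot>\<^sub>m 1\<^sub>m (a * b)) ?I)"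
          by (rule pord_bip_left[OF p(2-4) small pcone_one])
        then have le: "pord (a * a') (b * b') (?b T ?I) (complex_of_real (2 powr (- (j * R))) \<cdot>\<^sub>m 1\<^sub>m ((a * a') * (b * b')))"
          unfolding bip_smult_left[OF one_carrier_mat] bip_one[OF p(2-4)] .
        have c: "2 powr (- (j * R)) \<le> 1 / 2 ^ m"
        proof -
          have "2 powr (- (j * R)) \<le> 2 powr (- real m)" using mle by (intro powr_mono) auto
          then show ?thesis by (simp add: powr_minus_divide powr_realpow)
        qed
        show "pord (dA ^ n) (dB ^ n) (?b T ?I) (complex_of_real (1 / 2 ^ m) \<cdot>\<^sub>m 1\<^sub>m (dA ^ n * dB ^ n))"
          unfolding dim
        proof (rule pord_trans[OF le], unfold pord_def, intro ballI)
          fix u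
          have "2 powr (- (j * R)) * x \<le> 1 / 2 ^ m * x" if "0 \<le> x" for x :: real
            using c that by (rule mult_right_mono)
          then show "quad ((a * a') * (b * b')) (complex_of_real (2 powr (- (j * R))) \<cdot>\<^sub>m 1\<^sub>m ((a * a') * (b * b'))) u
            \<le> quad ((a * a') * (b * b')) (complex_of_real (1 / 2 ^ m) \<cdot>\<^sub>m 1\<^sub>m ((a * a') * (b * b'))) u"
            unfolding quad_smult[OF one_carrier_mat] quad_one ip_self of_real_mult[symmetric] less_eq_complex_def
              Re_complex_of_real Im_complex_of_real by (simp only: sum_nonneg zero_le_power2 simp_thms)
        qed
        have "tr (\<rho>n n * ?b T' ?I) = tr (\<rho>n (k * j) * T') * tr (\<rho>n i * ?I)"
          unfolding nji \<rho>n_add a_def b_def a'_def b'_def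
          using Tc state_pow states_carrier by (intro tr_bip_mult) (auto simp: a_def b_def)
        also have "\<rho>n i * ?I = \<rho>n i" using states_carrier[OF state_pow[of i]] by (simp add: a'_def b'_def)
        also have "tr (\<rho>n i) = 1" using state_pow[of i] by (simp add: states_def)
        finally have "Re (tr (\<rho>n n * ?b T' ?I)) = Re (tr (\<rho>n (k * j) * T'))" by simp
        then show "Re (tr (\<rho>n n * ?b T' ?I)) \<le> \<epsilon>" using err J[OF \<open>J \<le> j\<close>] by simp
      qed (use False in simp)
      then show ?thesis by (intro E_d_one_ge dims_pow_pos state_pow \<epsilon>(2))
    qed simp
    then have "j * R - 1 \<le> real (E_d_one (dA ^ n) (dB ^ n) \<epsilon> (\<rho>n n))" using mle by linarith
    moreover have "(real n / real k - 1) * R \<le> j * R"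
    proof (rule mult_right_mono[OF _ R(1)])
      have "i < k" using k by (simp add: i_def)
      then have "real n \<le> (real j + 1) * real k" unfolding nji by (simp add: algebra_simps)
      then have "real n / real k \<le> real j + 1" using k by (simp add: divide_le_eq)
      then show "real n / real k - 1 \<le> real j" by simp
    qed
    ultimately show ?thesis by linarith
  qed
  then show ?thesis by (auto simp: eventually_sequentially)
qed

lemma liminf_E_d_one_ge:
  assumes l: "(\<lambda>n. Dn n / n) \<longlonglongrightarrow> l" and \<epsilon>: "0 < \<epsilon>" "\<epsilon> < 1 / 2"
  shows "ereal l \<le> liminf (\<lambda>n. ereal (real (E_d_one (dA ^ n) (dB ^ n) \<epsilon> (\<rho>n n)) / real n))"
proof (rule ereal_le_epsilon2)
  fix e :: real assume e: "0 < e"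
  define R where "R = l - e / 2"
  show "ereal l \<le> liminf (\<lambda>n. ereal (real (E_d_one (dA ^ n) (dB ^ n) \<epsilon> (\<rho>n n)) / real n)) + ereal e"
  \<comment> \<open>The block bound assumes a nonnegative rate; for a negative one it is enough that
    the numbers of distilled pairs are nonnegative.\<close>
  proof (cases "R < 0")
    case True
    have "0 \<le> liminf (\<lambda>n. ereal (real (E_d_one (dA ^ n) (dB ^ n) \<epsilon> (\<rho>n n)) / real n))"
      by (intro Liminf_bounded always_eventually) auto
    moreover have "ereal l \<le> 0 + ereal e" using True e by (simp add: R_def)
    ultimately show ?thesis by (meson add_right_mono order_trans)
  next
    case False
    \<comment> \<open>The 5 consists of the loss of 4 in \<open>exists_feas\<close> and of 1 for the
      strict inequality in its hypothesis; spread over a long block of \<open>k\<close> copies it is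
      negligible.\<close>
    have "(\<lambda>n. Dn n / n - 5 / real n) \<longlonglongrightarrow> l - 0"
      by (intro tendsto_diff l lim_const_over_n)
    then have "\<forall>\<^sub>F n in sequentially. R < Dn n / n - 5 / real n"
      using e by (intro order_tendstoD) (auto simp: R_def)
    then have "\<forall>\<^sub>F n in sequentially. R < Dn n / n - 5 / real n \<and> 1 \<le> n"
      using eventually_ge_at_top[of 1] by (rule eventually_conj)
    then obtain N where "\<forall>n\<ge>N. R < Dn n / n - 5 / real n \<and> 1 \<le> n" unfolding eventually_sequentially by blast
    then obtain k where k: "R < Dn k / k - 5 / real k" "1 \<le> k" by blast
    have kR: "k * R < Dn k - 5" using k by (simp add: field_simps)
    have "ereal (Dn k - 1) < D_SEP_sep (dA ^ k) (dB ^ k) (\<rho>n k)" unfolding D_SEP_sep_Dn by simp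
    from exists_feas[OF dims_pow_pos state_pow this]
    obtain L where L: "feas (dA ^ k) (dB ^ k) L" "Dn k - 1 - 4 \<le> wval (\<rho>n k) L" by blast
    have "k * R < wval (\<rho>n k) L" using kR L by simp
    then have ev: "\<forall>\<^sub>F n in sequentially. (real n / real k - 1) * (k * R) - 1 \<le> real (E_d_one (dA ^ n) (dB ^ n) \<epsilon> (\<rho>n n))"
      using False by (intro E_d_one_ge_block[OF k(2) L(1) _ _ \<epsilon>]) auto
    obtain N where N: "2 * (k * R + 1) / e < real N" using reals_Archimedean2 by blast
    have "\<forall>\<^sub>F n in sequentially. ereal (R - e / 2) \<le> ereal (real (E_d_one (dA ^ n) (dB ^ n) \<epsilon> (\<rho>n n)) / real n)"
      using ev eventually_ge_at_top[of "max 1 N"]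
    proof eventually_elim
      case (elim n)
      have n: "1 \<le> n" "N \<le> n" using elim by auto
      have "2 * (k * R + 1) / e < real n" using N n by linarith
      then have 1: "2 * (k * R + 1) < e * real n" using e by (simp add: divide_less_eq mult.commute)
      have nk: "(real n / real k - 1) * (k * R) = n * R - k * R" using k by (simp add: field_simps)
      have 2: "n * R - k * R - 1 \<le> real (E_d_one (dA ^ n) (dB ^ n) \<epsilon> (\<rho>n n))" using elim(1) unfolding nk .
      have "2 * (n * R) - e * n \<le> 2 * (n * R) - 2 * (k * R + 1)"
        using less_imp_le[OF 1] by (rule diff_left_mono)
      also have "\<dots> = 2 * (n * R - k * R - 1)" by (simp add: algebra_simps)
      also have "\<dots> \<le> 2 * real (E_d_one (dA ^ n) (dB ^ n) \<epsilon> (\<rho>n n))"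
        using 2 by (rule mult_left_mono) simp
      finally have "2 * (n * R) - e * n \<le> 2 * real (E_d_one (dA ^ n) (dB ^ n) \<epsilon> (\<rho>n n))" .
      then have "(R - e / 2) * n \<le> real (E_d_one (dA ^ n) (dB ^ n) \<epsilon> (\<rho>n n))" by (simp add: algebra_simps)
      then show ?case using n by (simp add: pos_le_divide_eq)
    qed
    then have "ereal (R - e / 2) \<le> liminf (\<lambda>n. ereal (real (E_d_one (dA ^ n) (dB ^ n) \<epsilon> (\<rho>n n)) / real n))"
      by (rule Liminf_bounded)
    from add_right_mono[OF this, of "ereal e"] show ?thesis by (simp add: R_def)
  qed
qed

lemma liminf_E_d_one_le:
  assumes l: "(\<lambda>n. Dn n / n) \<longlonglongrightarrow> l" and \<epsilon>: "0 < \<epsilon>" "\<epsilon> < 1 / 2"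
  shows "liminf (\<lambda>n. ereal (real (E_d_one (dA ^ n) (dB ^ n) \<epsilon> (\<rho>n n)) / real n)) \<le> ereal (l / (1 - 2 * \<epsilon>))"
proof -
  have "(\<lambda>n. (Dn n / n + 3 / real n) / (1 - 2 * \<epsilon>)) \<longlonglongrightarrow> (l + 0) / (1 - 2 * \<epsilon>)"
    using \<epsilon> by (intro tendsto_intros l lim_const_over_n) auto
  then have "liminf (\<lambda>n. ereal ((Dn n / n + 3 / real n) / (1 - 2 * \<epsilon>))) = ereal (l / (1 - 2 * \<epsilon>))"
    by (intro lim_imp_Liminf) auto
  moreover have "liminf (\<lambda>n. ereal (real (E_d_one (dA ^ n) (dB ^ n) \<epsilon> (\<rho>n n)) / real n))
    \<le> liminf (\<lambda>n. ereal ((Dn n / n + 3 / real n) / (1 - 2 * \<epsilon>)))"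
  proof (rule Liminf_mono, rule eventually_mono[OF eventually_ge_at_top[of 1]])
    fix n :: nat assume n: "1 \<le> n"
    have "(1 - 2 * \<epsilon>) * real (E_d_one (dA ^ n) (dB ^ n) \<epsilon> (\<rho>n n)) - 3 \<le> Dn n"
      unfolding Dn_def using \<epsilon> by (intro E_d_one_le dims_pow_pos state_pow) auto
    then have "real (E_d_one (dA ^ n) (dB ^ n) \<epsilon> (\<rho>n n)) * (1 - 2 * \<epsilon>) \<le> Dn n + 3" by (simp add: mult.commute)
    then have "real (E_d_one (dA ^ n) (dB ^ n) \<epsilon> (\<rho>n n)) \<le> (Dn n + 3) / (1 - 2 * \<epsilon>)" using \<epsilon> by (simp add: pos_le_divide_eq)
    then have "real (E_d_one (dA ^ n) (dB ^ n) \<epsilon> (\<rho>n n)) / n \<le> (Dn n + 3) / (1 - 2 * \<epsilon>) / n"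
      by (rule divide_right_mono) simp
    also have "\<dots> = (Dn n / n + 3 / real n) / (1 - 2 * \<epsilon>)" by (simp add: add_divide_distrib mult.commute)
    finally show "ereal (real (E_d_one (dA ^ n) (dB ^ n) \<epsilon> (\<rho>n n)) / real n) \<le> ereal ((Dn n / n + 3 / real n) / (1 - 2 * \<epsilon>))"
      by simp
  qed
  ultimately show ?thesis by simp
qed

text \<open>At fixed error the lower limit lies between \<open>l\<close> and
  \<open>l / (1 - 2 * \<epsilon>)\<close>, and the gap closes as the error tends to 0.\<close>

lemma E_d_DNE_eq:
  assumes l: "(\<lambda>n. Dn n / n) \<longlonglongrightarrow> l"
  shows "E_d_DNE dA dB \<rho> = ereal l"
  unfolding E_d_DNE_def
proof (rule tendsto_Lim)
  let ?f = "\<lambda>\<epsilon>. liminf (\<lambda>n. ereal (real (E_d_one (dA ^ n) (dB ^ n) \<epsilon> (\<rho>n n)) / real n))"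
  have small: "\<forall>\<^sub>F \<epsilon> in at_right (0::real). 0 < \<epsilon> \<and> \<epsilon> < 1 / 2"
    by (auto simp: eventually_at_right_field intro!: exI[of _ "1/2"])
  have "((\<lambda>\<epsilon>::real. l / (1 - 2 * \<epsilon>)) \<longlongrightarrow> l / (1 - 2 * 0)) (at_right 0)"
    by (intro tendsto_intros) auto
  then have up: "((\<lambda>\<epsilon>::real. ereal (l / (1 - 2 * \<epsilon>))) \<longlongrightarrow> ereal l) (at_right 0)" by simp
  show "(?f \<longlongrightarrow> ereal l) (at_right 0)"
  proof (rule tendsto_sandwich[OF _ _ tendsto_const up])
    show "\<forall>\<^sub>F \<epsilon> in at_right 0. ereal l \<le> ?f \<epsilon>"
      using small by eventually_elim (use liminf_E_d_one_ge[OF l] in auto)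
    show "\<forall>\<^sub>F \<epsilon> in at_right 0. ?f \<epsilon> \<le> ereal (l / (1 - 2 * \<epsilon>))"
      using small by eventually_elim (use liminf_E_d_one_le[OF l] in auto)
  qed
qed simp

lemma D_SEP_reg_eq:
  assumes l: "(\<lambda>n. Dn n / n) \<longlonglongrightarrow> l"
  shows "D_SEP_reg dA dB \<rho> = ereal l"
proof -
  have "(\<lambda>n. ereal (Dn n / n)) \<longlonglongrightarrow> ereal l" using l by simp
  then have "(\<lambda>n. D_SEP_sep (dA ^ n) (dB ^ n) (\<rho>n n) / ereal (real n)) \<longlonglongrightarrow> ereal l"
  proof (rule Lim_transform_eventually)
    \<comment> \<open>The index 0 is left out: real division by 0 yields 0, which division of
      extended reals need not do.\<close>
    show "\<forall>\<^sub>F n in sequentially. ereal (Dn n / n) = D_SEP_sep (dA ^ n) (dB ^ n) (\<rho>n n) / ereal (real n)"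
      using eventually_ge_at_top[of 1] by eventually_elim (simp add: D_SEP_sep_Dn)
  qed
  then show ?thesis unfolding D_SEP_reg_def by (rule limI)
qed

end

theorem propositionS14:
  fixes dA dB :: nat and \<rho> :: "complex mat"
  assumes "\<rho> \<in> states (dA * dB)"
  shows "E_d_DNE dA dB \<rho> = D_SEP_reg dA dB \<rho> \<and>
         D_SEP_reg dA dB \<rho> \<le> ereal (E_kappa_reg dA dB \<rho>) \<and>
         E_kappa_reg dA dB \<rho> \<le> E_kappa dA dB \<rho>"
proof -
  interpret bipartite_state dA dB \<rho> by unfold_locales (rule assms)
  obtain l where l: "(\<lambda>n. Dn n / n) \<longlonglongrightarrow> l" using Dn_limit by blast
  obtain k where k: "(\<lambda>n. Kn n / n) \<longlonglongrightarrow> k" "k \<le> Kn 1" using Kn_limit by blast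
  have "l \<le> k"
    using l k(1) by (rule LIMSEQ_le) (auto intro!: divide_right_mono Dn_le_Kn)
  moreover have "E_kappa_reg dA dB \<rho> = k"
    unfolding E_kappa_reg_def using limI[OF k(1)] by (simp add: Kn_def)
  moreover have "Kn 1 = E_kappa dA dB \<rho>"
    using bip_power_1[OF states_carrier[OF state]] by (simp add: Kn_def)
  ultimately show ?thesis using k(2) by (simp add: E_d_DNE_eq[OF l] D_SEP_reg_eq[OF l])
qed

end
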